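(* Let $H$ be a nonzero complex Hilbert space, let $\Phi: B(H)\to B(H)$ be a unital positive linear map, and let $n\ge 2$ be an integer. Let $\mathbb{A}=(A_1,\dots,A_n)$ be an $n$-tuple of positive definite operators in $B(H)$, and let $\omega=(w_1,\dots,w_n)\in(0,1)^n$ with $\sum_{i=1}^n w_i=1$. Put $\Phi(\mathbb{A})=(\Phi(A_1),\dots,\Phi(A_n))$, let $m_i=\lambda_{\min}(A_i)$ and $M_i=\lambda_{\max}(A_i)$ be the minimum and the maximum of the spectrum of $A_i$, and let $\hbar=\max_{1\le i\le n}\frac{M_i}{m_i}$. Then $$\Lambda(\omega;\Phi(\mathbb{A}))\ \ge\ \Phi(\Lambda(\omega;\mathbb{A}))\ \ge\ \frac{4\hbar}{(1+\hbar)^2}\,\Lambda(\omega;\Phi(\mathbb{A})).$$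
   Context: $B(H)$ is the set of bounded linear operators on $H$; $\le$ is the Loewner order on self-adjoint operators. "Positive definite" means positive and invertible with bounded inverse. A linear map $\Phi$ is positive if $X\ge0$ implies $\Phi(X)\ge 0$, and unital if $\Phi(I)=I$. The weighted Karcher mean $\Lambda(\omega;\mathbb{A})$ is the unique positive definite solution $X$ of the operator equation $\sum_{i=1}^n w_i\log(X^{-1/2}A_iX^{-1/2})=0$ (existence and uniqueness are known). *)

theory Defs
  imports "HOL-Analysis.Analysis" "HOL-Computational_Algebra.Polynomial"
begin

class complex_vector = real_vector +
  fixes scaleC :: "complex \<Rightarrow> 'a \<Rightarrow> 'a"  (infixr "*\<^sub>C" 75)
  assumes scaleC_add_right: "a *\<^sub>C (x + y) = a *\<^sub>C x + a *\<^sub>C y"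
    and scaleC_add_left: "(a + b) *\<^sub>C x = a *\<^sub>C x + b *\<^sub>C x"
    and scaleC_scaleC: "a *\<^sub>C b *\<^sub>C x = (a * b) *\<^sub>C x"
    and scaleC_of_real: "complex_of_real r *\<^sub>C x = r *\<^sub>R x"

text \<open>The norm and the topology are those of the underlying real inner product space, whose inner
  product is the real part of the complex one.  The complex inner product is linear in the first
  argument.\<close>

class complex_hilbert_space = complex_vector + real_inner + banach +
  fixes cinner :: "'a \<Rightarrow> 'a \<Rightarrow> complex"
  assumes cinner_commute: "cinner x y = cnj (cinner y x)"
    and cinner_add_left: "cinner (x + y) z = cinner x z + cinner y z"
    and cinner_scaleC_left: "cinner (c *\<^sub>C x) y = c * cinner x y"
    and Re_cinner: "Re (cinner x y) = inner x y"

class nonzero_complex_hilbert_space = complex_hilbert_space +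
  assumes ex_nonzero: "\<exists>x. x \<noteq> 0"

abbreviation clinear :: "('a::complex_vector \<Rightarrow> 'b::complex_vector) \<Rightarrow> bool" where
  "clinear \<equiv> Vector_Spaces.linear scaleC scaleC"

text \<open>Real-linear bounded maps are provided by the library; the elements of \<open>B(H)\<close> are those that
  are compatible with complex scalars.\<close>

typedef (overloaded) ('a::complex_hilbert_space) bounded_op =
  "{T :: 'a \<Rightarrow>\<^sub>L 'a. \<forall>c x. blinfun_apply T (c *\<^sub>C x) = c *\<^sub>C blinfun_apply T x}"
  morphisms blinfun_of Abs_bounded_op
  by (rule exI[of _ 0])
    (simp, metis (no_types) scaleC_of_real scaleC_scaleC of_real_0 mult_zero_right scaleR_zero_left)

setup_lifting type_definition_bounded_op

lift_definition op_apply :: "'a::complex_hilbert_space bounded_op \<Rightarrow> 'a \<Rightarrow> 'a"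
  is blinfun_apply .

lemma bounded_op_eqI: "(\<And>x. op_apply S x = op_apply T x) \<Longrightarrow> S = T"
  by transfer (rule blinfun_eqI)

lemma scaleC_zero_right [simp]: "c *\<^sub>C (0::'a::complex_vector) = 0"
  using scaleC_add_right[of c 0 0] by simp

lemma scaleC_minus_right: "c *\<^sub>C (- x) = - (c *\<^sub>C (x::'a::complex_vector))"
  using scaleC_add_right[of c x "- x"] by (simp add: eq_neg_iff_add_eq_0 add.commute)

lemma scaleC_diff_right: "c *\<^sub>C (x - y) = c *\<^sub>C x - c *\<^sub>C (y::'a::complex_vector)"
  using scaleC_add_right[of c x "- y"] by (simp add: scaleC_minus_right)

lemma scaleC_scaleR: "c *\<^sub>C r *\<^sub>R x = r *\<^sub>R c *\<^sub>C (x::'a::complex_vector)"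
  by (metis scaleC_of_real scaleC_scaleC mult.commute)

lemma norm_scaleC: "norm (c *\<^sub>C x) = cmod c * norm (x::'a::complex_hilbert_space)"
proof -
  have "cinner (c *\<^sub>C x) (c *\<^sub>C x) = c * cnj (c * cinner x x)"
    using cinner_commute[of x "c *\<^sub>C x"] by (simp add: cinner_scaleC_left)
  also have "cnj (c * cinner x x) = cnj c * cinner x x"
    by (simp add: cinner_commute[of x x, symmetric])
  finally have "cinner (c *\<^sub>C x) (c *\<^sub>C x) = (c * cnj c) * cinner x x"
    by (simp add: mult.assoc)
  also have "c * cnj c = complex_of_real ((cmod c)\<^sup>2)"
    using complex_norm_square[of c] by simp
  finally have "inner (c *\<^sub>C x) (c *\<^sub>C x) = (cmod c)\<^sup>2 * inner x x"
    unfolding Re_cinner[symmetric] by simp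
  hence "(norm (c *\<^sub>C x))\<^sup>2 = (cmod c * norm x)\<^sup>2"
    by (simp add: power2_norm_eq_inner power_mult_distrib)
  thus ?thesis by (rule power2_eq_imp_eq) simp_all
qed

lemma bounded_linear_scaleC_blinfun:
  fixes T :: "'a::complex_hilbert_space \<Rightarrow>\<^sub>L 'a"
  shows "bounded_linear (\<lambda>x. c *\<^sub>C blinfun_apply T x)"
proof (rule bounded_linear_intro)
  show "norm (c *\<^sub>C blinfun_apply T x) \<le> norm x * (cmod c * norm T)" for x
    using mult_left_mono[OF norm_blinfun[of T x], of "cmod c"]
    by (simp add: norm_scaleC mult_ac)
qed (simp_all add: blinfun.add_right blinfun.scaleR_right scaleC_add_right scaleC_scaleR)

instantiation bounded_op :: (complex_hilbert_space) real_normed_algebra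
begin

lift_definition zero_bounded_op :: "'a bounded_op" is 0 by simp
lift_definition plus_bounded_op :: "'a bounded_op \<Rightarrow> 'a bounded_op \<Rightarrow> 'a bounded_op" is "(+)"
  by (simp add: blinfun.add_left scaleC_add_right)
lift_definition minus_bounded_op :: "'a bounded_op \<Rightarrow> 'a bounded_op \<Rightarrow> 'a bounded_op" is "(-)"
  by (simp add: blinfun.diff_left scaleC_diff_right)
lift_definition uminus_bounded_op :: "'a bounded_op \<Rightarrow> 'a bounded_op" is uminus
  by (simp add: blinfun.minus_left scaleC_minus_right)
lift_definition scaleR_bounded_op :: "real \<Rightarrow> 'a bounded_op \<Rightarrow> 'a bounded_op" is scaleR
  by (simp add: blinfun.scaleR_left scaleC_scaleR)
lift_definition times_bounded_op :: "'a bounded_op \<Rightarrow> 'a bounded_op \<Rightarrow> 'a bounded_op"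
  is blinfun_compose by simp
lift_definition norm_bounded_op :: "'a bounded_op \<Rightarrow> real" is norm .

definition "dist (S::'a bounded_op) T = norm (S - T)"
definition "sgn (T::'a bounded_op) = inverse (norm T) *\<^sub>R T"
definition [code del]: "(uniformity :: ('a bounded_op \<times> 'a bounded_op) filter) =
  (INF e\<in>{0<..}. principal {(x, y). dist x y < e})"
definition [code del]: "open (U :: 'a bounded_op set) \<longleftrightarrow>
  (\<forall>x\<in>U. eventually (\<lambda>(x', y). x' = x \<longrightarrow> y \<in> U) uniformity)"

instance
proof
  fix S T U :: "'a bounded_op" and r s :: real
  show "S + T + U = S + (T + U)" "S + T = T + S" "0 + S = S" "- S + S = 0" "S - T = S + - T"
    by (transfer, simp)+
  show "r *\<^sub>R (S + T) = r *\<^sub>R S + r *\<^sub>R T" "(r + s) *\<^sub>R S = r *\<^sub>R S + s *\<^sub>R S"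
    "r *\<^sub>R s *\<^sub>R S = (r * s) *\<^sub>R S" "1 *\<^sub>R S = S"
    by (transfer, simp add: scaleR_right_distrib scaleR_left_distrib)+
  show "S * T * U = S * (T * U)" "(S + T) * U = S * U + T * U" "S * (T + U) = S * T + S * U"
    "r *\<^sub>R S * T = r *\<^sub>R (S * T)" "S * r *\<^sub>R T = r *\<^sub>R (S * T)"
    by (transfer, (rule blinfun_eqI)?,
        simp add: blinfun.add_left blinfun.add_right blinfun.scaleR_left blinfun.scaleR_right)+
  show "norm S = 0 \<longleftrightarrow> S = 0" "norm (S + T) \<le> norm S + norm T"
    "norm (r *\<^sub>R S) = \<bar>r\<bar> * norm S"
    by (transfer, simp add: norm_triangle_ineq)+
  show "norm (S * T) \<le> norm S * norm T"
    by transfer (rule norm_blinfun_compose)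
qed (simp_all add: dist_bounded_op_def sgn_bounded_op_def uniformity_bounded_op_def
      open_bounded_op_def)

end

instantiation bounded_op :: (complex_hilbert_space) complex_vector
begin

lift_definition scaleC_bounded_op :: "complex \<Rightarrow> 'a bounded_op \<Rightarrow> 'a bounded_op"
  is "\<lambda>c T. Blinfun (\<lambda>x. c *\<^sub>C blinfun_apply T x)"
  by (simp add: bounded_linear_Blinfun_apply bounded_linear_scaleC_blinfun scaleC_scaleC mult.commute)

lemma op_apply_scaleC: "op_apply (c *\<^sub>C T) x = c *\<^sub>C op_apply T x"
  by transfer (simp add: bounded_linear_Blinfun_apply bounded_linear_scaleC_blinfun)

lemma op_apply_add: "op_apply (S + T) x = op_apply S x + op_apply T x"
  by transfer (simp add: blinfun.add_left)

lemma op_apply_scaleR: "op_apply (r *\<^sub>R T) x = r *\<^sub>R op_apply T x"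
  by transfer (simp add: blinfun.scaleR_left)

instance
  by standard
    (rule bounded_op_eqI, simp add: op_apply_scaleC op_apply_add op_apply_scaleR
      scaleC_add_right scaleC_add_left scaleC_scaleC scaleC_of_real)+

end

instantiation bounded_op :: (nonzero_complex_hilbert_space) real_normed_algebra_1
begin

lift_definition one_bounded_op :: "'a bounded_op" is id_blinfun by simp

instance
proof
  fix T :: "'a bounded_op"
  show "1 * T = T" "T * 1 = T" by (transfer, rule blinfun_eqI, simp)+
  obtain x :: 'a where x: "x \<noteq> 0" using ex_nonzero by blast
  show n: "norm (1::'a bounded_op) = 1"
  proof transfer
    have "norm (blinfun_apply id_blinfun x) \<le> norm (id_blinfun :: 'a \<Rightarrow>\<^sub>L 'a) * norm x"
      by (rule norm_blinfun)
    hence "1 \<le> norm (id_blinfun :: 'a \<Rightarrow>\<^sub>L 'a)" using x by simp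
    moreover have "norm (id_blinfun :: 'a \<Rightarrow>\<^sub>L 'a) \<le> 1"
      by (rule norm_blinfun_bound) simp_all
    ultimately show "norm (id_blinfun :: 'a \<Rightarrow>\<^sub>L 'a) = 1" by simp
  qed
  show "(0::'a bounded_op) \<noteq> 1" using n norm_zero by (metis zero_neq_one)
qed

end

text \<open>Hence sums, products and powers of operators, the unit, real multiples and norm convergence are
  the usual type class operations, with the product being composition.\<close>

lemma op_apply_times: "op_apply (S * T) x = op_apply S (op_apply T x)"
  by transfer simp

lemma op_apply_one: "op_apply 1 x = x"
  by transfer simp

definition op_self_adjoint :: "'a::complex_hilbert_space bounded_op \<Rightarrow> bool" where
  "op_self_adjoint T \<longleftrightarrow> (\<forall>x y. cinner (op_apply T x) y = cinner x (op_apply T y))"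

definition op_positive :: "'a::complex_hilbert_space bounded_op \<Rightarrow> bool" where
  "op_positive T \<longleftrightarrow> op_self_adjoint T \<and> (\<forall>x. 0 \<le> Re (cinner (op_apply T x) x))"

definition loewner_le :: "'a::complex_hilbert_space bounded_op \<Rightarrow> 'a bounded_op \<Rightarrow> bool"
    (infix "\<le>\<^sub>L" 50) where
  "S \<le>\<^sub>L T \<longleftrightarrow> op_self_adjoint S \<and> op_self_adjoint T \<and> op_positive (T - S)"

definition op_invertible :: "'a::nonzero_complex_hilbert_space bounded_op \<Rightarrow> bool" where
  "op_invertible T \<longleftrightarrow> (\<exists>S. S * T = 1 \<and> T * S = 1)"

definition positive_definite :: "'a::nonzero_complex_hilbert_space bounded_op \<Rightarrow> bool" where
  "positive_definite T \<longleftrightarrow> op_positive T \<and> op_invertible T"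

definition spectrum :: "'a::nonzero_complex_hilbert_space bounded_op \<Rightarrow> complex set" where
  "spectrum T = {z. \<not> op_invertible (T - z *\<^sub>C 1)}"

text \<open>The next two are meaningful for self-adjoint operators, whose spectrum is a nonempty compact
  set of real numbers.\<close>

definition lambda_min :: "'a::nonzero_complex_hilbert_space bounded_op \<Rightarrow> real" where
  "lambda_min T = (LEAST r. complex_of_real r \<in> spectrum T)"

definition lambda_max :: "'a::nonzero_complex_hilbert_space bounded_op \<Rightarrow> real" where
  "lambda_max T = (GREATEST r. complex_of_real r \<in> spectrum T)"

definition op_poly :: "real poly \<Rightarrow> 'a::nonzero_complex_hilbert_space bounded_op \<Rightarrow> 'a bounded_op" where
  "op_poly p T = (\<Sum>k\<le>degree p. coeff p k *\<^sub>R T ^ k)"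

text \<open>Continuous functional calculus of a self-adjoint \<open>T\<close>, for \<open>f\<close> continuous on its spectrum: \<open>f(T)\<close>
  is the common norm limit of \<open>p\<^sub>n(T)\<close> over all sequences of polynomials \<open>p\<^sub>n\<close> that converge to \<open>f\<close>
  uniformly on the spectrum.  (Such sequences exist by the Weierstrass theorem.)\<close>

definition cfc :: "(real \<Rightarrow> real) \<Rightarrow> 'a::nonzero_complex_hilbert_space bounded_op \<Rightarrow> 'a bounded_op" where
  "cfc f T = (THE S. \<forall>p :: nat \<Rightarrow> real poly.
     uniform_limit {r. complex_of_real r \<in> spectrum T} (\<lambda>n. poly (p n)) f sequentially
       \<longrightarrow> (\<lambda>n. op_poly (p n) T) \<longlonglongrightarrow> S)"

definition op_log :: "'a::nonzero_complex_hilbert_space bounded_op \<Rightarrow> 'a bounded_op" where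
  "op_log = cfc ln"

definition op_powr :: "'a::nonzero_complex_hilbert_space bounded_op \<Rightarrow> real \<Rightarrow> 'a bounded_op" where
  "op_powr T a = cfc (\<lambda>r. r powr a) T"

definition karcher_mean ::
  "nat \<Rightarrow> (nat \<Rightarrow> real) \<Rightarrow> (nat \<Rightarrow> 'a::nonzero_complex_hilbert_space bounded_op) \<Rightarrow> 'a bounded_op" where
  "karcher_mean n w A = (THE X. positive_definite X \<and>
     (\<Sum>i=1..n. w i *\<^sub>R op_log (op_powr X (- (1/2)) * A i * op_powr X (- (1/2)))) = 0)"

end

theory Submission
  imports Defs "HOL-Computational_Algebra.Fundamental_Theorem_Algebra"
begin

text \<open>Write \<open>S(X, A) = X\<^sup>1\<^sup>/\<^sup>2 log (X\<^sup>-\<^sup>1\<^sup>/\<^sup>2 A X\<^sup>-\<^sup>1\<^sup>/\<^sup>2) X\<^sup>1\<^sup>/\<^sup>2\<close> for the relative operator entropy and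
  \<open>G\<^sub>A(X) = \<Sum>\<^sub>i w\<^sub>i S(X, A\<^sub>i)\<close>, so that the Karcher mean is the zero of \<open>G\<^sub>A\<close>.  Riemann sums for the
  integral of the logarithm approximate \<open>S(X, A)\<close> by sums of weighted harmonic means of \<open>X\<close> and \<open>A\<close>
  minus multiples of \<open>X\<close>, and harmonic means are monotone in both arguments.  A descent step with
  these approximations shows that \<open>G\<^sub>A(Z) \<ge> 0 \<ge> G\<^sub>A(Y)\<close> implies \<open>Z \<le> Y\<close>, which yields uniqueness and
  (in a quantitative form) existence of the Karcher mean.

  The harmonic means \<open>X ! A\<close> satisfy \<open>\<Phi>(X ! A) \<le> \<Phi>(X) ! \<Phi>(A)\<close>, hence \<open>\<Phi>(S(X, A)) \<le> S(\<Phi>(X), \<Phi>(A))\<close>, and the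
  comparison principle at \<open>Z = \<Phi>(\<Lambda>(A))\<close> gives the first inequality.  For the second one, apply the
  same argument to \<open>A\<^sub>i\<^sup>-\<^sup>1\<close>, invert, and use \<open>\<Phi>(A\<^sub>i) \<le> (1 + h)\<^sup>2 / (4 h) \<Phi>(A\<^sub>i\<^sup>-\<^sup>1)\<^sup>-\<^sup>1\<close> (Kantorovich) and
  \<open>\<Phi>(X\<^sup>-\<^sup>1)\<^sup>-\<^sup>1 \<le> \<Phi>(X)\<close> (Choi).\<close>

section \<open>Bounded operators\<close>

text \<open>\<open>karcher_mean\<close> is a definite description, so it says nothing before
  existence and uniqueness are proved, and in infinite dimension neither compactness nor norm
  convergence of bounded monotone sequences is at hand. The obstacle is that S(X, A) is not monotone
  in X. The sum with N nodes, however, consists of harmonic means minus a multiple H X with H = 1 +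
  1/2 + ... + 1/N. So X plus 1/H times the approximate gradient is a weighted average of harmonic
  means and preserves the order. With the scaling rule S(l X, A) = l (S(X, A) - ln l X), a sharp
  bound Z \<le> l Y with l > 1 would be improved by one such step if N is large. Existence uses
  upper solutions (gradient at most 0) and lower solutions (at least 0); norm convergence comes from
  a strict contraction of the ratio between the two. Sums over right endpoints lie above the
  logarithm, so one of the two error estimates is exact. Inversion exchanges upper and lower
  solutions; this is why the second inequality passes through the inverse operators. The constant 4
  h / (1 + h)^2 is the reciprocal of the Kantorovich constant, which increases with the ratio M /
  m.\<close>

lemma op_apply_bounded_linear: "bounded_linear (op_apply T)"
  by transfer (rule blinfun.bounded_linear_right)

lemmas op_apply_right [simp] =
  linear_add[OF bounded_linear.linear[OF op_apply_bounded_linear]]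
  linear_diff[OF bounded_linear.linear[OF op_apply_bounded_linear]]
  linear_neg[OF bounded_linear.linear[OF op_apply_bounded_linear]]
  linear_0[OF bounded_linear.linear[OF op_apply_bounded_linear]]
  linear_scale[OF bounded_linear.linear[OF op_apply_bounded_linear]]

lemma op_apply_scaleC_right [simp]: "op_apply T (c *\<^sub>C x) = c *\<^sub>C op_apply T x"
  by transfer simp

lemma op_apply_zero [simp]: "op_apply 0 x = 0"
  by transfer simp

lemma op_apply_minus: "op_apply (- T) x = - op_apply T x"
  by transfer (simp add: blinfun.minus_left)

lemma op_apply_diff: "op_apply (S - T) x = op_apply S x - op_apply T x"
  by transfer (simp add: blinfun.diff_left)

lemma op_apply_sum: "op_apply (\<Sum>i\<in>I. T i) x = (\<Sum>i\<in>I. op_apply (T i) x)"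
  by (induction I rule: infinite_finite_induct) (simp_all add: op_apply_add)

lemmas op_apply_left [simp] = op_apply_add op_apply_minus op_apply_diff op_apply_sum op_apply_scaleR
  op_apply_times op_apply_one op_apply_scaleC

lemma norm_op_apply: "norm (op_apply T x) \<le> norm T * norm x"
  by transfer (rule norm_blinfun)

lemma norm_op_bound:
  assumes "0 \<le> b" "\<And>x. norm (op_apply T x) \<le> b * norm x"
  shows "norm T \<le> b"
  using assms by transfer (rule norm_blinfun_bound)

text \<open>The complex-linear maps form a closed subset of the complete space of bounded
  real-linear maps, because norm convergence implies pointwise convergence. Completeness supports
  the Neumann series, the functional calculus and the construction of the Karcher mean.\<close>

instance bounded_op :: (complex_hilbert_space) banach
proof
  fix X :: "nat \<Rightarrow> 'a bounded_op"
  assume X: "Cauchy X"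
  have d: "dist (blinfun_of S) (blinfun_of T) = dist S T" for S T :: "'a bounded_op"
    unfolding dist_norm by transfer simp
  have "Cauchy (\<lambda>n. blinfun_of (X n))"
    using X unfolding Cauchy_def d .
  then obtain L where L: "(\<lambda>n. blinfun_of (X n)) \<longlonglongrightarrow> L"
    by (auto simp: Cauchy_convergent_iff convergent_def)
  have lim: "(\<lambda>n. blinfun_apply (blinfun_of (X n)) x) \<longlonglongrightarrow> blinfun_apply L x" for x
    using L by (intro tendsto_intros)
  have bl: "bounded_linear (\<lambda>x::'a. c *\<^sub>C x)" for c
    by (rule bounded_linear_intro[of _ "cmod c"])
      (simp_all add: scaleC_add_right scaleC_scaleR norm_scaleC mult.commute)
  have "blinfun_apply L (c *\<^sub>C x) = c *\<^sub>C blinfun_apply L x" for c x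
  proof (rule LIMSEQ_unique)
    show "(\<lambda>n. blinfun_apply (blinfun_of (X n)) (c *\<^sub>C x)) \<longlonglongrightarrow> blinfun_apply L (c *\<^sub>C x)"
      by (rule lim)
    have "(\<lambda>n. c *\<^sub>C blinfun_apply (blinfun_of (X n)) x) \<longlonglongrightarrow> c *\<^sub>C blinfun_apply L x"
      by (rule bounded_linear.tendsto[OF bl lim])
    then show "(\<lambda>n. blinfun_apply (blinfun_of (X n)) (c *\<^sub>C x)) \<longlonglongrightarrow> c *\<^sub>C blinfun_apply L x"
      using blinfun_of[of "X _"] by simp
  qed
  then have "blinfun_of (Abs_bounded_op L) = L"
    by (intro Abs_bounded_op_inverse) simp
  with L have "(\<lambda>n. blinfun_of (X n)) \<longlonglongrightarrow> blinfun_of (Abs_bounded_op L)"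
    by simp
  then have "X \<longlonglongrightarrow> Abs_bounded_op L"
    by (simp add: tendsto_iff d)
  then show "convergent X"
    by (auto simp: convergent_def)
qed

text \<open>The imaginary part of \<open>cinner u v\<close> is the real part after replacing u by (-
  \<i>) u, and operators commute with complex scalars. From here on the real inner product is
  enough.\<close>

lemma op_self_adjoint_iff:
  "op_self_adjoint T \<longleftrightarrow> (\<forall>x y. inner (op_apply T x) y = inner x (op_apply T y))"
proof
  assume "op_self_adjoint T"
  then show "\<forall>x y. inner (op_apply T x) y = inner x (op_apply T y)"
    by (simp add: op_self_adjoint_def flip: Re_cinner)
next
  assume *: "\<forall>x y. inner (op_apply T x) y = inner x (op_apply T y)"
  have Im: "Im (cinner u v) = inner ((- \<i>) *\<^sub>C u) v" for u v :: 'a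
    by (simp add: cinner_scaleC_left flip: Re_cinner)
  show "op_self_adjoint T"
    unfolding op_self_adjoint_def
  proof (intro allI complex_eqI)
    fix x y
    show "Re (cinner (op_apply T x) y) = Re (cinner x (op_apply T y))"
      using * by (simp add: Re_cinner)
    show "Im (cinner (op_apply T x) y) = Im (cinner x (op_apply T y))"
      unfolding Im by (metis * op_apply_scaleC_right)
  qed
qed

section \<open>Quadratic forms, the Loewner order and its norm limits\<close>

definition qf :: "'a::complex_hilbert_space bounded_op \<Rightarrow> 'a \<Rightarrow> real" where
  "qf T x = inner (op_apply T x) x"

lemma qf_simps [simp]:
  "qf (S + T) x = qf S x + qf T x" "qf (S - T) x = qf S x - qf T x" "qf (- T) x = - qf T x"
  "qf (r *\<^sub>R T) x = r * qf T x" "qf (\<Sum>i\<in>I. U i) x = (\<Sum>i\<in>I. qf (U i) x)" "qf 0 x = 0"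
  by (simp_all add: qf_def inner_add_left inner_diff_left inner_sum_left)

lemma qf_one [simp]: "qf 1 x = (norm x)\<^sup>2"
  by (simp add: qf_def power2_norm_eq_inner)

lemma op_self_adjointD: "op_self_adjoint T \<Longrightarrow> inner (op_apply T x) y = inner x (op_apply T y)"
  by (simp add: op_self_adjoint_iff)

lemma sa_intros [simp, intro]:
  "op_self_adjoint 0"
  "op_self_adjoint S \<Longrightarrow> op_self_adjoint T \<Longrightarrow> op_self_adjoint (S + T)"
  "op_self_adjoint S \<Longrightarrow> op_self_adjoint T \<Longrightarrow> op_self_adjoint (S - T)"
  "op_self_adjoint T \<Longrightarrow> op_self_adjoint (- T)"
  "op_self_adjoint T \<Longrightarrow> op_self_adjoint (r *\<^sub>R T)"
  by (simp_all add: op_self_adjoint_iff inner_add_left inner_add_right inner_diff_left inner_diff_right)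

lemma sa_one [simp, intro]: "op_self_adjoint 1"
  by (simp add: op_self_adjoint_iff)

lemma sa_sum [intro]: "(\<And>i. i \<in> I \<Longrightarrow> op_self_adjoint (T i)) \<Longrightarrow> op_self_adjoint (\<Sum>i\<in>I. T i)"
  by (induction I rule: infinite_finite_induct) auto

lemma sa_times:
  "op_self_adjoint S \<Longrightarrow> op_self_adjoint T \<Longrightarrow> S * T = T * S \<Longrightarrow> op_self_adjoint (S * T)"
  unfolding op_self_adjoint_iff by (metis op_apply_times)

lemma sa_congruence: "op_self_adjoint C \<Longrightarrow> op_self_adjoint T \<Longrightarrow> op_self_adjoint (C * T * C)"
  by (simp add: op_self_adjoint_iff)

lemma qf_congruence: "op_self_adjoint C \<Longrightarrow> qf (C * T * C) x = qf T (op_apply C x)"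
  by (simp add: qf_def op_self_adjoint_iff)

lemma op_positive_iff: "op_positive T \<longleftrightarrow> op_self_adjoint T \<and> (\<forall>x. 0 \<le> qf T x)"
  by (simp add: op_positive_def qf_def Re_cinner)

lemma loewner_le_iff:
  "S \<le>\<^sub>L T \<longleftrightarrow> op_self_adjoint S \<and> op_self_adjoint T \<and> (\<forall>x. qf S x \<le> qf T x)"
  by (auto simp: loewner_le_def op_positive_iff)

lemma loewner_le_trans [trans]: "S \<le>\<^sub>L T \<Longrightarrow> T \<le>\<^sub>L U \<Longrightarrow> S \<le>\<^sub>L U"
  unfolding loewner_le_iff by (meson order_trans)

lemma loewner_le_refl: "op_self_adjoint T \<Longrightarrow> T \<le>\<^sub>L T"
  by (simp add: loewner_le_iff)

lemma loewner_add_mono: "S \<le>\<^sub>L T \<Longrightarrow> S' \<le>\<^sub>L T' \<Longrightarrow> S + S' \<le>\<^sub>L T + T'"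
  by (auto simp: loewner_le_iff intro: add_mono)

lemma loewner_scaleR_mono: "0 \<le> r \<Longrightarrow> S \<le>\<^sub>L T \<Longrightarrow> r *\<^sub>R S \<le>\<^sub>L r *\<^sub>R T"
  by (auto simp: loewner_le_iff intro: mult_left_mono)

lemma loewner_sum_mono: "(\<And>i. i \<in> I \<Longrightarrow> S i \<le>\<^sub>L T i) \<Longrightarrow> (\<Sum>i\<in>I. S i) \<le>\<^sub>L (\<Sum>i\<in>I. T i)"
  by (auto simp: loewner_le_iff intro: sum_mono)

lemma loewner_congruence: "op_self_adjoint C \<Longrightarrow> S \<le>\<^sub>L T \<Longrightarrow> C * S * C \<le>\<^sub>L C * T * C"
  by (auto simp: loewner_le_iff qf_congruence sa_congruence)

lemma inner_sa_polarization:
  assumes "op_self_adjoint T"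
  shows "4 * inner (op_apply T x) y = qf T (x + y) - qf T (x - y)"
  using op_self_adjointD[OF assms, of y x]
  by (simp add: qf_def inner_add_left inner_add_right inner_diff_left inner_diff_right
      inner_commute)

text \<open>Test with the vector y that has the direction of \<open>op_apply T x\<close> and the
  norm of x. Polarization and the parallelogram law turn the bound on the quadratic form into one on
  the operator norm.\<close>

lemma norm_sa_le:
  assumes T: "op_self_adjoint T" and c: "0 \<le> c" "\<And>x. \<bar>qf T x\<bar> \<le> c * (norm x)\<^sup>2"
  shows "norm T \<le> c"
proof (rule norm_op_bound[OF c(1)])
  fix x
  show "norm (op_apply T x) \<le> c * norm x"
  proof (cases "op_apply T x = 0 \<or> x = 0")
    case False
    define y where "y = (norm x / norm (op_apply T x)) *\<^sub>R op_apply T x"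
    have y: "norm y = norm x" using False by (simp add: y_def)
    have "4 * inner (op_apply T x) y \<le> c * (norm (x + y))\<^sup>2 + c * (norm (x - y))\<^sup>2"
      using c(2)[of "x + y"] c(2)[of "x - y"] by (simp add: inner_sa_polarization[OF T])
    also have "\<dots> = c * ((norm (x + y))\<^sup>2 + (norm (x - y))\<^sup>2)" by (simp add: distrib_left)
    also have "(norm (x + y))\<^sup>2 + (norm (x - y))\<^sup>2 = 2 * (norm x)\<^sup>2 + 2 * (norm y)\<^sup>2"
      by (simp add: power2_norm_eq_inner inner_add_left inner_add_right inner_diff_left
          inner_diff_right)
    finally have "inner (op_apply T x) y \<le> c * (norm x)\<^sup>2" by (simp add: y)
    moreover have "inner (op_apply T x) y = norm x * norm (op_apply T x)"
      using False by (simp add: y_def power2_eq_square flip: power2_norm_eq_inner)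
    ultimately show ?thesis using False by (simp add: power2_eq_square mult_ac)
  qed (use c(1) in auto)
qed

lemma qf_le_norm: "\<bar>qf T x\<bar> \<le> norm T * (norm x)\<^sup>2"
proof -
  have "\<bar>qf T x\<bar> \<le> norm (op_apply T x) * norm x"
    unfolding qf_def by (rule Cauchy_Schwarz_ineq2)
  also have "\<dots> \<le> norm T * norm x * norm x"
    by (rule mult_right_mono[OF norm_op_apply]) simp
  finally show ?thesis by (simp add: power2_eq_square mult_ac)
qed

lemma norm_le_of_loewner:
  assumes "- (c *\<^sub>R 1) \<le>\<^sub>L T" "T \<le>\<^sub>L c *\<^sub>R 1" "0 \<le> c"
  shows "norm T \<le> c"
  using assms by (intro norm_sa_le) (auto simp: loewner_le_iff abs_le_iff minus_le_iff)

lemma loewner_antisym: "S \<le>\<^sub>L T \<Longrightarrow> T \<le>\<^sub>L S \<Longrightarrow> S = T"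
  using norm_sa_le[of "S - T" 0] by (fastforce simp: loewner_le_iff intro: antisym)

lemma tendsto_op_apply: "(F \<longlongrightarrow> T) \<A> \<Longrightarrow> ((\<lambda>n. op_apply (F n) x) \<longlongrightarrow> op_apply T x) \<A>"
  by (rule bounded_linear.tendsto[where f = "\<lambda>T. op_apply T x"])
    (auto intro!: bounded_linear_intro[of _ "norm x"] simp: norm_op_apply)

lemma tendsto_qf: "(F \<longlongrightarrow> T) \<A> \<Longrightarrow> ((\<lambda>n. qf (F n) x) \<longlongrightarrow> qf T x) \<A>"
  unfolding qf_def by (intro tendsto_intros tendsto_op_apply)

lemma sa_limit:
  assumes "F \<longlonglongrightarrow> T" "\<And>n. op_self_adjoint (F n)"
  shows "op_self_adjoint T"
  unfolding op_self_adjoint_iff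
proof (intro allI)
  fix x y
  have "(\<lambda>n. inner (op_apply (F n) x) y) \<longlonglongrightarrow> inner (op_apply T x) y"
    "(\<lambda>n. inner x (op_apply (F n) y)) \<longlonglongrightarrow> inner x (op_apply T y)"
    using assms(1) by (auto intro!: tendsto_intros tendsto_op_apply)
  then show "inner (op_apply T x) y = inner x (op_apply T y)"
    using assms(2) by (simp add: op_self_adjoint_iff LIMSEQ_unique)
qed

lemma loewner_limit:
  assumes "F \<longlonglongrightarrow> S" "G \<longlonglongrightarrow> T" "\<And>n. F n \<le>\<^sub>L G n"
  shows "S \<le>\<^sub>L T"
  using assms sa_limit[of F S] sa_limit[of G T]
  unfolding loewner_le_iff
  by (auto intro: LIMSEQ_le[OF tendsto_qf tendsto_qf])

section \<open>Inverses\<close>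

definition op_inv :: "'a::nonzero_complex_hilbert_space bounded_op \<Rightarrow> 'a bounded_op" where
  "op_inv T = (SOME S. S * T = 1 \<and> T * S = 1)"

lemma op_inv:
  assumes "op_invertible T"
  shows "op_inv T * T = 1" "T * op_inv T = 1"
proof -
  have "op_inv T * T = 1 \<and> T * op_inv T = 1"
    unfolding op_inv_def using assms unfolding op_invertible_def by (rule someI_ex)
  then show "op_inv T * T = 1" "T * op_inv T = 1" by auto
qed

lemma op_inv_cancel [simp]:
  assumes "op_invertible T"
  shows "op_inv T * (T * S) = S" "T * (op_inv T * S) = S"
  by (simp_all add: assms op_inv flip: mult.assoc)

lemma op_apply_op_inv [simp]:
  assumes "op_invertible T"
  shows "op_apply T (op_apply (op_inv T) x) = x" "op_apply (op_inv T) (op_apply T x) = x"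
  using arg_cong[OF op_inv(2)[OF assms], of "\<lambda>S. op_apply S x"]
    arg_cong[OF op_inv(1)[OF assms], of "\<lambda>S. op_apply S x"] by simp_all

lemma op_invertibleI: "S * T = 1 \<Longrightarrow> T * S = 1 \<Longrightarrow> op_invertible T"
  unfolding op_invertible_def by blast

lemma op_inv_unique: "S * T = 1 \<Longrightarrow> T * S = 1 \<Longrightarrow> op_inv T = S"
  by (metis mult.assoc mult_1 mult_1_right op_inv(1) op_invertibleI)

lemma op_invertible_op_inv [simp]: "op_invertible T \<Longrightarrow> op_invertible (op_inv T)"
  by (meson op_inv op_invertibleI)

lemma op_inv_op_inv [simp]: "op_invertible T \<Longrightarrow> op_inv (op_inv T) = T"
  by (meson op_inv op_inv_unique)

lemma op_invertible_times:
  assumes "op_invertible S" "op_invertible T"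
  shows "op_invertible (S * T)"
  by (rule op_invertibleI[of "op_inv T * op_inv S"]) (use assms in \<open>simp_all add: mult.assoc op_inv\<close>)

lemma op_inv_times:
  assumes "op_invertible S" "op_invertible T"
  shows "op_inv (S * T) = op_inv T * op_inv S"
  by (rule op_inv_unique) (use assms in \<open>simp_all add: mult.assoc op_inv\<close>)

lemma op_inv_one [simp]: "op_inv 1 = 1"
  by (rule op_inv_unique) simp_all

lemma op_invertible_one [simp]: "op_invertible 1"
  by (rule op_invertibleI[of 1]) simp_all

lemma op_invertible_scaleR: "r \<noteq> 0 \<Longrightarrow> op_invertible T \<Longrightarrow> op_invertible (r *\<^sub>R T)"
  by (rule op_invertibleI[of "(1/r) *\<^sub>R op_inv T"]) (simp_all add: op_inv)

lemma op_inv_scaleR: "r \<noteq> 0 \<Longrightarrow> op_invertible T \<Longrightarrow> op_inv (r *\<^sub>R T) = (1/r) *\<^sub>R op_inv T"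
  by (rule op_inv_unique) (simp_all add: op_inv)

lemma sa_op_inv:
  assumes "op_self_adjoint T" "op_invertible T"
  shows "op_self_adjoint (op_inv T)"
  unfolding op_self_adjoint_iff
proof (intro allI)
  fix x y
  show "inner (op_apply (op_inv T) x) y = inner x (op_apply (op_inv T) y)"
    using op_self_adjointD[OF assms(1), of "op_apply (op_inv T) x" "op_apply (op_inv T) y"]
    by (simp add: assms(2))
qed

text \<open>The inverse is the Neumann series.\<close>

lemma op_invertible_one_minus:
  fixes E :: "'a::nonzero_complex_hilbert_space bounded_op"
  assumes "norm E < 1"
  shows "op_invertible (1 - E)"
proof -
  have s: "summable (\<lambda>n. E ^ n)"
  proof (rule summable_comparison_test')
    show "summable (\<lambda>n. norm E ^ n)" using assms by (simp add: summable_geometric)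
    show "norm (E ^ n) \<le> norm E ^ n" for n by (rule norm_power_ineq)
  qed
  define S where "S = (\<Sum>n. E ^ n)"
  have split: "S = 1 + (\<Sum>n. E ^ Suc n)"
    unfolding S_def using suminf_split_head[OF s] by simp
  have "(\<Sum>n. E ^ Suc n) = E * S" "(\<Sum>n. E ^ Suc n) = S * E"
    unfolding S_def using suminf_mult[OF s, of E] suminf_mult2[OF s, of E]
    by (simp_all add: power_commutes)
  with split have "S = 1 + E * S" "S = 1 + S * E" by auto
  then show ?thesis
    by (intro op_invertibleI[of S]) (simp_all add: algebra_simps)
qed

text \<open>T lies between m and M = \<open>norm T + m\<close>, so 1 - T / M has norm at most 1 - m
  / M < 1 and the Neumann series inverts T / M.\<close>

lemma op_invertible_of_bounded_below:
  assumes T: "op_self_adjoint T" and m: "0 < m" "\<And>x. m * (norm x)\<^sup>2 \<le> qf T x"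
  shows "op_invertible T"
proof -
  define M where "M = norm T + m"
  have M: "0 < M" "m \<le> M" using m(1) by (simp_all add: M_def add_nonneg_pos)
  have "norm (1 - (1/M) *\<^sub>R T) \<le> 1 - m / M"
  proof (rule norm_sa_le)
    fix x
    have "qf T x \<le> M * (norm x)\<^sup>2"
      using qf_le_norm[of T x] mult_nonneg_nonneg[OF less_imp_le[OF m(1)] zero_le_power2[of "norm x"]]
      unfolding M_def distrib_right by linarith
    then have "qf T x / M \<le> (norm x)\<^sup>2" using M by (simp add: field_simps)
    moreover have "m / M * (norm x)\<^sup>2 \<le> qf T x / M"
      using m(2)[of x] M by (simp add: field_simps)
    moreover have "m / M * (norm x)\<^sup>2 \<le> 1 * (norm x)\<^sup>2"
      using M by (intro mult_right_mono) auto
    ultimately show "\<bar>qf (1 - (1/M) *\<^sub>R T) x\<bar> \<le> (1 - m / M) * (norm x)\<^sup>2"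
      by (simp add: abs_le_iff left_diff_distrib)
  qed (use T M in auto)
  also have "\<dots> < 1" using m(1) M by simp
  finally have "op_invertible (1 - (1 - (1/M) *\<^sub>R T))" by (rule op_invertible_one_minus)
  then show ?thesis using op_invertible_scaleR[of M "(1/M) *\<^sub>R T"] M by simp
qed

text \<open>Expand the nonnegative form of T at x - r y with y = T x and r = 1 /
  \<open>norm T\<close>, and bound the form at y by \<open>norm T\<close> times the squared norm of
  y.\<close>

lemma op_positive_cauchy_schwarz:
  assumes "op_positive T"
  shows "(norm (op_apply T x))\<^sup>2 \<le> norm T * qf T x"
proof -
  have T: "op_self_adjoint T" "\<And>x. 0 \<le> qf T x" using assms by (auto simp: op_positive_iff)
  define y where "y = op_apply T x"
  have expand: "qf T (x - r *\<^sub>R y) = qf T x - 2 * r * (norm y)\<^sup>2 + r\<^sup>2 * qf T y" for r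
    using op_self_adjointD[OF T(1), of y x]
    by (simp add: qf_def inner_diff_left inner_diff_right dot_square_norm y_def
        inner_commute power2_eq_square algebra_simps)
  show ?thesis
  proof (cases "norm T = 0")
    case False
    then have N: "norm T > 0" by simp
    have "(1 / norm T)\<^sup>2 * qf T y \<le> (1 / norm T)\<^sup>2 * (norm T * (norm y)\<^sup>2)"
      by (intro mult_left_mono) (use qf_le_norm[of T y] in auto)
    also have "\<dots> = (norm y)\<^sup>2 / norm T" using N by (simp add: power2_eq_square)
    finally have "0 \<le> qf T x - (norm y)\<^sup>2 / norm T"
      using T(2)[of "x - (1 / norm T) *\<^sub>R y"] unfolding expand by simp
    then show ?thesis using N by (simp add: y_def field_simps)
  qed simp
qed

text \<open>A uniform lower bound replaces invertibility; unlike the latter it passes upwards in the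
  Loewner order. For the forward direction, the norm of x is at most \<open>norm S\<close> times
  that of T x, which \<open>op_positive_cauchy_schwarz\<close> bounds by the form.\<close>

lemma positive_definite_iff:
  "positive_definite T \<longleftrightarrow> (\<exists>m>0. m *\<^sub>R 1 \<le>\<^sub>L T)"
proof
  assume "positive_definite T"
  then have T: "op_positive T" "op_invertible T" by (auto simp: positive_definite_def)
  define S where "S = op_inv T"
  have S0: "norm S > 0" and T0: "norm T > 0"
    using op_inv[OF T(2)] by (auto simp: S_def)
  have "1 / ((norm S)\<^sup>2 * norm T) * (norm x)\<^sup>2 \<le> qf T x" for x
  proof -
    have "norm x \<le> norm S * norm (op_apply T x)"
      using norm_op_apply[of S "op_apply T x"] T(2) by (simp add: S_def)
    then have "(norm x)\<^sup>2 \<le> (norm S)\<^sup>2 * (norm (op_apply T x))\<^sup>2"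
      by (metis norm_ge_zero power_mono power_mult_distrib)
    also have "\<dots> \<le> (norm S)\<^sup>2 * (norm T * qf T x)"
      by (intro mult_left_mono op_positive_cauchy_schwarz T) auto
    finally show ?thesis using S0 T0 by (simp add: field_simps)
  qed
  then show "\<exists>m>0. m *\<^sub>R 1 \<le>\<^sub>L T"
    using S0 T0 T(1) by (intro exI[of _ "1 / ((norm S)\<^sup>2 * norm T)"])
      (auto simp: loewner_le_iff op_positive_iff)
next
  assume "\<exists>m>0. m *\<^sub>R 1 \<le>\<^sub>L T"
  then obtain m where m: "m > 0" "m *\<^sub>R 1 \<le>\<^sub>L T" by blast
  then have "op_self_adjoint T" "\<And>x. m * (norm x)\<^sup>2 \<le> qf T x" by (auto simp: loewner_le_iff)
  moreover from this m(1) have "0 \<le> qf T x" for x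
    by (meson less_imp_le mult_nonneg_nonneg order_trans zero_le_power2)
  ultimately show "positive_definite T"
    using m(1) op_invertible_of_bounded_below[of T m]
    by (auto simp: positive_definite_def op_positive_iff)
qed

lemma positive_definiteD:
  assumes "positive_definite T"
  shows "op_invertible T" "op_self_adjoint T" "op_positive T" "0 \<le> qf T x"
  using assms by (auto simp: positive_definite_def op_positive_iff)

lemma positive_definite_mono: "positive_definite S \<Longrightarrow> S \<le>\<^sub>L T \<Longrightarrow> positive_definite T"
  unfolding positive_definite_iff by (meson loewner_le_trans)

lemma positive_definite_scaleR:
  assumes "0 < r" "positive_definite T"
  shows "positive_definite (r *\<^sub>R T)"
proof -
  obtain m where "m > 0" "m *\<^sub>R 1 \<le>\<^sub>L T" using assms by (auto simp: positive_definite_iff)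
  then have "r * m > 0 \<and> (r * m) *\<^sub>R 1 \<le>\<^sub>L r *\<^sub>R T"
    using loewner_scaleR_mono[of r "m *\<^sub>R 1" T] assms(1) by simp
  then show ?thesis unfolding positive_definite_iff by blast
qed

lemma positive_definite_one [simp]: "positive_definite 1"
  unfolding positive_definite_iff by (intro exI[of _ 1]) (simp add: loewner_le_iff)

lemma positive_definite_add:
  "positive_definite S \<Longrightarrow> op_positive T \<Longrightarrow> positive_definite (S + T)"
  by (rule positive_definite_mono[of S]) (auto simp: loewner_le_iff op_positive_iff positive_definiteD)

lemma positive_definite_congruence:
  assumes "op_self_adjoint C" "op_invertible C" "positive_definite T"
  shows "positive_definite (C * T * C)"
  unfolding positive_definite_def
  using assms positive_definiteD[OF assms(3)]
  by (auto simp: op_positive_iff sa_congruence qf_congruence intro!: op_invertible_times)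

lemma positive_definite_op_inv:
  assumes "positive_definite T"
  shows "positive_definite (op_inv T)"
proof -
  have "positive_definite (op_inv T * T * op_inv T)"
    using assms by (intro positive_definite_congruence) (auto simp: positive_definiteD sa_op_inv)
  then show ?thesis using assms by (simp add: positive_definiteD op_inv)
qed

text \<open>Completing the square: the difference of the two sides is the form of A at y - z with z
  = A^-1 x, so equality holds at y = z.\<close>

lemma qf_op_inv_ge:
  assumes "positive_definite A"
  shows "2 * inner x y - qf A y \<le> qf (op_inv A) x"
proof -
  define z where "z = op_apply (op_inv A) x"
  have A: "op_self_adjoint A" "op_invertible A" using assms by (auto simp: positive_definiteD)
  have Az: "op_apply A z = x" by (simp add: z_def A)
  have "0 \<le> qf A (y - z)" using assms by (simp add: positive_definiteD)
  also have "\<dots> = qf A y - 2 * inner x y + qf (op_inv A) x"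
    using op_self_adjointD[OF A(1), of y z]
    by (simp add: qf_def inner_diff_left inner_diff_right Az inner_commute flip: z_def)
  finally show ?thesis by simp
qed

text \<open>The quadratic form of the inverse is the supremum of the left-hand side of
  \<open>qf_op_inv_ge\<close> over \<open>y\<close>, which is antitone in the operator.\<close>

lemma op_inv_antimono:
  assumes A: "positive_definite A" and AB: "A \<le>\<^sub>L B"
  shows "op_inv B \<le>\<^sub>L op_inv A"
proof -
  have B: "positive_definite B" by (rule positive_definite_mono[OF A AB])
  have "qf (op_inv B) x \<le> qf (op_inv A) x" for x
  proof -
    define y where "y = op_apply (op_inv B) x"
    have "op_apply B y = x"
      using B by (simp add: y_def positive_definiteD)
    then have "qf (op_inv B) x = 2 * inner x y - qf B y"
      by (simp add: qf_def inner_commute flip: y_def)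
    also have "\<dots> \<le> 2 * inner x y - qf A y" using AB by (simp add: loewner_le_iff)
    also have "\<dots> \<le> qf (op_inv A) x" by (rule qf_op_inv_ge[OF A])
    finally show ?thesis .
  qed
  then show ?thesis
    using A B by (auto simp: loewner_le_iff positive_definiteD positive_definite_op_inv)
qed

text \<open>X^-1 - Y^-1 = X^-1 (Y - X) Y^-1, and the common lower bound a keeps the norms of all
  inverses below 1 / a.\<close>

lemma tendsto_op_inv:
  assumes X: "X \<longlonglongrightarrow> Y" and a: "0 < a" "\<And>n. a *\<^sub>R 1 \<le>\<^sub>L X n"
  shows "(\<lambda>n. op_inv (X n)) \<longlonglongrightarrow> op_inv Y"
proof -
  have pd: "positive_definite (X n)" for n
    using a unfolding positive_definite_iff by blast
  have aY: "a *\<^sub>R 1 \<le>\<^sub>L Y"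
    by (rule loewner_limit[OF tendsto_const X a(2)])
  then have Y: "positive_definite Y" using a(1) unfolding positive_definite_iff by blast
  have bd: "norm (op_inv T) \<le> 1 / a" if T: "a *\<^sub>R 1 \<le>\<^sub>L T" for T :: "'a bounded_op"
  proof -
    have T': "positive_definite T" using a(1) T unfolding positive_definite_iff by blast
    have "op_inv T \<le>\<^sub>L op_inv (a *\<^sub>R 1)"
      using a(1) T by (intro op_inv_antimono positive_definite_scaleR) auto
    moreover have "op_inv (a *\<^sub>R 1) = (1/a) *\<^sub>R (1::'a bounded_op)"
      using a(1) by (simp add: op_inv_scaleR)
    moreover have "- ((1/a) *\<^sub>R 1) \<le>\<^sub>L op_inv T"
      using positive_definite_op_inv[OF T'] a(1)
      by (auto simp: loewner_le_iff positive_definiteD intro: order_trans[OF _ positive_definiteD(4)])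
    ultimately show ?thesis using a(1) by (intro norm_le_of_loewner) auto
  qed
  have bound: "norm (op_inv (X n) - op_inv Y) \<le> norm (X n - Y) * (1/a)\<^sup>2" for n
  proof -
    have "op_inv (X n) - op_inv Y = op_inv (X n) * (Y - X n) * op_inv Y"
      using pd[of n] Y by (simp add: algebra_simps positive_definiteD op_inv)
    also have "norm \<dots> \<le> norm (op_inv (X n)) * norm (Y - X n) * norm (op_inv Y)"
      by (meson mult_right_mono norm_ge_zero norm_mult_ineq order_trans)
    also have "\<dots> \<le> (1/a) * norm (Y - X n) * (1/a)"
      using a by (intro mult_mono bd aY) auto
    finally show ?thesis by (simp add: norm_minus_commute power2_eq_square mult_ac)
  qed
  have null: "(\<lambda>n. norm (X n - Y) * (1/a)\<^sup>2) \<longlonglongrightarrow> 0"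
    using X by (intro tendsto_mult_left_zero tendsto_norm_zero LIM_zero)
  have "(\<lambda>n. op_inv (X n) - op_inv Y) \<longlonglongrightarrow> 0"
    by (rule Lim_null_comparison[OF always_eventually null]) (rule allI, rule bound)
  then show ?thesis
    by (rule LIM_zero_cancel)
qed

section \<open>Continuous functional calculus\<close>

definition rspec :: "'a::nonzero_complex_hilbert_space bounded_op \<Rightarrow> real set" where
  "rspec T = {r. complex_of_real r \<in> spectrum T}"

lemma rspec_iff: "r \<in> rspec T \<longleftrightarrow> \<not> op_invertible (T - r *\<^sub>R 1)"
  by (simp add: rspec_def spectrum_def scaleC_of_real)

lemma positive_definite_diff_scaleR:
  assumes "m *\<^sub>R 1 \<le>\<^sub>L T" "r < m"
  shows "positive_definite (T - r *\<^sub>R 1)"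
  unfolding positive_definite_iff
  by (intro exI[of _ "m - r"]) (use assms in \<open>auto simp: loewner_le_iff algebra_simps\<close>)

lemma rspec_ge: "m *\<^sub>R 1 \<le>\<^sub>L T \<Longrightarrow> r \<in> rspec T \<Longrightarrow> m \<le> r"
  by (meson rspec_iff not_le positive_definite_diff_scaleR positive_definiteD(1))

lemma rspec_uminus: "r \<in> rspec (- T) \<longleftrightarrow> - r \<in> rspec T"
proof -
  have "op_invertible (- S)" if "op_invertible S" for S :: "'a bounded_op"
    using op_invertible_scaleR[of "-1" S] that by simp
  moreover have "- T - r *\<^sub>R 1 = - (T + r *\<^sub>R 1)" by simp
  ultimately have "op_invertible (- T - r *\<^sub>R 1) \<longleftrightarrow> op_invertible (T + r *\<^sub>R 1)"
    by (metis minus_minus)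
  then show ?thesis by (simp add: rspec_iff)
qed

lemma rspec_le: "T \<le>\<^sub>L M *\<^sub>R 1 \<Longrightarrow> r \<in> rspec T \<Longrightarrow> r \<le> M"
  using rspec_ge[of "- M" "- T" "- r"] by (auto simp: rspec_uminus loewner_le_iff)

lemma loewner_norm_bounds:
  assumes "op_self_adjoint T"
  shows "(- norm T) *\<^sub>R 1 \<le>\<^sub>L T" "T \<le>\<^sub>L norm T *\<^sub>R 1"
proof -
  have "- (norm T * (norm x)\<^sup>2) \<le> qf T x" "qf T x \<le> norm T * (norm x)\<^sup>2" for x
    using qf_le_norm[of T x] by (auto simp: abs_le_iff)
  then show "(- norm T) *\<^sub>R 1 \<le>\<^sub>L T" "T \<le>\<^sub>L norm T *\<^sub>R 1"
    using assms by (auto simp: loewner_le_iff)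
qed

lemma rspec_subset: "m *\<^sub>R 1 \<le>\<^sub>L T \<Longrightarrow> T \<le>\<^sub>L M *\<^sub>R 1 \<Longrightarrow> rspec T \<subseteq> {m..M}"
  by (auto simp: rspec_ge rspec_le)

text \<open>The infimum of the numerical range belongs to the spectrum, because a positive operator
  that is invertible is bounded below.\<close>

lemma rspec_minimum:
  fixes T :: "'a::nonzero_complex_hilbert_space bounded_op"
  assumes T: "op_self_adjoint T"
  obtains \<mu> where "\<mu> \<in> rspec T" "\<mu> *\<^sub>R 1 \<le>\<^sub>L T"
proof -
  define V where "V = qf T ` {x. norm x = 1}"
  obtain z :: 'a where "z \<noteq> 0" using ex_nonzero by blast
  then have "norm ((1 / norm z) *\<^sub>R z) = 1" by simp
  then have ne: "V \<noteq> {}" unfolding V_def by blast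
  have bdd: "bdd_below V"
  proof (rule bdd_belowI)
    fix v assume "v \<in> V"
    then obtain x where "norm x = 1" "v = qf T x" by (auto simp: V_def)
    then show "- norm T \<le> v" using qf_le_norm[of T x] by (simp add: abs_le_iff)
  qed
  define \<mu> where "\<mu> = Inf V"
  have le: "\<mu> *\<^sub>R 1 \<le>\<^sub>L T"
  proof -
    have "\<mu> * (norm x)\<^sup>2 \<le> qf T x" for x
    proof (cases "x = 0")
      case False
      define y where "y = (1 / norm x) *\<^sub>R x"
      have "qf T y \<in> V" using False by (auto simp: V_def y_def)
      then have "\<mu> \<le> qf T y" unfolding \<mu>_def by (rule cInf_lower[OF _ bdd])
      also have "qf T y = qf T x / (norm x)\<^sup>2" by (simp add: y_def qf_def power2_eq_square)
      finally show ?thesis using False by (simp add: field_simps)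
    qed (simp add: qf_def)
    then show ?thesis using T by (auto simp: loewner_le_iff)
  qed
  have "\<not> op_invertible (T - \<mu> *\<^sub>R 1)"
  proof
    assume "op_invertible (T - \<mu> *\<^sub>R 1)"
    then have "positive_definite (T - \<mu> *\<^sub>R 1)"
      using le by (auto simp: positive_definite_def op_positive_iff loewner_le_iff)
    then obtain m where m: "m > 0" "m *\<^sub>R 1 \<le>\<^sub>L T - \<mu> *\<^sub>R 1" by (auto simp: positive_definite_iff)
    have "m + \<mu> \<le> Inf V"
    proof (rule cInf_greatest[OF ne])
      fix v assume "v \<in> V"
      then obtain x where x: "norm x = 1" "v = qf T x" by (auto simp: V_def)
      have "qf (m *\<^sub>R 1) x \<le> qf (T - \<mu> *\<^sub>R 1) x"
        using m(2) by (simp add: loewner_le_iff del: qf_simps)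
      then show "m + \<mu> \<le> v" by (simp add: x)
    qed
    then show False using m(1) by (simp add: \<mu>_def)
  qed
  then show thesis using le that by (auto simp: rspec_iff)
qed

text \<open>The witness of \<open>rspec_minimum\<close> lies in the spectrum and bounds it from
  below, so the \<open>LEAST\<close> is attained.\<close>

lemma lambda_min:
  assumes T: "op_self_adjoint T"
  shows "lambda_min T *\<^sub>R 1 \<le>\<^sub>L T" "lambda_min T \<in> rspec T"
proof -
  obtain \<mu> where \<mu>: "\<mu> \<in> rspec T" "\<mu> *\<^sub>R 1 \<le>\<^sub>L T" using rspec_minimum[OF T] .
  have "lambda_min T = \<mu>"
    unfolding lambda_min_def
    by (rule Least_equality) (use \<mu> rspec_ge[OF \<mu>(2)] in \<open>auto simp: rspec_def\<close>)
  then show "lambda_min T *\<^sub>R 1 \<le>\<^sub>L T" "lambda_min T \<in> rspec T" using \<mu> by auto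
qed

lemma lambda_max:
  assumes T: "op_self_adjoint T"
  shows "T \<le>\<^sub>L lambda_max T *\<^sub>R 1" "lambda_max T \<in> rspec T"
proof -
  obtain \<mu> where \<mu>: "\<mu> \<in> rspec (- T)" "\<mu> *\<^sub>R 1 \<le>\<^sub>L - T"
    using rspec_minimum[of "- T"] T by blast
  have le: "T \<le>\<^sub>L (- \<mu>) *\<^sub>R 1" using \<mu>(2) T by (auto simp: loewner_le_iff le_minus_iff)
  have "lambda_max T = - \<mu>"
    unfolding lambda_max_def
    by (rule Greatest_equality) (use \<mu>(1)[unfolded rspec_uminus] rspec_le[OF le] in \<open>auto simp: rspec_def\<close>)
  then show "T \<le>\<^sub>L lambda_max T *\<^sub>R 1" "lambda_max T \<in> rspec T"
    using \<mu> le by (auto simp: rspec_uminus)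
qed

section \<open>Polynomials in a self-adjoint operator and their positivity on the spectrum\<close>

lemma op_poly_alt: "degree p \<le> n \<Longrightarrow> op_poly p T = (\<Sum>k\<le>n. coeff p k *\<^sub>R T ^ k)"
  unfolding op_poly_def
  by (rule sum.mono_neutral_left) (auto simp: coeff_eq_0)

lemma op_poly_0 [simp]: "op_poly 0 T = 0"
  by (simp add: op_poly_def)

lemma op_poly_pCons [simp]: "op_poly (pCons a p) T = a *\<^sub>R 1 + T * op_poly p T"
proof -
  have "op_poly (pCons a p) T = (\<Sum>k\<le>Suc (degree p). coeff (pCons a p) k *\<^sub>R T ^ k)"
    by (rule op_poly_alt) (rule degree_pCons_le)
  also have "\<dots> = a *\<^sub>R 1 + T * op_poly p T"
    by (subst sum.atMost_Suc_shift) (simp add: op_poly_def sum_distrib_left)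
  finally show ?thesis .
qed

lemma op_poly_add [simp]: "op_poly (p + q) T = op_poly p T + op_poly q T"
proof (induction p q rule: poly_induct2)
  case (pCons a p b q)
  then show ?case by (simp add: algebra_simps)
qed simp

lemma op_poly_smult [simp]: "op_poly (smult c p) T = c *\<^sub>R op_poly p T"
  by (induction p) (simp_all add: algebra_simps)

lemma op_poly_diff [simp]: "op_poly (p - q) T = op_poly p T - op_poly q T"
  using op_poly_add[of p "- q" T] op_poly_smult[of "- 1" q T] by simp

lemma op_poly_mult [simp]: "op_poly (p * q) T = op_poly p T * op_poly q T"
  by (induction p) (simp_all add: algebra_simps)

lemma op_poly_sum [simp]: "op_poly (\<Sum>i\<in>I. p i) T = (\<Sum>i\<in>I. op_poly (p i) T)"
  by (induction I rule: infinite_finite_induct) simp_all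

lemma op_poly_commute: "op_poly p T * op_poly q T = op_poly q T * op_poly p T"
  by (metis mult.commute op_poly_mult)

lemma sa_op_poly: "op_self_adjoint T \<Longrightarrow> op_self_adjoint (op_poly p T)"
proof (induction p)
  case (pCons a p)
  have "T * op_poly p T = op_poly p T * T"
    using op_poly_commute[of "[:0, 1:]" T p] by simp
  then show ?case using pCons by (auto intro!: sa_times)
qed simp

lemma complex_poly_mult:
  "poly (map_poly complex_of_real (p * q)) z =
    poly (map_poly complex_of_real p) z * poly (map_poly complex_of_real q) z"
  and complex_poly_add:
  "poly (map_poly complex_of_real (p + q)) z =
    poly (map_poly complex_of_real p) z + poly (map_poly complex_of_real q) z"
proof -
  have add: "poly (map_poly complex_of_real (p + q)) z =
    poly (map_poly complex_of_real p) z + poly (map_poly complex_of_real q) z" for p q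
    by (induction p q rule: poly_induct2) (simp_all add: map_poly_pCons algebra_simps)
  show "poly (map_poly complex_of_real (p + q)) z =
    poly (map_poly complex_of_real p) z + poly (map_poly complex_of_real q) z" by (rule add)
  have smult: "poly (map_poly complex_of_real (smult c q)) z =
    c * poly (map_poly complex_of_real q) z" for c q
    by (induction q) (simp_all add: map_poly_pCons algebra_simps)
  show "poly (map_poly complex_of_real (p * q)) z =
    poly (map_poly complex_of_real p) z * poly (map_poly complex_of_real q) z"
    by (induction p) (simp_all add: map_poly_pCons add smult algebra_simps)
qed

lemma complex_poly_of_real:
  "poly (map_poly complex_of_real p) (complex_of_real r) = complex_of_real (poly p r)"
  by (induction p) (simp_all add: map_poly_pCons)

text \<open>One half of the spectral mapping theorem, by splitting off factors. A real root of q
  lies outside the spectrum, so its linear factor is invertible. A non-real root a + b \<i> gives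
  the factor (T - a)^2 + b^2, which is bounded below by b^2 > 0.\<close>

lemma op_poly_invertible:
  assumes T: "op_self_adjoint T" and "\<And>r. r \<in> rspec T \<Longrightarrow> poly q r \<noteq> 0"
  shows "op_invertible (op_poly q T)"
  using assms(2)
proof (induction "degree q" arbitrary: q rule: less_induct)
  case less
  obtain r0 where r0: "r0 \<in> rspec T" using rspec_minimum[OF T] .
  have q0: "q \<noteq> 0" using less.prems[OF r0] by auto
  show ?case
  proof (cases "degree q = 0")
    case True
    then obtain c where "q = [:c:]" by (auto elim: degree_eq_zeroE)
    then show ?thesis using q0 by (auto intro: op_invertible_scaleR)
  next
    case False
    let ?c = "map_poly complex_of_real"
    have "\<not> constant (poly (?c q))"
      using False by (simp add: constant_degree degree_map_poly)
    then obtain z where z: "poly (?c q) z = 0" using fundamental_theorem_of_algebra by blast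
    show ?thesis
    proof (cases "Im z = 0")
      case True
      then obtain r where r: "z = complex_of_real r" by (metis complex_is_Real_iff Reals_cases)
      have "complex_of_real (poly q r) = 0" using z by (simp add: r complex_poly_of_real)
      then have "poly q r = 0" by simp
      then obtain s where s: "q = [:- r, 1:] * s" by (metis dvdE poly_eq_0_iff_dvd)
      have "s \<noteq> 0" using s q0 by auto
      then have "degree q = Suc (degree s)" unfolding s by (subst degree_mult_eq) auto
      then have "op_invertible (op_poly s T)"
        using less.prems by (intro less.hyps) (auto simp: s)
      moreover have "op_invertible (op_poly [:- r, 1:] T)"
        using less.prems[of r] by (auto simp: s rspec_iff)
      ultimately show ?thesis unfolding s op_poly_mult by (intro op_invertible_times)
    next
      case Im: False
      define a where "a = Re z"
      define b where "b = Im z"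
      define d where "d = [:a\<^sup>2 + b\<^sup>2, - 2 * a, 1:]"
      have dz: "poly (?c d) z = 0"
        by (simp add: d_def a_def b_def map_poly_pCons complex_eq_iff power2_eq_square algebra_simps)
      have d0: "d \<noteq> 0" and dd: "degree d = 2" by (simp_all add: d_def)
      \<comment> \<open>The remainder is a real polynomial of degree at most 1 with the non-real
        root z, hence it is zero and d divides q.\<close>
      define m where "m = q mod d"
      have "poly (?c (d * (q div d) + m)) z = 0" using z by (simp add: m_def)
      then have mz: "poly (?c m) z = 0" by (simp add: complex_poly_add complex_poly_mult dz del: mult_div_mod_eq)
      have "degree m < 2" using degree_mod_less[OF d0, of q] dd by (auto simp: m_def)
      then have "m = [:coeff m 0, coeff m 1:]"
        by (intro poly_eqI) (auto simp: coeff_pCons coeff_eq_0 split: nat.split)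
      then obtain u v where m: "m = [:u, v:]" by blast
      have "v * b = 0" "u + v * a = 0"
        using mz by (auto simp: m map_poly_pCons complex_eq_iff a_def b_def algebra_simps)
      then have "m = 0" using Im by (simp add: m b_def)
      then have s: "q = d * (q div d)" using mult_div_mod_eq[of d q] by (simp add: m_def)
      define s where "s = q div d"
      have qs: "q = d * s" using s by (simp add: s_def)
      have "s \<noteq> 0" using qs q0 by auto
      then have "degree q = degree s + 2" unfolding qs by (subst degree_mult_eq) (auto simp: d0 dd)
      then have "op_invertible (op_poly s T)"
        using less.prems by (intro less.hyps) (auto simp: qs)
      moreover have "op_invertible (op_poly d T)"
      proof (rule op_invertible_of_bounded_below[OF sa_op_poly[OF T]])
        show "0 < b\<^sup>2" using Im by (simp add: b_def)
        have "op_poly d T = (T - a *\<^sub>R 1) * (T - a *\<^sub>R 1) + b\<^sup>2 *\<^sub>R 1"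
          by (simp add: d_def algebra_simps power2_eq_square flip: scaleR_2)
        moreover have "0 \<le> qf ((T - a *\<^sub>R 1) * (T - a *\<^sub>R 1)) x" for x
          using op_self_adjointD[of "T - a *\<^sub>R 1" "op_apply (T - a *\<^sub>R 1) x" x] T
          by (simp add: qf_def sa_intros)
        ultimately show "b\<^sup>2 * (norm x)\<^sup>2 \<le> qf (op_poly d T) x" for x by simp
      qed
      ultimately show ?thesis unfolding qs op_poly_mult by (intro op_invertible_times)
    qed
  qed
qed

text \<open>If the least spectral point \<mu> of p(T) were negative, p - \<mu> would have no zero on
  the spectrum of T, and p(T) - \<mu> would be invertible.\<close>

lemma op_poly_positive:
  assumes T: "op_self_adjoint T" and p: "\<And>r. r \<in> rspec T \<Longrightarrow> 0 \<le> poly p r"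
  shows "op_positive (op_poly p T)"
proof -
  obtain \<mu> where \<mu>: "\<mu> \<in> rspec (op_poly p T)" "\<mu> *\<^sub>R 1 \<le>\<^sub>L op_poly p T"
    using rspec_minimum[OF sa_op_poly[OF T]] .
  have "0 \<le> \<mu>"
  proof (rule ccontr)
    assume "\<not> 0 \<le> \<mu>"
    then have "op_invertible (op_poly (p - [:\<mu>:]) T)"
      using p by (intro op_poly_invertible[OF T]) (fastforce simp: not_le)
    then show False using \<mu>(1) by (simp add: rspec_iff)
  qed
  then have "0 \<le> \<mu> * (norm x)\<^sup>2" for x :: 'a by simp
  then show ?thesis
    using \<mu>(2) by (auto simp: op_positive_iff loewner_le_iff intro: order_trans)
qed

text \<open>Apply positivity to e - p and e + p. This estimate makes uniform convergence on the
  spectrum imply norm convergence of the operators.\<close>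

lemma norm_op_poly_le:
  assumes T: "op_self_adjoint T" and p: "\<And>r. r \<in> rspec T \<Longrightarrow> \<bar>poly p r\<bar> \<le> e"
  shows "norm (op_poly p T) \<le> e"
proof -
  obtain r where "r \<in> rspec T" using rspec_minimum[OF T] .
  then have e: "0 \<le> e" using p[of r] by linarith
  have "op_positive (op_poly ([:e:] - p) T)" "op_positive (op_poly ([:e:] + p) T)"
    by (rule op_poly_positive[OF T], use p in \<open>force simp: abs_le_iff\<close>)+
  then have pos: "0 \<le> qf (op_poly ([:e:] - p) T) x" "0 \<le> qf (op_poly ([:e:] + p) T) x" for x
    unfolding op_positive_iff by blast+
  have "\<bar>qf (op_poly p T) x\<bar> \<le> e * (norm x)\<^sup>2" for x
    using pos[of x] by (simp add: abs_le_iff)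
  then show ?thesis by (rule norm_sa_le[OF sa_op_poly[OF T] e])
qed

text \<open>\<open>cfc\<close> as a relation witnessed by a single approximating sequence. Algebraic
  rules for it are proved by combining sequences, and \<open>cfc_lim_tendsto\<close> supplies the
  independence of the sequence that \<open>cfc\<close> demands.\<close>

definition cfc_lim :: "(real \<Rightarrow> real) \<Rightarrow> 'a::nonzero_complex_hilbert_space bounded_op \<Rightarrow> 'a bounded_op \<Rightarrow> bool" where
  "cfc_lim f T S \<longleftrightarrow> (\<exists>p. uniform_limit (rspec T) (\<lambda>n. poly (p n)) f sequentially \<and>
     (\<lambda>n. op_poly (p n) T) \<longlonglongrightarrow> S)"

lemma cfc_lim_tendsto:
  assumes T: "op_self_adjoint T" and "cfc_lim f T S"
    and q: "uniform_limit (rspec T) (\<lambda>n. poly (q n)) f sequentially"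
  shows "(\<lambda>n. op_poly (q n) T) \<longlonglongrightarrow> S"
proof -
  obtain p where p: "uniform_limit (rspec T) (\<lambda>n. poly (p n)) f sequentially"
    and S: "(\<lambda>n. op_poly (p n) T) \<longlonglongrightarrow> S"
    using assms(2) by (auto simp: cfc_lim_def)
  have u: "uniform_limit (rspec T) (\<lambda>n x. poly (q n) x - poly (p n) x) (\<lambda>x. f x - f x) sequentially"
    by (intro uniform_limit_intros p q)
  have "(\<lambda>n. op_poly (q n - p n) T) \<longlonglongrightarrow> 0"
  proof (rule tendstoI)
    fix e :: real assume "e > 0"
    then have "\<forall>\<^sub>F n in sequentially. \<forall>x\<in>rspec T. dist (poly (q n) x - poly (p n) x) (f x - f x) < e / 2"
      by (intro uniform_limitD[OF u]) simp
    then show "\<forall>\<^sub>F n in sequentially. dist (op_poly (q n - p n) T) 0 < e"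
    proof eventually_elim
      case (elim n)
      then have "norm (op_poly (q n - p n) T) \<le> e / 2"
        by (intro norm_op_poly_le[OF T]) (auto simp: dist_real_def intro: less_imp_le)
      then show ?case using \<open>e > 0\<close> by (simp del: op_poly_diff)
    qed
  qed
  from tendsto_add[OF this S] show ?thesis by simp
qed

lemma cfc_lim_unique: "op_self_adjoint T \<Longrightarrow> cfc_lim f T S \<Longrightarrow> cfc_lim f T S' \<Longrightarrow> S = S'"
  unfolding cfc_lim_def[of f T S'] by (metis LIMSEQ_unique cfc_lim_tendsto)

text \<open>The sequence contained in \<open>cfc_lim\<close> keeps the universally quantified
  condition under \<open>THE\<close> from holding vacuously, which gives uniqueness.\<close>

lemma cfc_eq:
  assumes T: "op_self_adjoint T" and S: "cfc_lim f T S"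
  shows "cfc f T = S"
  unfolding cfc_def rspec_def[symmetric]
proof (rule the_equality)
  show "\<forall>p. uniform_limit (rspec T) (\<lambda>n. poly (p n)) f sequentially \<longrightarrow> (\<lambda>n. op_poly (p n) T) \<longlonglongrightarrow> S"
    using cfc_lim_tendsto[OF T S] by blast
next
  fix S'
  assume *: "\<forall>p. uniform_limit (rspec T) (\<lambda>n. poly (p n)) f sequentially \<longrightarrow> (\<lambda>n. op_poly (p n) T) \<longlonglongrightarrow> S'"
  obtain p where p: "uniform_limit (rspec T) (\<lambda>n. poly (p n)) f sequentially"
    and S: "(\<lambda>n. op_poly (p n) T) \<longlonglongrightarrow> S"
    using S by (auto simp: cfc_lim_def)
  then show "S' = S" using * LIMSEQ_unique by blast
qed

lemma rspec_bounded: "op_self_adjoint T \<Longrightarrow> rspec T \<subseteq> {- norm T..norm T}"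
  by (rule rspec_subset) (rule loewner_norm_bounds; assumption)+

text \<open>Uniform limits can be multiplied only if the limit functions are bounded. Here f stays
  within distance 1 of a polynomial, which is bounded on an interval containing the
  spectrum.\<close>

lemma cfc_lim_bounded:
  assumes T: "op_self_adjoint T" and "cfc_lim f T S"
  shows "bounded (f ` rspec T)"
proof -
  obtain p where p: "uniform_limit (rspec T) (\<lambda>n. poly (p n)) f sequentially"
    using assms(2) by (auto simp: cfc_lim_def)
  obtain n where n: "\<forall>x\<in>rspec T. dist (poly (p n) x) (f x) < 1"
    using uniform_limitD[OF p, of 1] by (auto simp: eventually_sequentially)
  have "bounded (poly (p n) ` {- norm T..norm T})"
    by (intro compact_imp_bounded compact_continuous_image continuous_intros) auto
  then obtain B where "\<forall>y\<in>poly (p n) ` {- norm T..norm T}. norm y \<le> B"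
    unfolding bounded_iff by blast
  then have "\<bar>poly (p n) x\<bar> \<le> B" if "x \<in> {- norm T..norm T}" for x using that by auto
  then have "\<bar>f x\<bar> \<le> B + 1" if "x \<in> rspec T" for x
    using n that rspec_bounded[OF T] by (fastforce simp: dist_real_def)
  then show ?thesis by (auto simp: bounded_iff)
qed

lemma cfc_lim_cong: "(\<And>x. x \<in> rspec T \<Longrightarrow> f x = g x) \<Longrightarrow> cfc_lim f T S \<Longrightarrow> cfc_lim g T S"
  unfolding cfc_lim_def by (metis (no_types, lifting) uniform_limit_cong')

lemma cfc_lim_poly: "cfc_lim (poly p) T (op_poly p T)"
  unfolding cfc_lim_def by (intro exI[of _ "\<lambda>_. p"]) (auto intro!: uniform_limit_intros)

lemma cfc_lim_id: "cfc_lim (\<lambda>x. x) T T"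
  using cfc_lim_cong[OF _ cfc_lim_poly[of "[:0, 1:]" T], of "\<lambda>x. x"] by simp

lemma cfc_lim_const: "cfc_lim (\<lambda>x. c) T (c *\<^sub>R 1)"
  using cfc_lim_cong[OF _ cfc_lim_poly[of "[:c:]" T], of "\<lambda>x. c"] by simp

lemma cfc_lim_add:
  assumes "cfc_lim f T S" "cfc_lim g T S'"
  shows "cfc_lim (\<lambda>x. f x + g x) T (S + S')"
proof -
  obtain p q where
    "uniform_limit (rspec T) (\<lambda>n. poly (p n)) f sequentially" "(\<lambda>n. op_poly (p n) T) \<longlonglongrightarrow> S"
    "uniform_limit (rspec T) (\<lambda>n. poly (q n)) g sequentially" "(\<lambda>n. op_poly (q n) T) \<longlonglongrightarrow> S'"
    using assms by (auto simp: cfc_lim_def)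
  then show ?thesis
    unfolding cfc_lim_def
    by (intro exI[of _ "\<lambda>n. p n + q n"]) (auto intro!: uniform_limit_add tendsto_add simp: poly_add[abs_def])
qed

lemma cfc_lim_mult:
  assumes T: "op_self_adjoint T" and "cfc_lim f T S" "cfc_lim g T S'"
  shows "cfc_lim (\<lambda>x. f x * g x) T (S * S')"
proof -
  obtain p q where
    "uniform_limit (rspec T) (\<lambda>n. poly (p n)) f sequentially" "(\<lambda>n. op_poly (p n) T) \<longlonglongrightarrow> S"
    "uniform_limit (rspec T) (\<lambda>n. poly (q n)) g sequentially" "(\<lambda>n. op_poly (q n) T) \<longlonglongrightarrow> S'"
    using assms by (auto simp: cfc_lim_def)
  moreover note cfc_lim_bounded[OF T assms(2)] cfc_lim_bounded[OF T assms(3)]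
  ultimately show ?thesis
    unfolding cfc_lim_def
    by (intro exI[of _ "\<lambda>n. p n * q n"]) (auto intro!: uniform_lim_mult tendsto_mult simp: poly_mult[abs_def])
qed

lemma cfc_lim_scaleR:
  assumes T: "op_self_adjoint T" and "cfc_lim f T S"
  shows "cfc_lim (\<lambda>x. c * f x) T (c *\<^sub>R S)"
  using cfc_lim_mult[OF T cfc_lim_const assms(2), of c] by simp

lemma cfc_lim_diff:
  assumes T: "op_self_adjoint T" and "cfc_lim f T S" "cfc_lim g T S'"
  shows "cfc_lim (\<lambda>x. f x - g x) T (S - S')"
  using cfc_lim_add[OF assms(2) cfc_lim_scaleR[OF T assms(3), of "-1"]] by simp

lemma cfc_lim_sum:
  assumes "\<And>i. i \<in> I \<Longrightarrow> cfc_lim (f i) T (S i)"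
  shows "cfc_lim (\<lambda>x. \<Sum>i\<in>I. f i x) T (\<Sum>i\<in>I. S i)"
  using assms
  by (induction I rule: infinite_finite_induct) (use cfc_lim_const[of 0] in \<open>auto intro!: cfc_lim_add\<close>)

lemma cfc_lim_sa: "op_self_adjoint T \<Longrightarrow> cfc_lim f T S \<Longrightarrow> op_self_adjoint S"
  unfolding cfc_lim_def by (meson sa_limit sa_op_poly)

lemma cfc_lim_commute:
  assumes T: "op_self_adjoint T" and "cfc_lim f T S" "cfc_lim g T S'"
  shows "S * S' = S' * S"
proof (rule cfc_lim_unique[OF T cfc_lim_mult[OF assms]])
  show "cfc_lim (\<lambda>x. f x * g x) T (S' * S)"
    by (rule cfc_lim_cong[OF _ cfc_lim_mult[OF T assms(3,2)]]) simp
qed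

lemma cfc_lim_positive:
  assumes T: "op_self_adjoint T" and S: "cfc_lim f T S" and f: "\<And>x. x \<in> rspec T \<Longrightarrow> 0 \<le> f x"
  shows "op_positive S"
proof -
  obtain p where p: "uniform_limit (rspec T) (\<lambda>n. poly (p n)) f sequentially"
    and lim: "(\<lambda>n. op_poly (p n) T) \<longlonglongrightarrow> S"
    using S by (auto simp: cfc_lim_def)
  have ge: "- e * (norm x)\<^sup>2 \<le> qf S x" if "e > 0" for e x
  proof (rule tendsto_lowerbound[OF tendsto_qf[OF lim]])
    show "\<forall>\<^sub>F n in sequentially. - e * (norm x)\<^sup>2 \<le> qf (op_poly (p n) T) x"
      using uniform_limitD[OF p that]
    proof eventually_elim
      case (elim n)
      have "op_positive (op_poly (p n + [:e:]) T)"
      proof (rule op_poly_positive[OF T])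
        fix r assume "r \<in> rspec T"
        then show "0 \<le> poly (p n + [:e:]) r" using elim f by (fastforce simp: dist_real_def)
      qed
      then have "0 \<le> qf (op_poly (p n + [:e:]) T) x" unfolding op_positive_iff by blast
      then show ?case by simp
    qed
  qed simp
  have "0 \<le> qf S x" for x
  proof (rule field_le_epsilon)
    fix e :: real assume e: "e > 0"
    define d where "d = e / ((norm x)\<^sup>2 + 1)"
    have n: "(norm x)\<^sup>2 + 1 > 0" by (simp add: add_nonneg_pos)
    then have "d > 0" using e by (simp add: d_def)
    moreover have "d * ((norm x)\<^sup>2 + 1) = e" using n by (simp add: d_def)
    ultimately have "d * (norm x)\<^sup>2 \<le> e" by (simp add: distrib_left)
    with \<open>d > 0\<close> show "0 \<le> qf S x + e" using ge[of d x] by simp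
  qed
  then show ?thesis using cfc_lim_sa[OF T S] by (simp add: op_positive_iff)
qed

lemma cfc_lim_mono:
  assumes T: "op_self_adjoint T" and S: "cfc_lim f T S" "cfc_lim g T S'"
    and "\<And>x. x \<in> rspec T \<Longrightarrow> f x \<le> g x"
  shows "S \<le>\<^sub>L S'"
  using cfc_lim_positive[OF T cfc_lim_diff[OF T S(2,1)]] cfc_lim_sa[OF T S(1)] cfc_lim_sa[OF T S(2)] assms(4)
  by (simp add: loewner_le_def)

text \<open>Weierstrass approximation is carried out on a whole interval around the spectrum, so
  compactness of the spectrum itself does not have to be established; \<open>norm_op_poly_le\<close>
  makes the operators a Cauchy sequence.\<close>

lemma cfc_lim_exists:
  assumes T: "op_self_adjoint T" and ab: "rspec T \<subseteq> {a..b}" and f: "continuous_on {a..b} f"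
  obtains S where "cfc_lim f T S"
proof -
  have "\<exists>p. \<forall>x\<in>{a..b}. \<bar>f x - poly p x\<bar> < 1 / Suc n" for n
  proof -
    obtain g where g: "real_polynomial_function g" "\<And>x. x \<in> {a..b} \<Longrightarrow> \<bar>f x - g x\<bar> < 1 / Suc n"
      using Stone_Weierstrass_real_polynomial_function[OF compact_Icc f, of "1 / Suc n"] by auto
    obtain c m where "g = (\<lambda>x. \<Sum>i\<le>m. c i * x ^ i)"
      using g(1) by (auto simp: real_polynomial_function_iff_sum)
    then have "g = poly (\<Sum>i\<le>m. monom (c i) i)"
      by (simp add: poly_sum poly_monom fun_eq_iff)
    then show ?thesis using g(2) by (intro exI[of _ "\<Sum>i\<le>m. monom (c i) i"]) simp
  qed
  then obtain p where p: "\<And>n x. x \<in> {a..b} \<Longrightarrow> \<bar>f x - poly (p n) x\<bar> < 1 / Suc n"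
    by metis
  have small: "\<forall>\<^sub>F n in sequentially. \<forall>x\<in>rspec T. \<bar>f x - poly (p n) x\<bar> < e" if "e > 0" for e
  proof -
    have "\<forall>\<^sub>F n in sequentially. 1 / real (Suc n) < e"
      using order_tendstoD(2)[OF LIMSEQ_Suc[OF lim_1_over_n] that] .
    then show ?thesis
    proof eventually_elim
      case (elim n)
      then show ?case using p[of _ n] ab by (meson less_trans subsetD)
    qed
  qed
  have u: "uniform_limit (rspec T) (\<lambda>n. poly (p n)) f sequentially"
    by (rule uniform_limitI) (use small in \<open>auto simp: dist_real_def abs_minus_commute\<close>)
  have "Cauchy (\<lambda>n. op_poly (p n) T)"
  proof (rule metric_CauchyI)
    fix e :: real assume "e > 0"
    then obtain N where N: "\<And>n x. n \<ge> N \<Longrightarrow> x \<in> rspec T \<Longrightarrow> \<bar>f x - poly (p n) x\<bar> < e / 3"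
      using small[of "e / 3"] by (auto simp: eventually_sequentially)
    have "dist (op_poly (p m) T) (op_poly (p n) T) < e" if "m \<ge> N" "n \<ge> N" for m n
    proof -
      have "norm (op_poly (p m - p n) T) \<le> 2 * e / 3"
      proof (rule norm_op_poly_le[OF T])
        fix r assume "r \<in> rspec T"
        then show "\<bar>poly (p m - p n) r\<bar> \<le> 2 * e / 3"
          using N[OF that(1), of r] N[OF that(2), of r]
          unfolding poly_diff abs_le_iff abs_less_iff by linarith
      qed
      then show ?thesis using \<open>e > 0\<close> by (simp add: dist_norm)
    qed
    then show "\<exists>M. \<forall>m\<ge>M. \<forall>n\<ge>M. dist (op_poly (p m) T) (op_poly (p n) T) < e" by blast
  qed
  then obtain S where "(\<lambda>n. op_poly (p n) T) \<longlonglongrightarrow> S"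
    by (auto simp: Cauchy_convergent_iff convergent_def)
  then show thesis using u that unfolding cfc_lim_def by blast
qed

lemma cfc_lim_inverse:
  assumes T: "op_self_adjoint T" and S: "cfc_lim f T S" "cfc_lim (\<lambda>x. 1 / f x) T S'"
    and f: "\<And>x. x \<in> rspec T \<Longrightarrow> f x \<noteq> 0"
  shows "op_invertible S" "op_inv S = S'"
proof -
  have "cfc_lim (\<lambda>x. f x * (1 / f x)) T (S * S')" by (rule cfc_lim_mult[OF assms(1-3)])
  then have "cfc_lim (\<lambda>x. 1) T (S * S')" by (rule cfc_lim_cong[rotated]) (use f in auto)
  then have "S * S' = 1 *\<^sub>R 1" using cfc_lim_const cfc_lim_unique[OF T] by blast
  moreover have "S' * S = S * S'" by (rule cfc_lim_commute[OF T S(2,1)])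
  ultimately show "op_invertible S" "op_inv S = S'"
    by (auto intro: op_invertibleI op_inv_unique)
qed

section \<open>Functional calculus of positive definite operators: inverse, power -1/2 and
  logarithm\<close>

lemma positive_definite_bounds:
  assumes "positive_definite T"
  obtains m M where "0 < m" "m *\<^sub>R 1 \<le>\<^sub>L T" "T \<le>\<^sub>L M *\<^sub>R 1"
  using assms loewner_norm_bounds(2)[of T] unfolding positive_definite_iff loewner_le_iff by blast

lemma cfc_lim_exists_pd:
  assumes T: "positive_definite T" and f: "continuous_on {0<..} f"
  obtains S where "cfc_lim f T S"
proof -
  obtain m M where "0 < m" and m: "m *\<^sub>R 1 \<le>\<^sub>L T" "T \<le>\<^sub>L M *\<^sub>R 1"
    using positive_definite_bounds[OF T] .
  moreover from this have "continuous_on {m..M} f"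
    by (intro continuous_on_subset[OF f]) auto
  ultimately show thesis
    using cfc_lim_exists[OF positive_definiteD(2)[OF T] rspec_subset] that by metis
qed

lemma rspec_positive: "positive_definite T \<Longrightarrow> r \<in> rspec T \<Longrightarrow> 0 < r"
  unfolding positive_definite_iff using rspec_ge by fastforce

lemma cfc_lim_op_inv:
  assumes T: "positive_definite T" and "cfc_lim f T S" "continuous_on {0<..} f" "\<And>x. 0 < x \<Longrightarrow> 0 < f x"
  shows "cfc_lim (\<lambda>x. 1 / f x) T (op_inv S)"
proof -
  have "continuous_on {0<..} (\<lambda>x. 1 / f x)"
    using assms(3,4) by (intro continuous_intros) fastforce+
  then obtain S' where S': "cfc_lim (\<lambda>x. 1 / f x) T S'" using cfc_lim_exists_pd[OF T] by blast
  have "f x \<noteq> 0" if "x \<in> rspec T" for x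
    using assms(4)[OF rspec_positive[OF T that]] by simp
  then show ?thesis
    using cfc_lim_inverse(2)[OF positive_definiteD(2)[OF T] assms(2) S'] S' by simp
qed

lemma op_powr_minus_half:
  fixes X :: "'a::nonzero_complex_hilbert_space bounded_op"
  assumes X: "positive_definite X"
  defines "R \<equiv> op_powr X (- (1/2))"
  shows "op_self_adjoint R" "op_invertible R" "R * R = op_inv X" "R * X * R = 1"
proof -
  have sa: "op_self_adjoint X" using X by (simp add: positive_definiteD)
  obtain S where S: "cfc_lim (\<lambda>r. r powr (- (1/2))) X S"
    by (rule cfc_lim_exists_pd[OF X, of "\<lambda>r. r powr (- (1/2))"]) (auto intro!: continuous_intros)
  then have R: "cfc_lim (\<lambda>r. r powr (- (1/2))) X R"
    using cfc_eq[OF sa S] by (simp add: R_def op_powr_def)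
  show "op_self_adjoint R" by (rule cfc_lim_sa[OF sa R])
  have "cfc_lim (\<lambda>x. 1 / x) X (R * R)"
    by (rule cfc_lim_cong[OF _ cfc_lim_mult[OF sa R R]])
      (auto dest: rspec_positive[OF X] simp: powr_minus_divide simp flip: powr_add)
  moreover have "cfc_lim (\<lambda>x. 1 / x) X (op_inv X)"
    by (rule cfc_lim_op_inv[OF X cfc_lim_id]) (auto intro!: continuous_intros)
  ultimately show RR: "R * R = op_inv X" using cfc_lim_unique[OF sa] by blast
  have XR: "X * R = R * X" by (rule cfc_lim_commute[OF sa cfc_lim_id R])
  then show "R * X * R = 1"
    using X by (simp add: RR op_inv positive_definiteD mult.assoc flip: XR)
  then show "op_invertible R"
    by (intro op_invertibleI[of "R * X"]) (metis XR mult.assoc)+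
qed

lemma cfc_lim_op_log:
  assumes X: "positive_definite X"
  shows "cfc_lim ln X (op_log X)"
proof -
  obtain S where S: "cfc_lim ln X S"
    by (rule cfc_lim_exists_pd[OF X, of ln]) (auto intro!: continuous_intros)
  then show ?thesis
    using cfc_eq[OF positive_definiteD(2)[OF X] S] by (simp add: op_log_def)
qed

section \<open>Weighted harmonic means and relative operator entropy\<close>

definition wharm :: "real \<Rightarrow> 'a::nonzero_complex_hilbert_space bounded_op \<Rightarrow> 'a bounded_op \<Rightarrow> 'a bounded_op" where
  "wharm s X A = op_inv ((1 - s) *\<^sub>R op_inv X + s *\<^sub>R op_inv A)"

lemma positive_definite_convex:
  assumes P: "positive_definite P" and Q: "positive_definite Q" and s: "0 \<le> s" "s \<le> 1"
  shows "positive_definite ((1 - s) *\<^sub>R P + s *\<^sub>R Q)"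
proof (cases "s = 1")
  case False
  then have "positive_definite ((1 - s) *\<^sub>R P)" using s by (intro positive_definite_scaleR P) auto
  then show ?thesis
    by (rule positive_definite_add) (use Q s in \<open>auto simp: op_positive_iff positive_definiteD\<close>)
qed (use Q in simp)

lemma loewner_convex_mono:
  "P \<le>\<^sub>L P' \<Longrightarrow> Q \<le>\<^sub>L Q' \<Longrightarrow> 0 \<le> s \<Longrightarrow> s \<le> 1 \<Longrightarrow>
    (1 - s) *\<^sub>R P + s *\<^sub>R Q \<le>\<^sub>L (1 - s) *\<^sub>R P' + s *\<^sub>R Q'"
  by (intro loewner_add_mono loewner_scaleR_mono) auto

lemma positive_definite_wharm:
  "positive_definite X \<Longrightarrow> positive_definite A \<Longrightarrow> 0 \<le> s \<Longrightarrow> s \<le> 1 \<Longrightarrow> positive_definite (wharm s X A)"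
  unfolding wharm_def by (intro positive_definite_op_inv positive_definite_convex)

lemma wharm_mono:
  assumes "positive_definite X" "positive_definite A" "X \<le>\<^sub>L X'" "A \<le>\<^sub>L A'" "0 \<le> s" "s \<le> 1"
  shows "wharm s X A \<le>\<^sub>L wharm s X' A'"
  unfolding wharm_def
  using assms positive_definite_mono[OF assms(1,3)] positive_definite_mono[OF assms(2,4)]
  by (intro op_inv_antimono loewner_convex_mono positive_definite_convex positive_definite_op_inv) auto

lemma op_inv_congruence:
  assumes "op_invertible C" "op_invertible X"
  shows "op_inv (C * X * C) = op_inv C * op_inv X * op_inv C"
  by (simp add: assms op_inv_times op_invertible_times mult.assoc)

lemma wharm_congruence:
  assumes X: "positive_definite X" and A: "positive_definite A" and s: "0 \<le> s" "s \<le> 1"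
    and C: "op_self_adjoint C" "op_invertible C"
  shows "wharm s (C * X * C) (C * A * C) = C * wharm s X A * C"
proof -
  let ?D = "(1 - s) *\<^sub>R op_inv X + s *\<^sub>R op_inv A"
  have "positive_definite ?D" by (intro positive_definite_convex positive_definite_op_inv X A s)
  then have "op_invertible ?D" by (rule positive_definiteD)
  then have "op_inv (op_inv C * ?D * op_inv C) = C * op_inv ?D * C"
    using op_inv_congruence[of "op_inv C" ?D] C by simp
  moreover have "op_inv C * ?D * op_inv C =
      (1 - s) *\<^sub>R op_inv (C * X * C) + s *\<^sub>R op_inv (C * A * C)"
    using X A C by (simp add: op_inv_congruence positive_definiteD distrib_left distrib_right)
  ultimately show ?thesis by (simp add: wharm_def)
qed

lemma wharm_self:
  assumes "positive_definite X"
  shows "wharm s X X = X"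
proof -
  have "(1 - s) *\<^sub>R op_inv X + s *\<^sub>R op_inv X = op_inv X" by (simp add: scaleR_left_diff_distrib)
  then show ?thesis using assms by (simp add: wharm_def positive_definiteD)
qed

text \<open>The right Riemann sum, with nodes \<open>j / N\<close>, of
  \<open>log x = \<integral>\<^sub>0\<^sup>1 (x - 1) / ((1 - s) x + s) ds\<close>, lifted to two noncommuting arguments.\<close>

definition rel_entropy_approx ::
  "nat \<Rightarrow> 'a::nonzero_complex_hilbert_space bounded_op \<Rightarrow> 'a bounded_op \<Rightarrow> 'a bounded_op" where
  "rel_entropy_approx N X A = (\<Sum>j=1..N. (1 / real j) *\<^sub>R (wharm (real j / real N) X A - X))"

text \<open>At s = j / N the harmonic mean of 1 and y exceeds 1 by s (y - 1) / ((1 - s) y + s).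
  Dividing by j = s N therefore gives the integrand times the mesh 1 / N. The division by s is the
  reason for starting at j = 1.\<close>

definition ln_approx :: "nat \<Rightarrow> real \<Rightarrow> real" where
  "ln_approx N y = (\<Sum>j=1..N. (1 / real j) * (1 / ((1 - real j / real N) + real j / real N / y) - 1))"

text \<open>The denominators \<open>d j\<close> run in arithmetic progression from y to 1 with
  decrement \<delta>. By ln u \<le> u - 1, each difference ln (d (j - 1)) - ln (d j) lies between
  \<delta> / d (j - 1) and \<delta> / d j. The logarithms telescope to ln y and the gaps to (y + 1 /
  y - 2) / N.\<close>

lemma ln_approx_bounds:
  assumes y: "0 < y" and N: "1 \<le> N"
  shows "ln y \<le> ln_approx N y" "ln_approx N y \<le> ln y + (y + 1 / y) / N"
proof -
  define d where "d j = (1 - real j / real N) * y + real j / real N" for j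
  define \<delta> where "\<delta> = (y - 1) / N"
  have d: "0 < d j" if "j \<le> N" for j
  proof (cases "j = N")
    case False
    then have "real j / real N < 1" using that by simp
    then show ?thesis using y by (auto simp: d_def intro!: add_pos_nonneg)
  qed (use N in \<open>simp add: d_def\<close>)
  have step: "d (j - 1) - d j = \<delta>" if "1 \<le> j" for j
    using that N by (simp add: d_def \<delta>_def of_nat_diff field_simps)
  have summand: "(1 / real j) * (1 / ((1 - real j / real N) + real j / real N / y) - 1) = \<delta> / d j"
    if j: "j \<in> {1..N}" for j
  proof -
    have "(1 - real j / real N) + real j / real N / y = d j / y"
      using y by (simp add: d_def field_simps)
    then have "1 / ((1 - real j / real N) + real j / real N / y) - 1 = (y - d j) / d j"
      using d[of j] j by (simp add: field_simps)
    also have "y - d j = real j * \<delta>" using N by (simp add: d_def \<delta>_def field_simps)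
    finally show ?thesis using j by simp
  qed
  have sum: "ln_approx N y = (\<Sum>j=1..N. \<delta> / d j)"
    unfolding ln_approx_def by (rule sum.cong[OF refl summand])
  have tele: "(\<Sum>j=1..N. f (j - 1) - f j) = f 0 - f N" for f :: "nat \<Rightarrow> real"
    by (induction N) auto
  have ends: "d 0 = y" "d N = 1" using N by (simp_all add: d_def)
  have "ln y = (\<Sum>j=1..N. ln (d (j - 1)) - ln (d j))"
    using tele[of "\<lambda>j. ln (d j)"] ends by simp
  also have "\<dots> \<le> (\<Sum>j=1..N. \<delta> / d j)"
  proof (rule sum_mono)
    fix j assume j: "j \<in> {1..N}"
    have p: "0 < d j" "0 < d (j - 1)" by (rule d, use j in auto)+
    have "ln (d (j - 1)) - ln (d j) = ln (d (j - 1) / d j)" using p by (simp add: ln_div)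
    also have "\<dots> \<le> d (j - 1) / d j - 1" using p by (intro ln_le_minus_one) simp
    also have "\<dots> = \<delta> / d j" using step[of j] p j by (simp add: field_simps)
    finally show "ln (d (j - 1)) - ln (d j) \<le> \<delta> / d j" .
  qed
  finally show "ln y \<le> ln_approx N y" by (simp add: sum)
  have "(\<Sum>j=1..N. \<delta> / d j) \<le> (\<Sum>j=1..N. (ln (d (j - 1)) - ln (d j)) + (\<delta> / d j - \<delta> / d (j - 1)))"
  proof (rule sum_mono)
    fix j assume j: "j \<in> {1..N}"
    have p: "0 < d j" "0 < d (j - 1)" by (rule d, use j in auto)+
    have "ln (d j) - ln (d (j - 1)) = ln (d j / d (j - 1))" using p by (simp add: ln_div)
    also have "\<dots> \<le> d j / d (j - 1) - 1" using p by (intro ln_le_minus_one) simp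
    also have "\<dots> = (d j - d (j - 1)) / d (j - 1)" using p by (simp add: diff_divide_distrib)
    also have "d j - d (j - 1) = - \<delta>" using step[of j] j by simp
    finally show "\<delta> / d j \<le> (ln (d (j - 1)) - ln (d j)) + (\<delta> / d j - \<delta> / d (j - 1))" by simp
  qed
  also have "\<dots> = ln y + (\<Sum>j=1..N. (- \<delta> / d (j - 1)) - (- \<delta> / d j))"
    unfolding sum.distrib using tele[of "\<lambda>j. ln (d j)"] ends by simp
  also have "\<dots> = ln y + (\<delta> - \<delta> / y)" using tele[of "\<lambda>j. - \<delta> / d j"] ends by simp
  also have "\<delta> - \<delta> / y = (y + 1 / y - 2) / N"
    using y N by (simp add: \<delta>_def field_simps)
  also have "\<dots> \<le> (y + 1 / y) / N" by (simp add: divide_right_mono)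
  finally show "ln_approx N y \<le> ln y + (y + 1 / y) / N" by (simp add: sum)
qed

text \<open>When both arguments are functions of the same T, the operator sum is the functional
  calculus of the scalar one, by homogeneity in l. A general g covers both B = T and B =
  \<open>op_inv T\<close>.\<close>

lemma cfc_lim_rel_entropy_approx:
  fixes T B :: "'a::nonzero_complex_hilbert_space bounded_op"
  assumes T: "positive_definite T" and B: "cfc_lim g T B"
    and g: "continuous_on {0<..} g" "\<And>x. 0 < x \<Longrightarrow> 0 < g x" and l: "0 < l"
  shows "cfc_lim (\<lambda>x. l * ln_approx N (g x / l)) T (rel_entropy_approx N (l *\<^sub>R 1) B)"
proof -
  have sa: "op_self_adjoint T" using T by (rule positive_definiteD)
  have inv: "cfc_lim (\<lambda>x. 1 / g x) T (op_inv B)" by (rule cfc_lim_op_inv[OF T B g])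
  have l_inv: "op_inv (l *\<^sub>R 1) = (1 / l) *\<^sub>R (1::'a bounded_op)" using l by (simp add: op_inv_scaleR)
  have harm: "cfc_lim (\<lambda>x. 1 / ((1 - s) / l + s * (1 / g x))) T (wharm s (l *\<^sub>R 1) B)"
    if s: "0 \<le> s" "s \<le> 1" for s
    unfolding wharm_def l_inv
  proof (rule cfc_lim_op_inv[OF T])
    show "cfc_lim (\<lambda>x. (1 - s) / l + s * (1 / g x)) T ((1 - s) *\<^sub>R (1 / l) *\<^sub>R 1 + s *\<^sub>R op_inv B)"
      using cfc_lim_add[OF cfc_lim_const cfc_lim_scaleR[OF sa inv], of "(1 - s) / l" s] by simp
    show "continuous_on {0<..} (\<lambda>x. (1 - s) / l + s * (1 / g x))"
      using g l by (intro continuous_intros) fastforce+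
    show "0 < (1 - s) / l + s * (1 / g x)" if "0 < x" for x
      using s l g(2)[OF that] by (cases "s = 0") (auto intro!: add_nonneg_pos)
  qed
  have "cfc_lim (\<lambda>x. \<Sum>j=1..N. (1 / real j) * (1 / ((1 - real j / real N) / l + (real j / real N) * (1 / g x)) - l)) T
      (rel_entropy_approx N (l *\<^sub>R 1) B)"
    unfolding rel_entropy_approx_def
    by (intro cfc_lim_sum cfc_lim_scaleR[OF sa] cfc_lim_diff[OF sa] harm cfc_lim_const) auto
  then show ?thesis
  proof (rule cfc_lim_cong[rotated])
    fix x assume "x \<in> rspec T"
    then have gx: "0 < g x" using g(2) rspec_positive[OF T] by blast
    show "(\<Sum>j=1..N. (1 / real j) * (1 / ((1 - real j / real N) / l + (real j / real N) * (1 / g x)) - l)) =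
        l * ln_approx N (g x / l)"
      unfolding ln_approx_def sum_distrib_left
    proof (rule sum.cong[OF refl])
      fix j
      define s where "s = real j / real N"
      have e: "(1 - s) / l + s * (1 / g x) = ((1 - s) + s / (g x / l)) / l"
        using l gx by (simp add: field_simps)
      show "(1 / real j) * (1 / ((1 - real j / real N) / l + (real j / real N) * (1 / g x)) - l) =
          l * ((1 / real j) * (1 / ((1 - real j / real N) + real j / real N / (g x / l)) - 1))"
        unfolding s_def[symmetric] e by (simp add: algebra_simps)
    qed
  qed
qed

text \<open>The ratio y = g x / l lies between 1 / k and k, so y + 1 / y \<le> 2 k in the error term
  of \<open>ln_approx_bounds\<close>.\<close>

lemma rel_entropy_approx_one_bounds:
  fixes T B :: "'a::nonzero_complex_hilbert_space bounded_op"
  assumes T: "positive_definite T" and B: "cfc_lim g T B"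
    and g: "continuous_on {0<..} g" "\<And>x. 0 < x \<Longrightarrow> 0 < g x" and l: "0 < l"
    and k: "0 < k" "\<And>x. x \<in> rspec T \<Longrightarrow> l / k \<le> g x \<and> g x \<le> l * k"
    and L: "cfc_lim (\<lambda>x. ln (g x)) T L" and N: "1 \<le> N"
  shows "l *\<^sub>R (L - ln l *\<^sub>R 1) \<le>\<^sub>L rel_entropy_approx N (l *\<^sub>R 1) B"
    "rel_entropy_approx N (l *\<^sub>R 1) B \<le>\<^sub>L l *\<^sub>R (L + (2 * k / N - ln l) *\<^sub>R 1)"
proof -
  have sa: "op_self_adjoint T" using T by (rule positive_definiteD)
  note approx = cfc_lim_rel_entropy_approx[OF T B g l, of N]
  have gx: "0 < g x" if "x \<in> rspec T" for x using that g(2) rspec_positive[OF T] by blast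
  have "cfc_lim (\<lambda>x. l * (ln (g x) - ln l)) T (l *\<^sub>R (L - ln l *\<^sub>R 1))"
    by (intro cfc_lim_scaleR[OF sa] cfc_lim_diff[OF sa] L cfc_lim_const)
  from sa this approx show "l *\<^sub>R (L - ln l *\<^sub>R 1) \<le>\<^sub>L rel_entropy_approx N (l *\<^sub>R 1) B"
  proof (rule cfc_lim_mono)
    fix x assume "x \<in> rspec T"
    note gx = gx[OF this]
    show "l * (ln (g x) - ln l) \<le> l * ln_approx N (g x / l)"
      using ln_approx_bounds(1)[of "g x / l" N] gx l N by (simp add: ln_div)
  qed
  have "cfc_lim (\<lambda>x. l * (ln (g x) + (2 * k / N - ln l))) T (l *\<^sub>R (L + (2 * k / N - ln l) *\<^sub>R 1))"
    by (intro cfc_lim_scaleR[OF sa] cfc_lim_add L cfc_lim_const)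
  from sa approx this show "rel_entropy_approx N (l *\<^sub>R 1) B \<le>\<^sub>L l *\<^sub>R (L + (2 * k / N - ln l) *\<^sub>R 1)"
  proof (rule cfc_lim_mono)
    fix x assume x: "x \<in> rspec T"
    note gx = gx[OF this]
    have y: "g x / l \<le> k" "1 / (g x / l) \<le> k"
      using k(2)[OF x] k(1) gx l by (simp_all add: field_simps)
    then have "g x / l + 1 / (g x / l) \<le> 2 * k" by linarith
    then have "(g x / l + 1 / (g x / l)) / N \<le> 2 * k / N" using N by (intro divide_right_mono) auto
    then have "ln_approx N (g x / l) \<le> ln (g x) - ln l + 2 * k / N"
      using ln_approx_bounds(2)[of "g x / l" N] gx l N by (simp add: ln_div)
    then show "l * ln_approx N (g x / l) \<le> l * (ln (g x) + (2 * k / N - ln l))"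
      using l by (intro mult_left_mono) auto
  qed
qed

lemma rel_entropy_approx_congruence:
  assumes "positive_definite X" "positive_definite A" "op_self_adjoint C" "op_invertible C"
  shows "rel_entropy_approx N (C * X * C) (C * A * C) = C * rel_entropy_approx N X A * C"
proof -
  have "wharm (real j / real N) (C * X * C) (C * A * C) = C * wharm (real j / real N) X A * C"
    if "j \<in> {1..N}" for j
    using that by (intro wharm_congruence assms) auto
  then show ?thesis
    unfolding rel_entropy_approx_def sum_distrib_left sum_distrib_right
    by (intro sum.cong) (simp_all add: left_diff_distrib right_diff_distrib)
qed

text \<open>\<open>op_inv R\<close> stands for the square root of X. In this form only the power
  -1/2, which also occurs in \<open>karcher_mean\<close>, has to be analysed.\<close>

definition rel_entropy ::
  "'a::nonzero_complex_hilbert_space bounded_op \<Rightarrow> 'a bounded_op \<Rightarrow> 'a bounded_op" where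
  "rel_entropy X A = (let R = op_powr X (- (1/2)) in op_inv R * op_log (R * A * R) * op_inv R)"

text \<open>Congruence with C, where C C = X, reduces the first argument to a multiple of 1. The
  approximation is taken at l X but the entropy at X, since \<open>grad_comparison\<close> rescales
  its argument while knowing the gradient only at the original point.\<close>

lemma rel_entropy_approx_bounds:
  fixes X A :: "'a::nonzero_complex_hilbert_space bounded_op"
  assumes X: "positive_definite X" and A: "positive_definite A" and l: "0 < l"
    and k: "0 < k" "(l / k) *\<^sub>R X \<le>\<^sub>L A" "A \<le>\<^sub>L (l * k) *\<^sub>R X" and N: "1 \<le> N"
  shows "l *\<^sub>R (rel_entropy X A - ln l *\<^sub>R X) \<le>\<^sub>L rel_entropy_approx N (l *\<^sub>R X) A"
    "rel_entropy_approx N (l *\<^sub>R X) A \<le>\<^sub>L l *\<^sub>R (rel_entropy X A + (2 * k / N - ln l) *\<^sub>R X)"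
proof -
  define R where "R = op_powr X (- (1/2))"
  note R = op_powr_minus_half[OF X, folded R_def]
  define C where "C = op_inv R"
  have C: "op_self_adjoint C" "op_invertible C"
    using R by (auto simp: C_def sa_op_inv)
  have RC: "R * C = 1" "C * R = 1" using R(2) by (auto simp: C_def op_inv)
  define B where "B = R * A * R"
  have B: "positive_definite B" unfolding B_def by (intro positive_definite_congruence R A)
  have CBC: "C * B * C = A"
    using RC by (simp add: B_def mult.assoc) (simp add: RC flip: mult.assoc)
  have "C * (R * X * R) * C = X"
    using RC by (simp add: mult.assoc) (simp add: RC flip: mult.assoc)
  then have CC: "C * C = X" using R(4) by simp
  have kB: "(l / k) *\<^sub>R 1 \<le>\<^sub>L B" "B \<le>\<^sub>L (l * k) *\<^sub>R 1"
    using loewner_congruence[OF R(1) k(2)] loewner_congruence[OF R(1) k(3)] R(4)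
    by (simp_all add: B_def)
  have S: "rel_entropy X A = C * op_log B * C"
    by (simp add: rel_entropy_def C_def B_def R_def Let_def)
  have approx: "rel_entropy_approx N (l *\<^sub>R X) A = C * rel_entropy_approx N (l *\<^sub>R 1) B * C"
    using rel_entropy_approx_congruence[of "l *\<^sub>R 1" B C N] l B C
    by (simp add: positive_definite_scaleR CC CBC)
  have bds: "l *\<^sub>R (op_log B - ln l *\<^sub>R 1) \<le>\<^sub>L rel_entropy_approx N (l *\<^sub>R 1) B"
    "rel_entropy_approx N (l *\<^sub>R 1) B \<le>\<^sub>L l *\<^sub>R (op_log B + (2 * k / N - ln l) *\<^sub>R 1)"
    using rspec_ge[OF kB(1)] rspec_le[OF kB(2)]
    by (intro rel_entropy_approx_one_bounds[OF B cfc_lim_id _ _ l k(1) _ cfc_lim_op_log[OF B] N];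
        auto intro!: continuous_intros)+
  show "l *\<^sub>R (rel_entropy X A - ln l *\<^sub>R X) \<le>\<^sub>L rel_entropy_approx N (l *\<^sub>R X) A"
    using loewner_congruence[OF C(1) bds(1)] unfolding approx
    by (simp add: S algebra_simps CC)
  show "rel_entropy_approx N (l *\<^sub>R X) A \<le>\<^sub>L l *\<^sub>R (rel_entropy X A + (2 * k / N - ln l) *\<^sub>R X)"
    using loewner_congruence[OF C(1) bds(2)] unfolding approx
    by (simp add: S algebra_simps CC)
qed

lemma positive_definite_dominates:
  fixes X A :: "'a::nonzero_complex_hilbert_space bounded_op"
  assumes A: "positive_definite A" and X: "op_self_adjoint X"
  obtains c where "0 < c" "X \<le>\<^sub>L c *\<^sub>R A"
proof -
  obtain m where m: "m > 0" "m *\<^sub>R 1 \<le>\<^sub>L A" using A by (auto simp: positive_definite_iff)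
  define c where "c = (norm X + 1) / m"
  have "0 < c" using m(1) by (simp add: c_def add_nonneg_pos)
  have cm: "c * m = norm X + 1" using m(1) by (simp add: c_def)
  have "qf X x \<le> (c * m) * (norm x)\<^sup>2" for x
    using abs_le_D1[OF qf_le_norm[of X x]] by (simp add: cm distrib_right add_increasing2)
  then have "X \<le>\<^sub>L (c * m) *\<^sub>R 1" using X by (auto simp: loewner_le_iff)
  also have "(c * m) *\<^sub>R 1 \<le>\<^sub>L c *\<^sub>R A"
    using loewner_scaleR_mono[of c, OF _ m(2)] \<open>0 < c\<close> by simp
  finally show thesis using that \<open>0 < c\<close> by blast
qed

lemma loewner_scaleR_left_mono:
  "op_positive X \<Longrightarrow> a \<le> b \<Longrightarrow> a *\<^sub>R X \<le>\<^sub>L b *\<^sub>R X"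
  by (auto simp: loewner_le_iff op_positive_iff intro: mult_right_mono)

lemma positive_definite_comparable:
  fixes X A :: "'a::nonzero_complex_hilbert_space bounded_op"
  assumes X: "positive_definite X" and A: "positive_definite A" and l: "0 < l"
  obtains k where "0 < k" "(l / k) *\<^sub>R X \<le>\<^sub>L A" "A \<le>\<^sub>L (l * k) *\<^sub>R X"
proof -
  obtain c where c: "0 < c" "X \<le>\<^sub>L c *\<^sub>R A"
    using positive_definite_dominates[OF A positive_definiteD(2)[OF X]] .
  obtain d where d: "0 < d" "A \<le>\<^sub>L d *\<^sub>R X"
    using positive_definite_dominates[OF X positive_definiteD(2)[OF A]] .
  define k where "k = l * c + d / l"
  have k: "0 < k" using c d l by (simp add: k_def add_pos_pos)
  have "(l / k) *\<^sub>R X \<le>\<^sub>L (1 / c) *\<^sub>R X"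
    using c d l k by (intro loewner_scaleR_left_mono positive_definiteD X) (simp add: k_def field_simps)
  also have "(1 / c) *\<^sub>R X \<le>\<^sub>L A"
    using loewner_scaleR_mono[of "1/c", OF _ c(2)] c(1) by simp
  finally have "(l / k) *\<^sub>R X \<le>\<^sub>L A" .
  moreover have "d \<le> l * k" using c l by (simp add: k_def distrib_left)
  then have "A \<le>\<^sub>L (l * k) *\<^sub>R X"
    using d(2) loewner_scaleR_left_mono[OF positive_definiteD(3)[OF X]] loewner_le_trans by blast
  ultimately show thesis using that k by blast
qed

section \<open>Convergence of the Riemann sums, and the rules for the relative entropy that
  follow\<close>

lemma tendsto_over_Suc: "(\<lambda>N. c / real (Suc N)) \<longlonglongrightarrow> 0"
  using tendsto_mult_right_zero[OF LIMSEQ_Suc[OF lim_1_over_n], of c] by simp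

lemma tendsto_rel_entropy_approx:
  assumes X: "positive_definite X" and A: "positive_definite A" and l: "0 < l"
  shows "(\<lambda>N. rel_entropy_approx (Suc N) (l *\<^sub>R X) A) \<longlonglongrightarrow> l *\<^sub>R (rel_entropy X A - ln l *\<^sub>R X)"
    (is "?F \<longlonglongrightarrow> ?S")
proof -
  obtain k where k: "0 < k" "(l / k) *\<^sub>R X \<le>\<^sub>L A" "A \<le>\<^sub>L (l * k) *\<^sub>R X"
    using positive_definite_comparable[OF X A l] .
  note bds = rel_entropy_approx_bounds[OF X A l k]
  have bound: "norm (?F N - ?S) \<le> (2 * k * l * norm X) / real (Suc N)" for N
  proof (rule norm_sa_le)
    note b = bds[of "Suc N"]
    show "op_self_adjoint (?F N - ?S)" using b by (auto simp: loewner_le_iff)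
    show "0 \<le> 2 * k * l * norm X / real (Suc N)" using k l by simp
    fix x
    have 1: "qf ?S x \<le> qf (?F N) x"
      and 2: "qf (?F N) x \<le> qf (l *\<^sub>R (rel_entropy X A + (2 * k / Suc N - ln l) *\<^sub>R X)) x"
      using b by (auto simp: loewner_le_iff simp del: qf_simps)
    from 2 have "qf (?F N) x - qf ?S x \<le> (2 * k * l / Suc N) * qf X x"
      by (simp add: algebra_simps)
    also have "\<dots> \<le> (2 * k * l / Suc N) * (norm X * (norm x)\<^sup>2)"
      using k l qf_le_norm[of X x] by (intro mult_left_mono) auto
    finally show "\<bar>qf (?F N - ?S) x\<bar> \<le> 2 * k * l * norm X / real (Suc N) * (norm x)\<^sup>2"
      using 1 by (simp add: qf_simps(2) mult.assoc del: qf_simps(1,3-))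
  qed
  have "(\<lambda>N. ?F N - ?S) \<longlonglongrightarrow> 0"
    by (rule Lim_null_comparison[OF always_eventually tendsto_over_Suc]) (rule allI, rule bound)
  then show ?thesis by (rule LIM_zero_cancel)
qed

lemma tendsto_rel_entropy_approx':
  assumes "positive_definite X" "positive_definite A"
  shows "(\<lambda>N. rel_entropy_approx (Suc N) X A) \<longlonglongrightarrow> rel_entropy X A"
  using tendsto_rel_entropy_approx[OF assms, of 1] by simp

lemma sa_rel_entropy:
  assumes "positive_definite X" "positive_definite A"
  shows "op_self_adjoint (rel_entropy X A)"
proof (rule sa_limit[OF tendsto_rel_entropy_approx'[OF assms]])
  show "op_self_adjoint (rel_entropy_approx (Suc N) X A)" for N
    unfolding rel_entropy_approx_def
    by (intro sa_sum sa_intros positive_definiteD(2) positive_definite_wharm assms) auto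
qed

lemma rel_entropy_approx_mono_right:
  assumes "positive_definite X" "positive_definite A" "A \<le>\<^sub>L A'"
  shows "rel_entropy_approx N X A \<le>\<^sub>L rel_entropy_approx N X A'"
proof -
  have "wharm (real j / real N) X A - X \<le>\<^sub>L wharm (real j / real N) X A' - X" if "j \<in> {1..N}" for j
    using wharm_mono[OF assms(1,2) _ assms(3), of X "real j / real N"] that assms(1)
    by (auto simp: loewner_le_iff positive_definiteD)
  then show ?thesis
    unfolding rel_entropy_approx_def by (intro loewner_sum_mono loewner_scaleR_mono) auto
qed

lemma rel_entropy_mono_right:
  assumes "positive_definite X" "positive_definite A" "A \<le>\<^sub>L A'"
  shows "rel_entropy X A \<le>\<^sub>L rel_entropy X A'"
  using tendsto_rel_entropy_approx'[OF assms(1,2)]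
    tendsto_rel_entropy_approx'[OF assms(1) positive_definite_mono[OF assms(2,3)]]
    rel_entropy_approx_mono_right[OF assms]
  by (rule loewner_limit)

lemma rel_entropy_congruence:
  assumes "positive_definite X" "positive_definite A" "op_self_adjoint C" "op_invertible C"
  shows "rel_entropy (C * X * C) (C * A * C) = C * rel_entropy X A * C"
proof (rule LIMSEQ_unique)
  show "(\<lambda>N. rel_entropy_approx (Suc N) (C * X * C) (C * A * C)) \<longlonglongrightarrow> rel_entropy (C * X * C) (C * A * C)"
    by (intro tendsto_rel_entropy_approx' positive_definite_congruence assms)
  show "(\<lambda>N. rel_entropy_approx (Suc N) (C * X * C) (C * A * C)) \<longlonglongrightarrow> C * rel_entropy X A * C"
    unfolding rel_entropy_approx_congruence[OF assms]
    by (intro tendsto_intros tendsto_rel_entropy_approx' assms)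
qed

lemma rel_entropy_scaleR:
  assumes "positive_definite X" "positive_definite A" "0 < r"
  shows "rel_entropy (r *\<^sub>R X) (r *\<^sub>R A) = r *\<^sub>R rel_entropy X A"
  using rel_entropy_congruence[OF assms(1,2), of "sqrt r *\<^sub>R 1"] assms(3)
  by (simp add: op_invertible_scaleR)

text \<open>In effect the composition rule log (g(T)) = (ln o g)(T). Instead of composing two
  functional calculi, both sides are squeezed between the same approximations. It is applied to g x
  = 1 / x.\<close>

lemma rel_entropy_one_left:
  assumes T: "positive_definite T" and B: "cfc_lim g T B"
    and g: "continuous_on {0<..} g" "\<And>x. 0 < x \<Longrightarrow> 0 < g x"
    and L: "cfc_lim (\<lambda>x. ln (g x)) T L"
  shows "rel_entropy 1 B = L"
proof -
  have sa: "op_self_adjoint T" using T by (rule positive_definiteD)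
  obtain m M where mM: "0 < m" "rspec T \<subseteq> {m..M}"
    using positive_definite_bounds[OF T] rspec_subset by metis
  have cg: "continuous_on {m..M} g" using mM by (intro continuous_on_subset[OF g(1)]) auto
  have "g x \<noteq> 0" if "x \<in> {m..M}" for x using g(2)[of x] mM(1) that by simp
  then have "continuous_on {m..M} (\<lambda>x. 1 / g x)" by (intro continuous_intros cg) auto
  then have bd: "bounded (g ` {m..M})" "bounded ((\<lambda>x. 1 / g x) ` {m..M})"
    using cg by (auto intro: compact_imp_bounded compact_continuous_image)
  obtain b where b: "\<forall>y\<in>g ` {m..M}. norm y \<le> b" using bd(1) unfolding bounded_iff by blast
  obtain c where c: "\<forall>y\<in>(\<lambda>x. 1 / g x) ` {m..M}. norm y \<le> c" using bd(2) unfolding bounded_iff by blast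
  have bc: "g x \<le> b" "1 / g x \<le> c" if "x \<in> rspec T" for x
    using b c that mM(2) by (auto simp: abs_le_iff)
  define k where "k = \<bar>b\<bar> + \<bar>c\<bar> + 1"
  have k: "0 < k" by (simp add: k_def)
  have gk: "1 / k \<le> g x \<and> g x \<le> 1 * k" if x: "x \<in> rspec T" for x
  proof -
    have "0 < g x" using g(2) rspec_positive[OF T x] by blast
    moreover have "1 / g x \<le> k" "g x \<le> k" using bc[OF x] by (auto simp: k_def)
    ultimately show ?thesis using k by (simp add: field_simps)
  qed
  note bds = rel_entropy_approx_one_bounds[OF T B g zero_less_one k gk L]
  have Bpd: "positive_definite B"
  proof -
    have "(1 / k) *\<^sub>R 1 \<le>\<^sub>L B" by (rule cfc_lim_mono[OF sa cfc_lim_const B]) (use gk in auto)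
    then show ?thesis unfolding positive_definite_iff using k by (intro exI[of _ "1 / k"]) auto
  qed
  note lim = tendsto_rel_entropy_approx'[OF positive_definite_one Bpd]
  have "L \<le>\<^sub>L rel_entropy 1 B"
    using bds(1)[of "Suc _"] by (intro loewner_limit[OF tendsto_const lim]) simp
  moreover have "rel_entropy 1 B \<le>\<^sub>L L"
  proof (rule loewner_limit[OF lim])
    show "(\<lambda>N. L + (2 * k / Suc N) *\<^sub>R 1) \<longlonglongrightarrow> L"
      using tendsto_add[OF tendsto_const tendsto_scaleR[OF tendsto_over_Suc tendsto_const], of L "2 * k" 1]
      by simp
    show "rel_entropy_approx (Suc N) 1 B \<le>\<^sub>L L + (2 * k / Suc N) *\<^sub>R 1" for N
      using bds(2)[of "Suc N"] by simp
  qed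
  ultimately show ?thesis by (intro loewner_antisym)
qed

text \<open>The source of self-duality under inversion. With B = R A R one has X^-1 = R R and A^-1 =
  R B^-1 R, so congruence with R reduces the claim to log (B^-1) = - log B.\<close>

lemma rel_entropy_op_inv:
  assumes X: "positive_definite X" and A: "positive_definite A"
  shows "rel_entropy (op_inv X) (op_inv A) = - (op_inv X * rel_entropy X A * op_inv X)"
proof -
  define R where "R = op_powr X (- (1/2))"
  note R = op_powr_minus_half[OF X, folded R_def]
  define B where "B = R * A * R"
  have B: "positive_definite B" unfolding B_def by (intro positive_definite_congruence R A)
  have saB: "op_self_adjoint B" using B by (rule positive_definiteD)
  have "rel_entropy 1 (op_inv B) = - op_log B"
  proof (rule rel_entropy_one_left[OF B])
    show "cfc_lim (\<lambda>x. 1 / x) B (op_inv B)"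
      by (rule cfc_lim_op_inv[OF B cfc_lim_id]) (auto intro!: continuous_intros)
    show "continuous_on {0<..} (\<lambda>x::real. 1 / x)" by (auto intro!: continuous_intros)
    have "cfc_lim (\<lambda>x. - 1 * ln x) B ((- 1) *\<^sub>R op_log B)"
      by (intro cfc_lim_scaleR saB cfc_lim_op_log B)
    then have "cfc_lim (\<lambda>x. ln (1 / x)) B ((- 1) *\<^sub>R op_log B)"
      by (rule cfc_lim_cong[rotated]) (auto dest: rspec_positive[OF B] simp: ln_div)
    then show "cfc_lim (\<lambda>x. ln (1 / x)) B (- op_log B)" by simp
  qed simp
  moreover have "op_inv B = op_inv R * op_inv A * op_inv R"
    unfolding B_def using R(2) positive_definiteD(1)[OF A] by (rule op_inv_congruence)
  then have "R * op_inv B * R = op_inv A" using R(2) by (simp add: mult.assoc op_inv)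
  ultimately have "rel_entropy (op_inv X) (op_inv A) = - (R * op_log B * R)"
    using rel_entropy_congruence[OF positive_definite_one positive_definite_op_inv[OF B] R(1,2)]
    by (simp add: R(3))
  also have "rel_entropy X A = op_inv R * op_log B * op_inv R"
    by (simp add: rel_entropy_def Let_def R_def B_def)
  then have "- (R * op_log B * R) = - (op_inv X * rel_entropy X A * op_inv X)"
    using R(2) by (simp add: mult.assoc flip: R(3))
  finally show ?thesis .
qed

section \<open>The Karcher equation\<close>

text \<open>Since \<open>1 - v' = (1 - v) / (1 + g)\<close>, iterating this bound drives the ratio \<open>v\<close> to \<open>1\<close>
  geometrically.\<close>

lemma wharm_scaleR_left_le:
  assumes Y: "positive_definite Y" and A: "positive_definite A" and c: "0 < c" "A \<le>\<^sub>L c *\<^sub>R Y"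
    and v: "0 < v" "v \<le> 1" and s: "r \<le> s" "0 < r" "s \<le> 1"
    and g: "g = r / c" and v': "v' = (v + g) / (1 + g)"
  shows "wharm s ((1 / v) *\<^sub>R Y) A \<le>\<^sub>L (1 / v') *\<^sub>R wharm s Y A"
proof -
  let ?D = "(1 - s) *\<^sub>R op_inv Y + s *\<^sub>R op_inv A"
  have g0: "0 < g" using c s by (simp add: g)
  have v'0: "0 < v'" using g0 v by (simp add: v')
  have D: "positive_definite ?D" using s by (intro positive_definite_convex positive_definite_op_inv Y A) auto
  have inv: "op_inv ((1 / v) *\<^sub>R Y) = v *\<^sub>R op_inv Y"
    using v Y by (simp add: op_inv_scaleR positive_definiteD)
  have "op_inv (c *\<^sub>R Y) \<le>\<^sub>L op_inv A" by (rule op_inv_antimono[OF A c(2)])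
  then have cA: "qf (op_inv Y) x \<le> c * qf (op_inv A) x" for x
    using c Y by (simp add: op_inv_scaleR positive_definiteD loewner_le_iff field_simps)
  \<comment> \<open>Rescaling Y shrinks only the first summand of \<open>?D\<close>, by the factor
    v. The second summand is at least g times the first, and v' = (v + g) / (1 + g) is the ratio in
    the extreme case of equality.\<close>
  have "v' *\<^sub>R ?D \<le>\<^sub>L (1 - s) *\<^sub>R (v *\<^sub>R op_inv Y) + s *\<^sub>R op_inv A"
  proof -
    have "v' * ((1 - s) * qf (op_inv Y) x + s * qf (op_inv A) x) \<le>
        (1 - s) * (v * qf (op_inv Y) x) + s * qf (op_inv A) x" for x
    proof -
      define p where "p = qf (op_inv Y) x"
      define q where "q = qf (op_inv A) x"
      have p: "0 \<le> p" unfolding p_def using positive_definite_op_inv[OF Y] by (rule positive_definiteD)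
      have "(1 - s) * (g * p) \<le> g * p" using s g0 p by (intro mult_left_le_one_le) auto
      also have "\<dots> \<le> g * (c * q)" using cA[of x] g0 by (simp add: p_def q_def)
      also have "g * (c * q) = r * q" using c by (simp add: g)
      also have "\<dots> \<le> s * q"
        using s positive_definiteD(4)[OF positive_definite_op_inv[OF A]] by (auto simp: q_def intro: mult_right_mono)
      finally have key: "(1 - s) * (g * p) \<le> s * q" .
      define d where "d = (1 - v) / (1 + g)"
      have d: "v' - v = g * d" "1 - v' = d"
        using g0 by (simp_all add: v' d_def field_simps)
      have "v' * ((1 - s) * p + s * q) - ((1 - s) * (v * p) + s * q) =
          (v' - v) * ((1 - s) * p) - (1 - v') * (s * q)"
        by (simp add: algebra_simps)
      also have "\<dots> = d * ((1 - s) * (g * p) - s * q)"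
        unfolding d by (simp add: algebra_simps)
      also have "\<dots> \<le> 0" using key v g0 by (intro mult_nonneg_nonpos) (auto simp: d_def)
      finally show ?thesis by (simp add: p_def q_def)
    qed
    then show ?thesis
      using Y A D by (auto simp: loewner_le_iff positive_definiteD positive_definite_op_inv mult.assoc)
  qed
  from op_inv_antimono[OF positive_definite_scaleR[OF v'0 D] this]
  show ?thesis unfolding wharm_def inv using v'0 D by (simp add: op_inv_scaleR positive_definiteD)
qed

section \<open>The Karcher equation of a weighted tuple: gradient, comparison and existence\<close>

locale weighted_tuple =
  fixes I :: "'i set" and w :: "'i \<Rightarrow> real"
    and A :: "'i \<Rightarrow> 'a::nonzero_complex_hilbert_space bounded_op"
  assumes A: "i \<in> I \<Longrightarrow> positive_definite (A i)"
    and w: "i \<in> I \<Longrightarrow> 0 \<le> w i"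
    and sum_w: "sum w I = 1"
begin

text \<open>In finite dimension, minus this expression is the Riemannian gradient of half the
  weighted sum of squared distances to the \<open>A i\<close>; hence also the name
  \<open>descent\<close>.\<close>

definition grad :: "'a bounded_op \<Rightarrow> 'a bounded_op" where
  "grad X = (\<Sum>i\<in>I. w i *\<^sub>R rel_entropy X (A i))"

definition grad_approx :: "nat \<Rightarrow> 'a bounded_op \<Rightarrow> 'a bounded_op" where
  "grad_approx N X = (\<Sum>i\<in>I. w i *\<^sub>R rel_entropy_approx N X (A i))"

text \<open>The step size is chosen so that the negative multiple of X in
  \<open>grad_approx N X\<close> cancels X. By \<open>descent_eq\<close> a weighted average of
  harmonic means remains, which is monotone in X.\<close>

definition descent :: "nat \<Rightarrow> 'a bounded_op \<Rightarrow> 'a bounded_op" where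
  "descent N X = X + (1 / (\<Sum>j=1..N. 1 / real j)) *\<^sub>R grad_approx N X"

lemma finite_I: "finite I"
  using sum_w by (metis sum.infinite zero_neq_one)

lemma I_nonempty: "I \<noteq> {}"
  using sum_w by auto

lemma harmonic_pos:
  assumes "1 \<le> N"
  shows "0 < (\<Sum>j=1..N. 1 / real j)"
  using assms by (intro sum_pos) auto

lemma descent_eq:
  assumes N: "1 \<le> N"
  shows "descent N X = (1 / (\<Sum>j=1..N. 1 / real j)) *\<^sub>R
    (\<Sum>i\<in>I. w i *\<^sub>R (\<Sum>j=1..N. (1 / real j) *\<^sub>R wharm (real j / real N) X (A i)))"
proof -
  define H where "H = (\<Sum>j=1..N. 1 / real j)"
  have "rel_entropy_approx N X B = (\<Sum>j=1..N. (1 / real j) *\<^sub>R wharm (real j / real N) X B) - H *\<^sub>R X" for B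
    unfolding rel_entropy_approx_def H_def
    by (simp add: scaleR_right_diff_distrib sum_subtractf scaleR_left.sum)
  then have "grad_approx N X = (\<Sum>i\<in>I. w i *\<^sub>R (\<Sum>j=1..N. (1 / real j) *\<^sub>R wharm (real j / real N) X (A i))) - H *\<^sub>R X"
    by (simp add: grad_approx_def scaleR_right_diff_distrib sum_subtractf sum_w flip: scaleR_left.sum sum_distrib_right)
  then show ?thesis
    using harmonic_pos[OF N] unfolding descent_def H_def[symmetric]
    by (simp add: scaleR_right_diff_distrib)
qed

text \<open>Writes a constant as the same kind of average as \<open>descent_eq\<close>, so that the
  two can be compared term by term.\<close>

lemma average_const:
  fixes X :: "'a bounded_op"
  assumes "1 \<le> N"
  shows "(1 / (\<Sum>j=1..N. 1 / real j)) *\<^sub>R (\<Sum>i\<in>I. w i *\<^sub>R (\<Sum>j=1..N. (1 / real j) *\<^sub>R X)) = X"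
proof -
  define H where "H = (\<Sum>j=1..N. 1 / real j)"
  have H: "0 < H" unfolding H_def by (rule harmonic_pos[OF assms])
  have inner: "(\<Sum>j=1..N. (1 / real j) *\<^sub>R X) = H *\<^sub>R X"
    unfolding H_def by (rule scaleR_left.sum[symmetric])
  have outer: "(\<Sum>i\<in>I. w i *\<^sub>R V) = V" for V :: "'a bounded_op"
    using scaleR_left.sum[of w I V] sum_w by simp
  show ?thesis unfolding H_def[symmetric] inner outer using H by simp
qed

lemma descent_mono:
  assumes "1 \<le> N" "positive_definite X" "X \<le>\<^sub>L X'"
  shows "descent N X \<le>\<^sub>L descent N X'"
  unfolding descent_eq[OF assms(1)] using harmonic_pos[OF assms(1)]
  by (intro loewner_scaleR_mono loewner_sum_mono wharm_mono assms A w loewner_le_refl positive_definiteD(2)) auto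

lemma comparable:
  assumes X: "positive_definite X" and l: "0 < l"
  obtains k where "0 < k" "\<And>i. i \<in> I \<Longrightarrow> (l / k) *\<^sub>R X \<le>\<^sub>L A i" "\<And>i. i \<in> I \<Longrightarrow> A i \<le>\<^sub>L (l * k) *\<^sub>R X"
proof -
  have "\<exists>k>0. (l / k) *\<^sub>R X \<le>\<^sub>L A i \<and> A i \<le>\<^sub>L (l * k) *\<^sub>R X" if "i \<in> I" for i
    using positive_definite_comparable[OF X A[OF that] l] by metis
  then obtain f where f: "\<And>i. i \<in> I \<Longrightarrow> 0 < f i \<and> (l / f i) *\<^sub>R X \<le>\<^sub>L A i \<and> A i \<le>\<^sub>L (l * f i) *\<^sub>R X"
    by metis
  define k where "k = sum f I"
  have k: "0 < k" unfolding k_def using f by (intro sum_pos finite_I I_nonempty) auto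
  have fk: "f i \<le> k" if "i \<in> I" for i
    unfolding k_def by (rule member_le_sum[OF that]) (use f finite_I in \<open>auto intro: less_imp_le\<close>)
  note mono = loewner_scaleR_left_mono[OF positive_definiteD(3)[OF X]]
  show thesis
  proof (rule that[OF k])
    fix i assume i: "i \<in> I"
    have "(l / k) *\<^sub>R X \<le>\<^sub>L (l / f i) *\<^sub>R X"
      using fk[OF i] f[OF i] l by (intro mono divide_left_mono) auto
    then show "(l / k) *\<^sub>R X \<le>\<^sub>L A i" using f[OF i] loewner_le_trans by blast
    have "(l * f i) *\<^sub>R X \<le>\<^sub>L (l * k) *\<^sub>R X"
      using fk[OF i] l by (intro mono mult_left_mono) auto
    then show "A i \<le>\<^sub>L (l * k) *\<^sub>R X" using f[OF i] loewner_le_trans by blast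
  qed
qed

lemma average: "(\<Sum>i\<in>I. w i *\<^sub>R l *\<^sub>R (rel_entropy X (A i) + c *\<^sub>R X)) = l *\<^sub>R (grad X + c *\<^sub>R X)"
  by (simp add: grad_def scaleR_right_distrib sum.distrib scaleR_sum_right mult_ac sum_w
      flip: scaleR_left.sum sum_distrib_left sum_distrib_right)

lemma grad_approx_bounds:
  assumes X: "positive_definite X" and l: "0 < l"
    and k: "0 < k" "\<And>i. i \<in> I \<Longrightarrow> (l / k) *\<^sub>R X \<le>\<^sub>L A i" "\<And>i. i \<in> I \<Longrightarrow> A i \<le>\<^sub>L (l * k) *\<^sub>R X"
    and N: "1 \<le> N"
  shows "l *\<^sub>R (grad X + (- ln l) *\<^sub>R X) \<le>\<^sub>L grad_approx N (l *\<^sub>R X)"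
    "grad_approx N (l *\<^sub>R X) \<le>\<^sub>L l *\<^sub>R (grad X + (2 * k / N - ln l) *\<^sub>R X)"
proof -
  note bds = rel_entropy_approx_bounds[OF X A l k(1) k(2) k(3) N]
  show "l *\<^sub>R (grad X + (- ln l) *\<^sub>R X) \<le>\<^sub>L grad_approx N (l *\<^sub>R X)"
    unfolding average[symmetric] grad_approx_def
    by (intro loewner_sum_mono loewner_scaleR_mono w) (use bds(1) in auto)
  show "grad_approx N (l *\<^sub>R X) \<le>\<^sub>L l *\<^sub>R (grad X + (2 * k / N - ln l) *\<^sub>R X)"
    unfolding average[symmetric] grad_approx_def
    by (intro loewner_sum_mono loewner_scaleR_mono w) (use bds(2) in auto)
qed

text \<open>If \<open>l\<close> is the least number with \<open>Z \<le> l Y\<close> and \<open>ln l > a + b\<close>, then applying the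
  monotone map \<open>descent N\<close> to \<open>Z \<le> l Y\<close> yields a smaller such number.\<close>

lemma grad_comparison:
  assumes Z: "positive_definite Z" and Y: "positive_definite Y" and a: "0 \<le> a"
    and gZ: "(- a) *\<^sub>R Z \<le>\<^sub>L grad Z" and gY: "grad Y \<le>\<^sub>L b *\<^sub>R Y"
  shows "Z \<le>\<^sub>L exp (a + b) *\<^sub>R Y"
proof -
  define V where "V = {l. Z \<le>\<^sub>L l *\<^sub>R Y}"
  have sa: "op_self_adjoint Z" "op_self_adjoint Y" using Z Y by (auto simp: positive_definiteD)
  have pos: "0 < qf T x" if T: "positive_definite T" and x: "x \<noteq> 0" for T :: "'a bounded_op" and x
  proof -
    obtain m where "0 < m" "m *\<^sub>R 1 \<le>\<^sub>L T" using T unfolding positive_definite_iff by blast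
    then have "0 < m * (norm x)\<^sup>2" "m * (norm x)\<^sup>2 \<le> qf T x" using x by (auto simp: loewner_le_iff)
    then show ?thesis by linarith
  qed
  obtain e :: 'a where e: "e \<noteq> 0" using ex_nonzero by blast
  have Vpos: "0 < l" if "l \<in> V" for l
  proof -
    have "qf Z e \<le> l * qf Y e" using that by (simp add: V_def loewner_le_iff)
    then have "0 < l * qf Y e" using pos[OF Z e] by linarith
    then show ?thesis using pos[OF Y e] by (simp add: zero_less_mult_iff)
  qed
  have ne: "V \<noteq> {}" using positive_definite_dominates[OF Y sa(1)] by (auto simp: V_def)
  have bdd: "bdd_below V" by (rule bdd_belowI[of _ 0]) (use Vpos in \<open>auto intro: less_imp_le\<close>)
  define l where "l = Inf V"
  have Zl: "qf Z x \<le> l * qf Y x" for x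
  proof (cases "x = 0")
    case False
    have "qf Z x / qf Y x \<le> l" unfolding l_def
    proof (rule cInf_greatest[OF ne])
      fix u assume "u \<in> V"
      then have "qf Z x \<le> u * qf Y x" by (simp add: V_def loewner_le_iff)
      then show "qf Z x / qf Y x \<le> u" using pos[OF Y False] by (simp add: field_simps)
    qed
    then show ?thesis using pos[OF Y False] by (simp add: field_simps)
  qed (simp add: qf_def)
  then have lV: "l \<in> V" using sa by (auto simp: V_def loewner_le_iff)
  then have l: "0 < l" by (rule Vpos)
  have "ln l \<le> a + b"
  proof (rule ccontr)
    assume "\<not> ln l \<le> a + b"
    then have gap: "0 < ln l - a - b" by simp
    obtain k where k: "0 < k" "\<And>i. i \<in> I \<Longrightarrow> (l / k) *\<^sub>R Y \<le>\<^sub>L A i" "\<And>i. i \<in> I \<Longrightarrow> A i \<le>\<^sub>L (l * k) *\<^sub>R Y"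
      using comparable[OF Y l] by blast
    obtain k' where k': "0 < k'" "\<And>i. i \<in> I \<Longrightarrow> (1 / k') *\<^sub>R Z \<le>\<^sub>L A i" "\<And>i. i \<in> I \<Longrightarrow> A i \<le>\<^sub>L (1 * k') *\<^sub>R Z"
      using comparable[OF Z zero_less_one] by blast
    \<comment> \<open>N is fixed here, with discretization error below the gap. The step size t
      shrinks as N grows, but the contradiction only requires the new factor to be smaller than l,
      at no particular rate.\<close>
    obtain N0 where "2 * k / real (Suc N0) < ln l - a - b"
      using order_tendstoD(2)[OF tendsto_over_Suc gap, of "2 * k"] by (auto simp: eventually_sequentially)
    then obtain N where N: "1 \<le> N" "2 * k / real N < ln l - a - b" by (metis le_add1 plus_1_eq_Suc)
    define t where "t = 1 / (\<Sum>j=1..N. 1 / real j)"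
    have t: "0 < t" using harmonic_pos[OF N(1)] by (simp add: t_def)
    define c where "c = b + 2 * k / N - ln l"
    have "Z \<le>\<^sub>L (l * (1 + t * (c + a))) *\<^sub>R Y"
    proof -
      have "qf Z x \<le> l * (1 + t * (c + a)) * qf Y x" for x
      proof -
        define z where "z = qf Z x"
        define y where "y = qf Y x"
        have "qf (descent N Z) x \<le> qf (descent N (l *\<^sub>R Y)) x"
          using descent_mono[OF N(1) Z] lV by (simp add: V_def loewner_le_iff del: qf_simps)
        then have 1: "z + t * qf (grad_approx N Z) x \<le> l * y + t * qf (grad_approx N (l *\<^sub>R Y)) x"
          by (simp add: descent_def t_def z_def y_def)
        have "qf (grad Z) x \<le> qf (grad_approx N Z) x"
          using grad_approx_bounds(1)[OF Z zero_less_one k' N(1)] by (simp add: loewner_le_iff)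
        moreover have "- a * z \<le> qf (grad Z) x" using gZ by (simp add: loewner_le_iff z_def)
        ultimately have "- a * z \<le> qf (grad_approx N Z) x" by linarith
        then have 2: "t * (- a * z) \<le> t * qf (grad_approx N Z) x" using t by (intro mult_left_mono) auto
        have "qf (grad_approx N (l *\<^sub>R Y)) x \<le> l * (qf (grad Y) x + (2 * k / N - ln l) * y)"
          using grad_approx_bounds(2)[OF Y l k N(1)] by (simp add: loewner_le_iff y_def)
        also have "qf (grad Y) x \<le> b * y" using gY by (simp add: loewner_le_iff y_def)
        then have "l * (qf (grad Y) x + (2 * k / N - ln l) * y) \<le> l * (c * y)"
          using l by (intro mult_left_mono) (auto simp: c_def algebra_simps)
        finally have 3: "t * qf (grad_approx N (l *\<^sub>R Y)) x \<le> t * (l * (c * y))" using t by simp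
        \<comment> \<open>Replacing z by its bound l y in the error term t a z collects everything
          into the factor l (1 + t (c + a)), and c + a < 0 by the choice of N.\<close>
        have 4: "(t * a) * z \<le> (t * a) * (l * y)"
          using t a Zl[of x] by (intro mult_left_mono) (auto simp: z_def y_def)
        show ?thesis using 1 2 3 4 unfolding z_def[symmetric] y_def[symmetric] by (simp add: algebra_simps)
      qed
      then show ?thesis using sa by (auto simp: loewner_le_iff)
    qed
    then have "l * (1 + t * (c + a)) \<in> V" by (simp add: V_def)
    then have "l \<le> l * (1 + t * (c + a))" unfolding l_def by (rule cInf_lower[OF _ bdd])
    moreover have "t * (c + a) < 0" using t N(2) by (intro mult_pos_neg) (auto simp: c_def)
    ultimately show False using l by (simp add: mult_le_cancel_left1)
  qed
  then have "l \<le> exp (a + b)" using l by (metis exp_le_cancel_iff exp_ln)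
  then have "l *\<^sub>R Y \<le>\<^sub>L exp (a + b) *\<^sub>R Y" by (intro loewner_scaleR_left_mono positive_definiteD(3)[OF Y])
  then show ?thesis using lV loewner_le_trans by (auto simp: V_def)
qed

text \<open>At fixed N only finitely many inverses occur, and they stay bounded. This takes the
  place of continuity of \<open>rel_entropy\<close> in its first argument.\<close>

lemma tendsto_grad_approx:
  assumes X: "X \<longlonglongrightarrow> Y" and a: "0 < a" "\<And>m. a *\<^sub>R 1 \<le>\<^sub>L X m"
    and b: "0 < b" "\<And>m. X m \<le>\<^sub>L b *\<^sub>R 1" "\<And>i. i \<in> I \<Longrightarrow> A i \<le>\<^sub>L b *\<^sub>R 1"
  shows "(\<lambda>m. grad_approx N (X m)) \<longlonglongrightarrow> grad_approx N Y"
proof -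
  have pd: "positive_definite (X m)" for m using a unfolding positive_definite_iff by blast
  have inv_ge: "(1 / b) *\<^sub>R 1 \<le>\<^sub>L op_inv T" if "positive_definite T" "T \<le>\<^sub>L b *\<^sub>R 1" for T :: "'a bounded_op"
    using op_inv_antimono[OF that] b(1) by (simp add: op_inv_scaleR)
  have "(\<lambda>m. wharm s (X m) (A i)) \<longlonglongrightarrow> wharm s Y (A i)" if i: "i \<in> I" and s: "0 \<le> s" "s \<le> 1" for i s
    unfolding wharm_def
  proof (rule tendsto_op_inv)
    show "(\<lambda>m. (1 - s) *\<^sub>R op_inv (X m) + s *\<^sub>R op_inv (A i)) \<longlonglongrightarrow> (1 - s) *\<^sub>R op_inv Y + s *\<^sub>R op_inv (A i)"
      by (intro tendsto_intros tendsto_op_inv[OF X a])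
    show "0 < 1 / b" using b(1) by simp
    have "(1 - s) *\<^sub>R (1 / b) *\<^sub>R 1 + s *\<^sub>R (1 / b) *\<^sub>R 1 \<le>\<^sub>L (1 - s) *\<^sub>R op_inv (X m) + s *\<^sub>R op_inv (A i)" for m
      by (intro loewner_convex_mono inv_ge pd b A i s)
    then show "(1 / b) *\<^sub>R 1 \<le>\<^sub>L (1 - s) *\<^sub>R op_inv (X m) + s *\<^sub>R op_inv (A i)" for m
      by (simp flip: scaleR_left_distrib add_divide_distrib)
  qed
  then show ?thesis
    unfolding grad_approx_def rel_entropy_approx_def by (intro tendsto_intros X) auto
qed

text \<open>Monotone iteration of \<open>descent N\<close> from the upper solution k 1 and the lower
  solution (1/k) 1, whose initial ratio is 1 / (k k). Each step applies
  \<open>wharm_scaleR_left_le\<close> with least node r = 1 / N and c = k k, because A i \<le> k 1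
  \<le> k k Y; this is where \<gamma> comes from. The explicit ratio yields closeness in norm, which
  monotonicity alone would not.\<close>

lemma descent_pairs:
  assumes N: "1 \<le> N" and k: "1 \<le> k" "\<And>i. i \<in> I \<Longrightarrow> (1 / k) *\<^sub>R 1 \<le>\<^sub>L A i" "\<And>i. i \<in> I \<Longrightarrow> A i \<le>\<^sub>L k *\<^sub>R 1"
  defines "\<gamma> \<equiv> (1 / N) / (k * k)"
  shows "\<exists>X Y. (1 / k) *\<^sub>R 1 \<le>\<^sub>L Y \<and> Y \<le>\<^sub>L X \<and> X \<le>\<^sub>L k *\<^sub>R 1 \<and> descent N X \<le>\<^sub>L X \<and> Y \<le>\<^sub>L descent N Y \<and>
    (1 - (1 - 1 / (k * k)) * (1 / (1 + \<gamma>)) ^ q) *\<^sub>R X \<le>\<^sub>L Y"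
proof (induction q)
  case 0
  have pd: "positive_definite (c *\<^sub>R (1::'a bounded_op))" if "0 < c" for c
    using that by (simp add: positive_definite_scaleR)
  have "descent N (k *\<^sub>R 1) \<le>\<^sub>L k *\<^sub>R 1"
  proof (subst (2) average_const[OF N, symmetric], unfold descent_eq[OF N],
      intro loewner_scaleR_mono loewner_sum_mono w)
    fix i j assume i: "i \<in> I" and j: "j \<in> {1..N}"
    show "wharm (real j / real N) (k *\<^sub>R 1) (A i) \<le>\<^sub>L k *\<^sub>R 1"
      using wharm_mono[OF pd A[OF i] _ k(3)[OF i], of k "k *\<^sub>R 1" "real j / real N"] j k(1)
        wharm_self[OF pd, of k] by (simp add: loewner_le_refl)
  qed (use harmonic_pos[OF N] in auto)
  moreover have "(1 / k) *\<^sub>R 1 \<le>\<^sub>L descent N ((1 / k) *\<^sub>R 1)"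
  proof (subst (1) average_const[OF N, symmetric], unfold descent_eq[OF N],
      intro loewner_scaleR_mono loewner_sum_mono w)
    fix i j assume i: "i \<in> I" and j: "j \<in> {1..N}"
    show "(1 / k) *\<^sub>R 1 \<le>\<^sub>L wharm (real j / real N) ((1 / k) *\<^sub>R 1) (A i)"
      using wharm_mono[OF pd pd _ k(2)[OF i], of "1 / k" "(1 / k) *\<^sub>R 1" "real j / real N"] j k(1)
        wharm_self[OF pd, of "1 / k"] by (simp add: loewner_le_refl)
  qed (use harmonic_pos[OF N] in auto)
  moreover have "(1 / k) *\<^sub>R 1 \<le>\<^sub>L k *\<^sub>R (1::'a bounded_op)"
  proof -
    have "1 / k \<le> 1" using k(1) by simp
    also note k(1)
    finally show ?thesis by (intro loewner_scaleR_left_mono) (simp_all add: positive_definiteD)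
  qed
  ultimately show ?case
    using k(1) by (intro exI[of _ "k *\<^sub>R 1"] exI[of _ "(1 / k) *\<^sub>R 1"]) (simp add: loewner_le_refl)
next
  case (Suc q)
  define v where "v = 1 - (1 - 1 / (k * k)) * (1 / (1 + \<gamma>)) ^ q"
  from Suc obtain X Y where XY: "(1 / k) *\<^sub>R 1 \<le>\<^sub>L Y" "Y \<le>\<^sub>L X" "X \<le>\<^sub>L k *\<^sub>R 1"
    "descent N X \<le>\<^sub>L X" "Y \<le>\<^sub>L descent N Y" "v *\<^sub>R X \<le>\<^sub>L Y"
    unfolding v_def by blast
  have g: "0 < \<gamma>" using N k(1) by (simp add: \<gamma>_def)
  have kk: "0 < 1 / (k * k)" "1 / (k * k) \<le> 1"
    using k(1) mult_mono[OF k(1) k(1)] by simp_all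
  have p: "0 \<le> (1 / (1 + \<gamma>)) ^ q" "(1 / (1 + \<gamma>)) ^ q \<le> 1"
    using g by (auto intro!: power_le_one)
  have v: "0 < v" "v \<le> 1"
  proof -
    define c where "c = 1 - 1 / (k * k)"
    have c: "0 \<le> c" "c < 1" using kk unfolding c_def by linarith+
    have "c * (1 / (1 + \<gamma>)) ^ q \<le> c" using c p by (intro mult_left_le) auto
    with c show "0 < v" unfolding v_def c_def[symmetric] by linarith
    show "v \<le> 1" unfolding v_def using kk p by simp
  qed
  define v' where "v' = (v + \<gamma>) / (1 + \<gamma>)"
  have v'_eq: "v' = 1 - (1 - 1 / (k * k)) * (1 / (1 + \<gamma>)) ^ Suc q"
  proof -
    have "v' = 1 - (1 - v) * (1 / (1 + \<gamma>))" using g by (simp add: v'_def field_simps)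
    then show ?thesis by (simp add: v_def)
  qed
  have v'0: "0 < v'" using v g by (simp add: v'_def)
  have Y: "positive_definite Y"
    using XY(1) k(1) unfolding positive_definite_iff by (intro exI[of _ "1 / k"]) auto
  have X: "positive_definite X" by (rule positive_definite_mono[OF Y XY(2)])
  have dX: "positive_definite (descent N X)"
    by (rule positive_definite_mono[OF Y]) (meson XY descent_mono[OF N Y] loewner_le_trans)
  have XvY: "X \<le>\<^sub>L (1 / v) *\<^sub>R Y"
    using loewner_scaleR_mono[of "1 / v", OF _ XY(6)] v by simp
  have AY: "A i \<le>\<^sub>L (k * k) *\<^sub>R Y" if i: "i \<in> I" for i
  proof -
    have "k *\<^sub>R 1 \<le>\<^sub>L (k * k) *\<^sub>R Y"
      using loewner_scaleR_mono[of "k * k", OF _ XY(1)] k(1) by simp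
    with k(3)[OF i] show ?thesis by (rule loewner_le_trans)
  qed
  have "descent N X \<le>\<^sub>L descent N ((1 / v) *\<^sub>R Y)" by (rule descent_mono[OF N X XvY])
  also have "descent N ((1 / v) *\<^sub>R Y) \<le>\<^sub>L (1 / v') *\<^sub>R descent N Y"
  proof -
    have "wharm (real j / real N) ((1 / v) *\<^sub>R Y) (A i) \<le>\<^sub>L (1 / v') *\<^sub>R wharm (real j / real N) Y (A i)"
      if i: "i \<in> I" and j: "j \<in> {1..N}" for i j
    proof (rule wharm_scaleR_left_le[OF Y A[OF i] _ AY[OF i] v _ _ _ _ v'_def])
      show "1 / real N \<le> real j / real N" using j by (intro divide_right_mono) auto
      show "\<gamma> = 1 / real N / (k * k)" by (simp add: \<gamma>_def)
    qed (use k(1) N j in auto)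
    then have "descent N ((1 / v) *\<^sub>R Y) \<le>\<^sub>L (1 / (\<Sum>j=1..N. 1 / real j)) *\<^sub>R
        (\<Sum>i\<in>I. w i *\<^sub>R (\<Sum>j=1..N. (1 / real j) *\<^sub>R (1 / v') *\<^sub>R wharm (real j / real N) Y (A i)))"
      unfolding descent_eq[OF N] using harmonic_pos[OF N]
      by (intro loewner_scaleR_mono loewner_sum_mono w) auto
    also have "\<dots> = (1 / v') *\<^sub>R descent N Y"
      unfolding descent_eq[OF N] by (simp add: scaleR_sum_right mult_ac)
    finally show ?thesis .
  qed
  finally have "v' *\<^sub>R descent N X \<le>\<^sub>L descent N Y"
    using loewner_scaleR_mono[of v' "descent N X"] v'0 by fastforce
  moreover have "(1 / k) *\<^sub>R 1 \<le>\<^sub>L descent N Y" using XY(1,5) by (rule loewner_le_trans)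
  moreover have "descent N Y \<le>\<^sub>L descent N X" by (rule descent_mono[OF N Y XY(2)])
  moreover have "descent N X \<le>\<^sub>L k *\<^sub>R 1" using XY(4,3) by (rule loewner_le_trans)
  moreover have "descent N (descent N X) \<le>\<^sub>L descent N X" by (rule descent_mono[OF N dX XY(4)])
  moreover have "descent N Y \<le>\<^sub>L descent N (descent N Y)" by (rule descent_mono[OF N Y XY(5)])
  ultimately show ?case unfolding v'_eq by blast
qed

text \<open>The inequalities for \<open>descent\<close> give the signs of
  \<open>grad_approx\<close>. As the approximation lies above the entropy, the sign at X passes to
  \<open>grad X\<close> without loss, while Y pays the error 2 k k / N.\<close>

lemma approximate_solutions:
  fixes N :: nat
  assumes N: "1 \<le> N" and k: "1 \<le> k" "\<And>i. i \<in> I \<Longrightarrow> (1 / k) *\<^sub>R 1 \<le>\<^sub>L A i" "\<And>i. i \<in> I \<Longrightarrow> A i \<le>\<^sub>L k *\<^sub>R 1"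
  shows "\<exists>X Y. (1 / k) *\<^sub>R 1 \<le>\<^sub>L Y \<and> Y \<le>\<^sub>L X \<and> X \<le>\<^sub>L k *\<^sub>R 1 \<and> (1 - 1 / N) *\<^sub>R X \<le>\<^sub>L Y \<and>
    grad X \<le>\<^sub>L 0 \<and> (- (2 * (k * k) / N)) *\<^sub>R Y \<le>\<^sub>L grad Y"
proof -
  define \<gamma> where "\<gamma> = (1 / N) / (k * k)"
  have g: "0 < \<gamma>" using N k(1) by (simp add: \<gamma>_def)
  have kk: "0 < 1 / (k * k)" "1 / (k * k) \<le> 1"
    using k(1) mult_mono[OF k(1) k(1)] by simp_all
  obtain q where q: "(1 / (1 + \<gamma>)) ^ q < 1 / N"
    using real_arch_pow_inv[of "1 / N" "1 / (1 + \<gamma>)"] g N by auto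
  obtain X Y where XY: "(1 / k) *\<^sub>R 1 \<le>\<^sub>L Y" "Y \<le>\<^sub>L X" "X \<le>\<^sub>L k *\<^sub>R 1"
    "descent N X \<le>\<^sub>L X" "Y \<le>\<^sub>L descent N Y" "(1 - (1 - 1 / (k * k)) * (1 / (1 + \<gamma>)) ^ q) *\<^sub>R X \<le>\<^sub>L Y"
    using descent_pairs[OF N k, of q] unfolding \<gamma>_def by blast
  have Y: "positive_definite Y"
    using XY(1) k(1) unfolding positive_definite_iff by (intro exI[of _ "1 / k"]) auto
  have X: "positive_definite X" by (rule positive_definite_mono[OF Y XY(2)])
  have "(1 - 1 / (k * k)) * (1 / (1 + \<gamma>)) ^ q \<le> 1 * (1 / N)"
    using kk q g by (intro mult_mono) auto
  then have "(1 - 1 / N) *\<^sub>R X \<le>\<^sub>L (1 - (1 - 1 / (k * k)) * (1 / (1 + \<gamma>)) ^ q) *\<^sub>R X"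
    by (intro loewner_scaleR_left_mono positive_definiteD(3)[OF X]) simp
  then have close: "(1 - 1 / N) *\<^sub>R X \<le>\<^sub>L Y" using XY(6) by (rule loewner_le_trans)
  have comp: "(1 / (k * k)) *\<^sub>R Z \<le>\<^sub>L A i" "A i \<le>\<^sub>L (1 * (k * k)) *\<^sub>R Z"
    if Z: "(1 / k) *\<^sub>R 1 \<le>\<^sub>L Z" "Z \<le>\<^sub>L k *\<^sub>R 1" and i: "i \<in> I" for Z i
  proof -
    have "(1 / (k * k)) *\<^sub>R Z \<le>\<^sub>L (1 / k) *\<^sub>R 1"
      using loewner_scaleR_mono[of "1 / (k * k)", OF _ Z(2)] k(1) by simp
    then show "(1 / (k * k)) *\<^sub>R Z \<le>\<^sub>L A i" using k(2)[OF i] by (rule loewner_le_trans)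
    have "k *\<^sub>R 1 \<le>\<^sub>L (1 * (k * k)) *\<^sub>R Z"
      using loewner_scaleR_mono[of "k * k", OF _ Z(1)] k(1) by simp
    with k(3)[OF i] show "A i \<le>\<^sub>L (1 * (k * k)) *\<^sub>R Z" by (rule loewner_le_trans)
  qed
  have H: "0 < (\<Sum>j=1..N. 1 / real j)" by (rule harmonic_pos[OF N])
  have kk0: "0 < k * k" using k(1) by simp
  note bX = grad_approx_bounds(1)[OF X zero_less_one kk0 comp[OF loewner_le_trans[OF XY(1,2)] XY(3)] N]
  note bY = grad_approx_bounds(2)[OF Y zero_less_one kk0 comp[OF XY(1) loewner_le_trans[OF XY(2,3)]] N]
  have "qf (grad_approx N X) x \<le> 0" for x
  proof -
    have "qf (descent N X) x \<le> qf X x" using XY(4) by (simp add: loewner_le_iff)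
    then have "(1 / (\<Sum>j=1..N. 1 / real j)) * qf (grad_approx N X) x \<le> 0"
      by (simp add: descent_def)
    then show ?thesis using H by (simp add: mult_le_0_iff divide_le_0_iff)
  qed
  then have gX: "grad X \<le>\<^sub>L 0"
    using bX by (auto simp: loewner_le_iff intro: order_trans)
  have "0 \<le> qf (grad_approx N Y) x" for x
  proof -
    have "qf Y x \<le> qf (descent N Y) x" using XY(5) by (simp add: loewner_le_iff)
    then have "0 \<le> (1 / (\<Sum>j=1..N. 1 / real j)) * qf (grad_approx N Y) x"
      by (simp add: descent_def)
    then show ?thesis using H by (simp add: zero_le_mult_iff zero_le_divide_iff)
  qed
  moreover have "qf (grad_approx N Y) x \<le> qf (grad Y) x + 2 * (k * k) / N * qf Y x" for x
    using bY by (simp add: loewner_le_iff)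
  ultimately have nn: "0 \<le> qf (grad Y) x + 2 * (k * k) / N * qf Y x" for x
    using order_trans by blast
  have "- (2 * (k * k) / N) * qf Y x \<le> qf (grad Y) x" for x
    using nn[of x] by simp
  moreover have "op_self_adjoint (grad Y)"
    unfolding grad_def by (intro sa_sum sa_intros sa_rel_entropy Y A)
  ultimately have gY: "(- (2 * (k * k) / N)) *\<^sub>R Y \<le>\<^sub>L grad Y"
    using Y by (auto simp: loewner_le_iff positive_definiteD)
  show ?thesis using XY close gX gY by blast
qed

text \<open>\<open>grad_comparison\<close> turns the approximate solutions into a norm Cauchy sequence.\<close>

lemma karcher_equation_exists: "\<exists>X. positive_definite X \<and> grad X = 0"
proof -
  obtain k0 where k0: "0 < k0" "\<And>i. i \<in> I \<Longrightarrow> (1 / k0) *\<^sub>R 1 \<le>\<^sub>L A i" "\<And>i. i \<in> I \<Longrightarrow> A i \<le>\<^sub>L (1 * k0) *\<^sub>R 1"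
    using comparable[OF positive_definite_one zero_less_one] by blast
  define k where "k = k0 + 1"
  have k1: "1 \<le> k" using k0 by (simp add: k_def)
  note mono1 = loewner_scaleR_left_mono[OF positive_definiteD(3)[OF positive_definite_one]]
  have kA: "(1 / k) *\<^sub>R 1 \<le>\<^sub>L A i" "A i \<le>\<^sub>L k *\<^sub>R 1" if i: "i \<in> I" for i
  proof -
    have "1 / k \<le> 1 / k0" using k0(1) by (simp add: k_def field_simps)
    from loewner_le_trans[OF mono1[OF this] k0(2)[OF i]] show "(1 / k) *\<^sub>R 1 \<le>\<^sub>L A i" .
    have "1 * k0 \<le> k" by (simp add: k_def)
    from loewner_le_trans[OF k0(3)[OF i] mono1[OF this]] show "A i \<le>\<^sub>L k *\<^sub>R 1" .
  qed
  define K where "K = 2 * (k * k)"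
  have "\<exists>X Y. (1 / k) *\<^sub>R 1 \<le>\<^sub>L Y \<and> Y \<le>\<^sub>L X \<and> X \<le>\<^sub>L k *\<^sub>R 1 \<and> (1 - 1 / Suc m) *\<^sub>R X \<le>\<^sub>L Y \<and>
    grad X \<le>\<^sub>L 0 \<and> (- (K / Suc m)) *\<^sub>R Y \<le>\<^sub>L grad Y" for m
    using approximate_solutions[of "Suc m" k, OF _ k1 kA] by (simp add: K_def)
  then obtain X Y where XY: "\<And>m. (1 / k) *\<^sub>R 1 \<le>\<^sub>L Y m" "\<And>m. Y m \<le>\<^sub>L X m" "\<And>m. X m \<le>\<^sub>L k *\<^sub>R 1"
    "\<And>m. (1 - 1 / Suc m) *\<^sub>R X m \<le>\<^sub>L Y m" "\<And>m. grad (X m) \<le>\<^sub>L 0"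
    "\<And>m. (- (K / Suc m)) *\<^sub>R Y m \<le>\<^sub>L grad (Y m)"
    by metis
  have kpos: "0 < 1 / k" "0 < k" using k1 by simp_all
  have Xge: "(1 / k) *\<^sub>R 1 \<le>\<^sub>L X m" for m using XY(1,2) by (rule loewner_le_trans)
  have Yle: "Y m \<le>\<^sub>L k *\<^sub>R 1" for m using XY(2,3) by (rule loewner_le_trans)
  have pdX: "positive_definite (X m)" and pdY: "positive_definite (Y m)" for m
    unfolding positive_definite_iff using Xge XY(1) kpos by blast+
  \<comment> \<open>Two losses, each measured against X \<le> k 1: the factor exp (K / Suc m) in
    comparing \<open>Y m\<close> with any \<open>X l\<close>, and the relative gap 1 / Suc m between
    \<open>X m\<close> and \<open>Y m\<close>.\<close>
  define \<delta> where "\<delta> m = (exp (K / Suc m) - 1 + 1 / Suc m) * k" for m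
  have \<delta>_lim: "\<delta> \<longlonglongrightarrow> 0"
  proof -
    have "\<delta> \<longlonglongrightarrow> (exp 0 - 1 + 0) * k"
      unfolding \<delta>_def by (intro tendsto_intros tendsto_over_Suc)
    then show ?thesis by simp
  qed
  have K0: "0 \<le> K" by (simp add: K_def)
  have \<delta>0: "0 \<le> \<delta> m" for m
    using K0 kpos by (simp add: \<delta>_def)
  have diff: "qf (X m) x - qf (X l) x \<le> \<delta> m * (norm x)\<^sup>2" for m l x
  proof -
    have "Y m \<le>\<^sub>L exp (K / Suc m + 0) *\<^sub>R X l"
      using XY(5,6) K0 by (intro grad_comparison pdX pdY) auto
    then have 1: "qf (Y m) x \<le> exp (K / Suc m) * qf (X l) x" by (simp add: loewner_le_iff)
    have 2: "(1 - 1 / Suc m) * qf (X m) x \<le> qf (Y m) x" using XY(4)[of m] by (simp add: loewner_le_iff)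
    have b: "qf (X i) x \<le> k * (norm x)\<^sup>2" for i using XY(3)[of i] by (simp add: loewner_le_iff)
    have "1 / real (Suc m) * qf (X m) x \<le> 1 / real (Suc m) * (k * (norm x)\<^sup>2)"
      by (intro mult_left_mono b) simp
    moreover have "(exp (K / Suc m) - 1) * qf (X l) x \<le> (exp (K / Suc m) - 1) * (k * (norm x)\<^sup>2)"
      using K0 by (intro mult_left_mono b) simp
    ultimately show ?thesis using 1 2 by (simp add: \<delta>_def algebra_simps)
  qed
  have "Cauchy X"
  proof (rule metric_CauchyI)
    fix e :: real assume "0 < e"
    then obtain M where M: "\<And>m. M \<le> m \<Longrightarrow> \<delta> m < e / 2"
      using order_tendstoD(2)[OF \<delta>_lim, of "e / 2"] by (auto simp: eventually_sequentially)
    have "dist (X m) (X l) < e" if "M \<le> m" "M \<le> l" for m l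
    proof -
      have "norm (X m - X l) \<le> e / 2"
      proof (rule norm_sa_le)
        show "op_self_adjoint (X m - X l)" by (intro sa_intros positive_definiteD pdX)
        fix x :: 'a
        have "\<delta> i * (norm x)\<^sup>2 \<le> e / 2 * (norm x)\<^sup>2" if "M \<le> i" for i
          using M[OF that] by (intro mult_right_mono) auto
        from this[OF that(1)] this[OF that(2)] show "\<bar>qf (X m - X l) x\<bar> \<le> e / 2 * (norm x)\<^sup>2"
          using diff[of m x l] diff[of l x m] unfolding abs_le_iff qf_simps by linarith
      qed (use \<open>0 < e\<close> in simp)
      then show ?thesis using \<open>0 < e\<close> by (simp add: dist_norm)
    qed
    then show "\<exists>M. \<forall>m\<ge>M. \<forall>n\<ge>M. dist (X m) (X n) < e" by blast
  qed
  then obtain Z where Z: "X \<longlonglongrightarrow> Z" by (auto simp: Cauchy_convergent_iff convergent_def)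
  have "(\<lambda>m. Y m - X m) \<longlonglongrightarrow> 0"
  proof (rule Lim_null_comparison[OF always_eventually tendsto_over_Suc[of k]], rule allI)
    fix m
    show "norm (Y m - X m) \<le> k / real (Suc m)"
    proof (rule norm_sa_le)
      show "op_self_adjoint (Y m - X m)" by (intro sa_intros positive_definiteD pdX pdY)
      fix x :: 'a
      have "qf (Y m) x \<le> qf (X m) x" "(1 - 1 / Suc m) * qf (X m) x \<le> qf (Y m) x"
        using XY(2,4)[of m] by (auto simp: loewner_le_iff)
      moreover have "1 / real (Suc m) * qf (X m) x \<le> 1 / real (Suc m) * (k * (norm x)\<^sup>2)"
        using XY(3)[of m] by (intro mult_left_mono) (auto simp: loewner_le_iff)
      ultimately show "\<bar>qf (Y m - X m) x\<bar> \<le> k / real (Suc m) * (norm x)\<^sup>2"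
        by (simp add: abs_le_iff algebra_simps)
    qed (use kpos in simp)
  qed
  from tendsto_add[OF this Z] have YZ: "Y \<longlonglongrightarrow> Z" by simp
  have "(1 / k) *\<^sub>R 1 \<le>\<^sub>L Z" by (rule loewner_limit[OF tendsto_const Z Xge])
  then have pdZ: "positive_definite Z" using kpos unfolding positive_definite_iff by blast
  have grad_lim: "(\<lambda>N. grad_approx (Suc N) T) \<longlonglongrightarrow> grad T" if "positive_definite T" for T
    unfolding grad_def grad_approx_def by (intro tendsto_intros tendsto_rel_entropy_approx' that A)
  have comp: "(1 / (k * k)) *\<^sub>R T \<le>\<^sub>L A i" "A i \<le>\<^sub>L (1 * (k * k)) *\<^sub>R T"
    if T: "(1 / k) *\<^sub>R 1 \<le>\<^sub>L T" "T \<le>\<^sub>L k *\<^sub>R 1" and i: "i \<in> I" for T i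
  proof -
    have "(1 / (k * k)) *\<^sub>R T \<le>\<^sub>L (1 / k) *\<^sub>R 1"
      using loewner_scaleR_mono[of "1 / (k * k)", OF _ T(2)] k1 by simp
    then show "(1 / (k * k)) *\<^sub>R T \<le>\<^sub>L A i" using kA(1)[OF i] by (rule loewner_le_trans)
    have "k *\<^sub>R 1 \<le>\<^sub>L (1 * (k * k)) *\<^sub>R T"
      using loewner_scaleR_mono[of "k * k", OF _ T(1)] k1 by simp
    with kA(2)[OF i] show "A i \<le>\<^sub>L (1 * (k * k)) *\<^sub>R T" by (rule loewner_le_trans)
  qed
  have kk0: "0 < k * k" using kpos by simp
  \<comment> \<open>The order of limits matters: first m tends to infinity at fixed N, by continuity
    of \<open>grad_approx\<close>, and only then N.\<close>
  have "grad_approx (Suc N) Z \<le>\<^sub>L (K * k / Suc N) *\<^sub>R 1" for N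
  proof (rule loewner_limit[OF _ tendsto_const])
    show "(\<lambda>m. grad_approx (Suc N) (X m)) \<longlonglongrightarrow> grad_approx (Suc N) Z"
      by (rule tendsto_grad_approx[OF Z kpos(1) Xge kpos(2) XY(3) kA(2)])
    fix m
    have "grad_approx (Suc N) (X m) \<le>\<^sub>L grad (X m) + (K / Suc N) *\<^sub>R X m"
      using grad_approx_bounds(2)[OF pdX zero_less_one kk0 comp[OF Xge XY(3)], where N = "Suc N"]
      by (simp add: K_def)
    also have "\<dots> \<le>\<^sub>L 0 + (K / Suc N) *\<^sub>R (k *\<^sub>R 1)"
      using K0 by (intro loewner_add_mono XY loewner_scaleR_mono) auto
    finally show "grad_approx (Suc N) (X m) \<le>\<^sub>L (K * k / Suc N) *\<^sub>R 1" by simp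
  qed
  then have upper: "grad Z \<le>\<^sub>L 0"
    using loewner_limit[OF grad_lim[OF pdZ] tendsto_scaleR[OF tendsto_over_Suc[of "K * k"] tendsto_const[of 1]]]
    by simp
  have "0 \<le>\<^sub>L grad_approx (Suc N) Z" for N
  proof (rule loewner_limit)
    show "(\<lambda>m. grad_approx (Suc N) (Y m)) \<longlonglongrightarrow> grad_approx (Suc N) Z"
      by (rule tendsto_grad_approx[OF YZ kpos(1) XY(1) kpos(2) Yle kA(2)])
    show "(\<lambda>m. (- (K * k) / Suc m) *\<^sub>R 1) \<longlonglongrightarrow> (0::'a bounded_op)"
      using tendsto_scaleR[OF tendsto_over_Suc[of "- (K * k)"] tendsto_const[of 1]] by simp
    fix m
    have "(- (K * k) / Suc m) *\<^sub>R 1 \<le>\<^sub>L (- (K / Suc m)) *\<^sub>R Y m"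
    proof -
      have "K / Suc m * qf (Y m) x \<le> K / Suc m * (k * (norm x)\<^sup>2)" for x
        using Yle[of m] K0 by (intro mult_left_mono) (auto simp: loewner_le_iff)
      then show ?thesis using pdY by (auto simp: loewner_le_iff positive_definiteD mult.assoc)
    qed
    also have "\<dots> \<le>\<^sub>L grad (Y m)" by (rule XY(6))
    also have "\<dots> \<le>\<^sub>L grad_approx (Suc N) (Y m)"
      using grad_approx_bounds(1)[OF pdY zero_less_one kk0 comp[OF XY(1) Yle], where N = "Suc N"]
      by simp
    finally show "(- (K * k) / Suc m) *\<^sub>R 1 \<le>\<^sub>L grad_approx (Suc N) (Y m)" .
  qed
  then have "0 \<le>\<^sub>L grad Z" by (rule loewner_limit[OF tendsto_const grad_lim[OF pdZ]])
  with upper have "grad Z = 0" by (rule loewner_antisym)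
  with pdZ show ?thesis by blast
qed

lemma grad_comparison_0:
  assumes "positive_definite Z" "positive_definite Y" "0 \<le>\<^sub>L grad Z" "grad Y \<le>\<^sub>L 0"
  shows "Z \<le>\<^sub>L Y"
  using grad_comparison[of Z Y 0 0] assms by simp

lemma karcher_equation_ex1: "\<exists>!X. positive_definite X \<and> grad X = 0"
proof (rule ex_ex1I[OF karcher_equation_exists])
  fix X Y
  assume X: "positive_definite X \<and> grad X = 0" and Y: "positive_definite Y \<and> grad Y = 0"
  have "X \<le>\<^sub>L Y" "Y \<le>\<^sub>L X"
    by (rule grad_comparison_0; simp add: X Y loewner_le_refl)+
  then show "X = Y" by (rule loewner_antisym)
qed

lemma karcher_equation_iff:
  assumes X: "positive_definite X"
  shows "(\<Sum>i\<in>I. w i *\<^sub>R op_log (op_powr X (- (1/2)) * A i * op_powr X (- (1/2)))) = 0 \<longleftrightarrow> grad X = 0"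
proof -
  define R where "R = op_powr X (- (1/2))"
  have R: "op_invertible R" unfolding R_def by (rule op_powr_minus_half[OF X])
  define F where "F = (\<Sum>i\<in>I. w i *\<^sub>R op_log (R * A i * R))"
  have g: "grad X = op_inv R * F * op_inv R"
    by (simp add: grad_def F_def rel_entropy_def Let_def sum_distrib_left sum_distrib_right flip: R_def)
  have "F = R * grad X * R"
    using R by (simp add: g mult.assoc op_inv)
  with g have "F = 0 \<longleftrightarrow> grad X = 0" by auto
  then show ?thesis by (simp add: F_def R_def)
qed

end

lemma karcher_mean:
  fixes A :: "nat \<Rightarrow> 'a::nonzero_complex_hilbert_space bounded_op"
  assumes "weighted_tuple {1..n} w A"
  shows "positive_definite (karcher_mean n w A)" "weighted_tuple.grad {1..n} w A (karcher_mean n w A) = 0"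
proof -
  interpret weighted_tuple "{1..n}" w A by fact
  let ?P = "\<lambda>X. positive_definite X \<and>
    (\<Sum>i=1..n. w i *\<^sub>R op_log (op_powr X (- (1/2)) * A i * op_powr X (- (1/2)))) = 0"
  have "?P X \<longleftrightarrow> positive_definite X \<and> grad X = 0" for X using karcher_equation_iff by blast
  then have "\<exists>!X. ?P X" using karcher_equation_ex1 by presburger
  then have "?P (karcher_mean n w A)" unfolding karcher_mean_def by (rule theI')
  then show "positive_definite (karcher_mean n w A)" "grad (karcher_mean n w A) = 0"
    using karcher_equation_iff by auto
qed

section \<open>Positive linear maps\<close>

text \<open>Unitality is kept in a separate locale, because \<open>lieb_form\<close> applies
  \<open>kadison\<close> to the map T -> \<Phi>(C T C), which is in general not unital.\<close>

locale positive_map =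
  fixes \<Phi> :: "'a::nonzero_complex_hilbert_space bounded_op \<Rightarrow> 'b::nonzero_complex_hilbert_space bounded_op"
  assumes add: "\<Phi> (S + T) = \<Phi> S + \<Phi> T"
    and scaleR: "\<Phi> (r *\<^sub>R T) = r *\<^sub>R \<Phi> T"
    and pos: "op_positive T \<Longrightarrow> op_positive (\<Phi> T)"
begin

lemma zero: "\<Phi> 0 = 0"
  using scaleR[of 0 0] by simp

lemma diff: "\<Phi> (S - T) = \<Phi> S - \<Phi> T"
  using add[of S "(- 1) *\<^sub>R T"] by (simp only: scaleR) simp

lemma sum: "\<Phi> (\<Sum>i\<in>I. T i) = (\<Sum>i\<in>I. \<Phi> (T i))"
  by (induction I rule: infinite_finite_induct) (simp_all add: zero add)

text \<open>T is the difference of the positive operators \<open>norm T\<close> times 1 and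
  \<open>norm T\<close> times 1 minus T.\<close>

lemma sa:
  assumes T: "op_self_adjoint T"
  shows "op_self_adjoint (\<Phi> T)"
proof -
  let ?c = "norm T *\<^sub>R (1::'a bounded_op)"
  have "op_positive (?c - T)" "op_positive ?c"
    using loewner_norm_bounds(2)[OF T] by (auto simp: loewner_le_def op_positive_iff)
  then have "op_self_adjoint (\<Phi> ?c - \<Phi> (?c - T))" using pos by (auto simp: op_positive_iff)
  then show ?thesis by (simp add: diff)
qed

lemma mono: "S \<le>\<^sub>L T \<Longrightarrow> \<Phi> S \<le>\<^sub>L \<Phi> T"
  using pos[of "T - S"] sa by (auto simp: loewner_le_def diff)

lemma congruence:
  assumes C: "op_self_adjoint C"
  shows "positive_map (\<lambda>T. \<Phi> (C * T * C))"
  by unfold_locales (auto simp: distrib_left distrib_right add scaleR op_positive_iff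
      intro!: pos[unfolded op_positive_iff, simplified] sa_congruence[OF C] simp: qf_congruence[OF C])

text \<open>The matrix \<open>((x\<^sup>2, x), (x, 1))\<close> is positive semidefinite of rank one for every real \<open>x\<close>.
  Since the Bernstein polynomials of \<open>x \<mapsto> x\<close> and \<open>x \<mapsto> x\<^sup>2\<close> are \<open>x\<close> and \<open>x\<^sup>2 + x (1 - x) / n\<close>,
  sampling it at \<open>k / n\<close> yields an inequality that only needs positivity of \<open>\<Phi>\<close>, not complete
  positivity.\<close>

lemma kadison_contraction:
  assumes Q: "op_positive Q" "Q \<le>\<^sub>L 1"
  shows "0 \<le> qf (\<Phi> (Q * Q)) u + 2 * inner (op_apply (\<Phi> Q) u) v + qf (\<Phi> 1) v"
proof -
  have saQ: "op_self_adjoint Q" using Q(1) by (simp add: op_positive_iff)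
  have spec: "rspec Q \<subseteq> {0..1}"
    using Q by (intro rspec_subset) (auto simp: loewner_le_iff op_positive_iff)
  have bound: "0 \<le> (1 / Suc m) * qf (\<Phi> Q) u + (1 - 1 / Suc m) * qf (\<Phi> (Q * Q)) u +
    2 * inner (op_apply (\<Phi> Q) u) v + qf (\<Phi> 1) v" for m
  proof -
    define n where "n = Suc m"
    define b where "b k = smult (real (n choose k)) ([:0, 1:] ^ k * [:1, - 1:] ^ (n - k))" for k
    define B where "B k = op_poly (b k) Q" for k
    have poly_b: "poly (b k) x = Bernstein n k x" for k x
      by (simp add: b_def Bernstein_def)
    have n0: "n \<noteq> 0" by (simp add: n_def)
    have "0 \<le> poly (b k) r" if "r \<in> rspec Q" for k r
      unfolding poly_b using spec that by (intro Bernstein_nonneg) auto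
    then have pB: "op_positive (\<Phi> (B k))" for k
      unfolding B_def by (intro pos op_poly_positive saQ)
    have 0: "(\<Sum>k\<le>n. b k) = 1"
      by (rule poly_eq_poly_eq_iff[THEN iffD1]) (simp add: fun_eq_iff poly_sum poly_b)
    have 1: "(\<Sum>k\<le>n. smult (k / n) (b k)) = [:0, 1:]"
      by (rule poly_eq_poly_eq_iff[THEN iffD1])
        (simp add: fun_eq_iff poly_sum poly_b n0 flip: sum_divide_distrib)
    have 2: "(\<Sum>k\<le>n. smult ((k / n)\<^sup>2) (b k)) = [:0, 1 / n, 1 - 1 / n:]"
    proof (rule poly_eq_poly_eq_iff[THEN iffD1], rule ext)
      fix x
      have "poly (\<Sum>k\<le>n. smult ((k / n)\<^sup>2) (b k)) x =
          (\<Sum>k\<le>n. (real k * (real k - 1) * Bernstein n k x + real k * Bernstein n k x) / n\<^sup>2)"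
        by (simp add: poly_sum poly_b power2_eq_square algebra_simps add_divide_distrib)
      also have "\<dots> = (real n * (real n - 1) * x\<^sup>2 + real n * x) / n\<^sup>2"
        by (simp only: sum_divide_distrib[symmetric] sum.distrib sum_kk_Bernstein sum_k_Bernstein of_nat_id)
      also have "\<dots> = poly [:0, 1 / n, 1 - 1 / n:] x"
        using n0 by (simp add: power2_eq_square field_simps)
      finally show "poly (\<Sum>k\<le>n. smult ((k / n)\<^sup>2) (b k)) x = poly [:0, 1 / n, 1 - 1 / n:] x" .
    qed
    have B0: "(\<Sum>k\<le>n. B k) = 1"
      using arg_cong[OF 0, of "\<lambda>p. op_poly p Q"] by (simp add: B_def one_pCons)
    have B1: "(\<Sum>k\<le>n. (k / n) *\<^sub>R B k) = Q"
      using arg_cong[OF 1, of "\<lambda>p. op_poly p Q"] by (simp add: B_def)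
    have B2: "(\<Sum>k\<le>n. (k / n)\<^sup>2 *\<^sub>R B k) = (1 / n) *\<^sub>R Q + (1 - 1 / n) *\<^sub>R (Q * Q)"
      using arg_cong[OF 2, of "\<lambda>p. op_poly p Q"] by (simp add: B_def distrib_left)
    \<comment> \<open>Each summand is the form, at the pair (u, v), of \<Phi>(B k) tensored with the
      rank-one matrix at x = k / n.\<close>
    have "0 \<le> (\<Sum>k\<le>n. qf (\<Phi> (B k)) ((k / n) *\<^sub>R u + v))"
      using pB by (intro sum_nonneg) (auto simp: op_positive_iff)
    also have "\<dots> = (\<Sum>k\<le>n. (k / n)\<^sup>2 * qf (\<Phi> (B k)) u + 2 * ((k / n) * inner (op_apply (\<Phi> (B k)) u) v) + qf (\<Phi> (B k)) v)"
    proof (rule sum.cong[OF refl])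
      fix k
      have "op_self_adjoint (\<Phi> (B k))" using pB by (simp add: op_positive_iff)
      from op_self_adjointD[OF this, of v u]
      have "inner (op_apply (\<Phi> (B k)) v) u = inner (op_apply (\<Phi> (B k)) u) v" by (simp add: inner_commute)
      then show "qf (\<Phi> (B k)) ((k / n) *\<^sub>R u + v) =
          (k / n)\<^sup>2 * qf (\<Phi> (B k)) u + 2 * ((k / n) * inner (op_apply (\<Phi> (B k)) u) v) + qf (\<Phi> (B k)) v"
        by (simp add: qf_def inner_add_left inner_add_right power2_eq_square algebra_simps)
    qed
    also have "\<dots> = qf (\<Phi> (\<Sum>k\<le>n. (k / n)\<^sup>2 *\<^sub>R B k)) u +
        2 * inner (op_apply (\<Phi> (\<Sum>k\<le>n. (k / n) *\<^sub>R B k)) u) v + qf (\<Phi> (\<Sum>k\<le>n. B k)) v"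
      by (simp add: sum scaleR sum.distrib inner_sum_left sum_distrib_left)
    also have "\<dots> = (1 / n) * qf (\<Phi> Q) u + (1 - 1 / n) * qf (\<Phi> (Q * Q)) u +
        2 * inner (op_apply (\<Phi> Q) u) v + qf (\<Phi> 1) v"
      unfolding B0 B1 B2 by (simp add: add scaleR)
    finally show ?thesis unfolding n_def .
  qed
  have "(\<lambda>m. (1 / Suc m) * qf (\<Phi> Q) u + (1 - 1 / Suc m) * qf (\<Phi> (Q * Q)) u +
      2 * inner (op_apply (\<Phi> Q) u) v + qf (\<Phi> 1) v) \<longlonglongrightarrow>
      0 * qf (\<Phi> Q) u + (1 - 0) * qf (\<Phi> (Q * Q)) u + 2 * inner (op_apply (\<Phi> Q) u) v + qf (\<Phi> 1) v"
    by (intro tendsto_intros tendsto_over_Suc)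
  from tendsto_lowerbound[OF this, of 0] show ?thesis using bound by simp
qed

lemma kadison:
  assumes Q: "op_positive Q"
  shows "0 \<le> qf (\<Phi> (Q * Q)) u + 2 * inner (op_apply (\<Phi> Q) u) v + qf (\<Phi> 1) v"
proof -
  define c where "c = norm Q + 1"
  have c: "0 < c" by (simp add: c_def add_nonneg_pos)
  have saQ: "op_self_adjoint Q" using Q by (simp add: op_positive_iff)
  have "Q \<le>\<^sub>L norm Q *\<^sub>R 1" by (rule loewner_norm_bounds[OF saQ])
  also have "norm Q *\<^sub>R 1 \<le>\<^sub>L c *\<^sub>R 1"
    by (rule loewner_scaleR_left_mono) (simp_all add: c_def positive_definiteD)
  finally have "(1 / c) *\<^sub>R Q \<le>\<^sub>L 1"
    using loewner_scaleR_mono[of "1 / c" Q "c *\<^sub>R 1"] c by simp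
  moreover have "op_positive ((1 / c) *\<^sub>R Q)" using Q c by (auto simp: op_positive_iff)
  \<comment> \<open>Multiplying Q by 1 / c and u by c leaves every term of the claimed inequality
    unchanged.\<close>
  ultimately have "0 \<le> qf (\<Phi> (((1 / c) *\<^sub>R Q) * ((1 / c) *\<^sub>R Q))) (c *\<^sub>R u) +
      2 * inner (op_apply (\<Phi> ((1 / c) *\<^sub>R Q)) (c *\<^sub>R u)) v + qf (\<Phi> 1) v"
    by (intro kadison_contraction)
  then show ?thesis using c by (simp add: scaleR qf_def)
qed

text \<open>Positivity of the block form with diagonal \<Phi>(P T^-1 P), \<Phi>(T) and off-diagonal
  \<Phi>(P). It is \<open>kadison\<close> for the map S -> \<Phi>(C S C) at Q = R P R, where R =
  T^(-1/2) and C = R^-1, so that C Q C = P, C Q Q C = P T^-1 P and C C = T.\<close>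

lemma lieb_form:
  assumes P: "op_positive P" and T: "positive_definite T"
  shows "0 \<le> qf (\<Phi> (P * op_inv T * P)) u + 2 * inner (op_apply (\<Phi> P) u) v + qf (\<Phi> T) v"
proof -
  define R where "R = op_powr T (- (1/2))"
  note R = op_powr_minus_half[OF T, folded R_def]
  define C where "C = op_inv R"
  have C: "op_self_adjoint C" using R by (simp add: C_def sa_op_inv)
  have RC: "C * (R * S) = S" "R * (C * S) = S" "R * C = 1" for S
    using R(2) by (simp_all add: C_def op_inv)
  interpret C: positive_map "\<lambda>T. \<Phi> (C * T * C)" by (rule congruence[OF C])
  have "op_positive (R * P * R)"
    using P R(1) by (auto simp: op_positive_iff sa_congruence qf_congruence)
  note C.kadison[OF this, of u v]
  moreover have "C * (R * P * R) * C = P" by (simp add: mult.assoc RC)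
  moreover have "C * ((R * P * R) * (R * P * R)) * C = P * op_inv T * P"
    by (simp add: mult.assoc RC flip: R(3))
  moreover have "C * 1 * C = T"
  proof -
    have "C * C = C * (R * T * R) * C" by (simp add: R(4))
    also have "\<dots> = T" by (simp add: mult.assoc RC)
    finally show ?thesis by simp
  qed
  ultimately show ?thesis by simp
qed

text \<open>The Schur complement of \<open>lieb_form\<close>: for given u, the form is minimized in
  v at v = - \<Phi>(T)^-1 \<Phi>(P) u.\<close>

lemma lieb:
  assumes P: "op_positive P" and T: "positive_definite T" and \<Phi>T: "positive_definite (\<Phi> T)"
  shows "\<Phi> P * op_inv (\<Phi> T) * \<Phi> P \<le>\<^sub>L \<Phi> (P * op_inv T * P)"
proof -
  have saP: "op_self_adjoint (\<Phi> P)" using pos[OF P] by (simp add: op_positive_iff)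
  have inv: "op_self_adjoint (op_inv (\<Phi> T))" "op_invertible (\<Phi> T)"
    using \<Phi>T by (auto simp: positive_definiteD positive_definite_op_inv)
  have "qf (\<Phi> P * op_inv (\<Phi> T) * \<Phi> P) u \<le> qf (\<Phi> (P * op_inv T * P)) u" for u
  proof -
    define p where "p = op_apply (\<Phi> P) u"
    define v where "v = - op_apply (op_inv (\<Phi> T)) p"
    have "inner p v = - qf (op_inv (\<Phi> T)) p" "qf (\<Phi> T) v = qf (op_inv (\<Phi> T)) p"
      using inv(2) by (simp_all add: v_def qf_def inner_commute)
    then show ?thesis
      using lieb_form[OF P T, of u v] by (simp add: qf_congruence[OF saP] flip: p_def)
  qed
  moreover have "op_self_adjoint (P * op_inv T * P)"
    using P T by (intro sa_congruence) (auto simp: op_positive_iff positive_definiteD positive_definite_op_inv)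
  ultimately show ?thesis
    using sa_congruence[OF saP inv(1)] sa by (auto simp: loewner_le_iff)
qed

end

section \<open>Unital positive maps: inequalities for inverses, harmonic means and relative
  entropy\<close>

locale unital_positive_map = positive_map +
  assumes unital: "\<Phi> 1 = 1"
begin

lemma pd:
  assumes "positive_definite T"
  shows "positive_definite (\<Phi> T)"
proof -
  obtain m where "0 < m" "m *\<^sub>R 1 \<le>\<^sub>L T" using assms unfolding positive_definite_iff by blast
  then show ?thesis using mono[of "m *\<^sub>R 1" T] unfolding positive_definite_iff by (auto simp: scaleR unital)
qed

lemma choi:
  assumes "positive_definite T"
  shows "op_inv (\<Phi> T) \<le>\<^sub>L \<Phi> (op_inv T)"
  using lieb[OF positive_definiteD(3)[OF positive_definite_one] assms pd[OF assms]] by (simp add: unital)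

end

text \<open>Moves all nonlinearity into a term X D^-1 X with D affine in X and A, the shape handled
  by \<open>lieb\<close>. Factoring the sum of inverses gives X D^-1 A, and A = (D - s X) / (1 -
  s).\<close>

lemma wharm_eq:
  assumes X: "positive_definite X" and A: "positive_definite A" and s: "0 \<le> s" "s < 1"
  shows "wharm s X A = (1 / (1 - s)) *\<^sub>R (X - s *\<^sub>R (X * op_inv ((1 - s) *\<^sub>R A + s *\<^sub>R X) * X))"
proof -
  let ?D = "(1 - s) *\<^sub>R A + s *\<^sub>R X"
  have inv: "op_invertible X" "op_invertible A" "op_invertible ?D"
    using positive_definite_convex[OF A X, of s] X A s by (auto simp: positive_definiteD)
  have "(1 - s) *\<^sub>R op_inv X + s *\<^sub>R op_inv A = op_inv A * ?D * op_inv X"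
    using inv by (simp add: distrib_left distrib_right op_inv mult.assoc)
  then have "wharm s X A = X * op_inv ?D * A"
    using inv by (simp add: wharm_def op_inv_times op_invertible_times mult.assoc)
  moreover have "A = (1 / (1 - s)) *\<^sub>R (?D - s *\<^sub>R X)" using s by simp
  then have "X * op_inv ?D * A = X * op_inv ?D * ((1 / (1 - s)) *\<^sub>R (?D - s *\<^sub>R X))" by (rule arg_cong)
  moreover have "\<dots> = (1 / (1 - s)) *\<^sub>R (X * (op_inv ?D * ?D) - s *\<^sub>R (X * op_inv ?D * X))"
    by (simp only: mult_scaleR_right right_diff_distrib mult.assoc)
  ultimately show ?thesis using inv by (simp only: op_inv mult_1_right)
qed

context unital_positive_map
begin

text \<open>By \<open>lieb\<close>, \<Phi> can only increase the term X D^-1 X, which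
  \<open>wharm_eq\<close> subtracts. That formula degenerates at s = 1, where the mean is A
  itself.\<close>

lemma wharm_le:
  assumes X: "positive_definite X" and A: "positive_definite A" and s: "0 \<le> s" "s \<le> 1"
  shows "\<Phi> (wharm s X A) \<le>\<^sub>L wharm s (\<Phi> X) (\<Phi> A)"
proof (cases "s = 1")
  case True
  then show ?thesis
    using A pd[OF A] by (simp add: wharm_def positive_definiteD loewner_le_refl)
next
  case False
  then have s1: "s < 1" using s by simp
  let ?D = "(1 - s) *\<^sub>R A + s *\<^sub>R X"
  have D: "positive_definite ?D" using s by (intro positive_definite_convex A X)
  have \<Phi>D: "\<Phi> ?D = (1 - s) *\<^sub>R \<Phi> A + s *\<^sub>R \<Phi> X" by (simp add: add scaleR)
  have "\<Phi> X * op_inv (\<Phi> ?D) * \<Phi> X \<le>\<^sub>L \<Phi> (X * op_inv ?D * X)"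
    using X by (intro lieb D pd) (simp add: positive_definiteD)
  then have "\<Phi> X - s *\<^sub>R \<Phi> (X * op_inv ?D * X) \<le>\<^sub>L \<Phi> X - s *\<^sub>R (\<Phi> X * op_inv (\<Phi> ?D) * \<Phi> X)"
    using s pd[OF X] by (auto simp: loewner_le_iff positive_definiteD intro: mult_left_mono)
  then show ?thesis
    unfolding wharm_eq[OF X A s(1) s1] wharm_eq[OF pd[OF X] pd[OF A] s(1) s1]
    using s1 by (simp only: scaleR diff \<Phi>D) (auto intro: loewner_scaleR_mono)
qed

text \<open>The approximations lie above \<open>rel_entropy X A\<close>, so \<Phi> is applied at
  finite N and the limit is taken only outside \<Phi>; its continuity does not enter.\<close>

lemma rel_entropy_le:
  assumes X: "positive_definite X" and A: "positive_definite A"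
  shows "\<Phi> (rel_entropy X A) \<le>\<^sub>L rel_entropy (\<Phi> X) (\<Phi> A)"
proof (rule loewner_limit[OF tendsto_const tendsto_rel_entropy_approx'[OF pd[OF X] pd[OF A]]])
  fix N
  obtain k where k: "0 < k" "(1 / k) *\<^sub>R X \<le>\<^sub>L A" "A \<le>\<^sub>L (1 * k) *\<^sub>R X"
    using positive_definite_comparable[OF X A zero_less_one] by blast
  have "\<Phi> (rel_entropy X A) \<le>\<^sub>L \<Phi> (rel_entropy_approx (Suc N) X A)"
    using rel_entropy_approx_bounds(1)[OF X A zero_less_one k, where N = "Suc N"] by (intro mono) simp
  also have "\<Phi> (rel_entropy_approx (Suc N) X A) \<le>\<^sub>L rel_entropy_approx (Suc N) (\<Phi> X) (\<Phi> A)"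
    unfolding rel_entropy_approx_def sum scaleR diff
  proof (intro loewner_sum_mono loewner_scaleR_mono)
    fix j assume "j \<in> {1..Suc N}"
    then have "\<Phi> (wharm (real j / real (Suc N)) X A) \<le>\<^sub>L wharm (real j / real (Suc N)) (\<Phi> X) (\<Phi> A)"
      by (intro wharm_le X A) auto
    then show "\<Phi> (wharm (real j / real (Suc N)) X A) - \<Phi> X \<le>\<^sub>L wharm (real j / real (Suc N)) (\<Phi> X) (\<Phi> A) - \<Phi> X"
      using pd[OF X] by (auto simp: loewner_le_iff positive_definiteD)
  qed simp
  finally show "\<Phi> (rel_entropy X A) \<le>\<^sub>L rel_entropy_approx (Suc N) (\<Phi> X) (\<Phi> A)" .
qed

text \<open>With \<open>Q = \<Phi> (A\<^sup>-\<^sup>1)\<close>, the first inequality is \<open>A + m M A\<^sup>-\<^sup>1 \<le> M + m\<close>, and the second one is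
  \<open>0 \<le> (\<alpha> - \<beta> Q) Q\<^sup>-\<^sup>1 (\<alpha> - \<beta> Q)\<close> with \<open>\<alpha>\<^sup>2 = (M + m)\<^sup>2 / (4 m M)\<close> and \<open>\<beta>\<^sup>2 = m M\<close>.\<close>

lemma kantorovich:
  assumes m: "0 < m" "m *\<^sub>R 1 \<le>\<^sub>L A" "A \<le>\<^sub>L M *\<^sub>R 1" and M: "0 < M"
  shows "\<Phi> A \<le>\<^sub>L ((M + m)\<^sup>2 / (4 * m * M)) *\<^sub>R op_inv (\<Phi> (op_inv A))"
proof -
  have A: "positive_definite A" using m unfolding positive_definite_iff by blast
  have saA: "op_self_adjoint A" using A by (rule positive_definiteD)
  define Q where "Q = \<Phi> (op_inv A)"
  have Q: "positive_definite Q" unfolding Q_def by (intro pd positive_definite_op_inv A)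
  have saQ: "op_self_adjoint Q" "op_self_adjoint (op_inv Q)"
    using Q by (auto simp: positive_definiteD positive_definite_op_inv)
  have "A + (m * M) *\<^sub>R op_inv A \<le>\<^sub>L (M + m) *\<^sub>R 1"
  proof (rule cfc_lim_mono[OF saA _ cfc_lim_const])
    have "cfc_lim (\<lambda>x. 1 / x) A (op_inv A)"
      by (rule cfc_lim_op_inv[OF A cfc_lim_id]) (auto intro!: continuous_intros)
    then show "cfc_lim (\<lambda>x. x + (m * M) * (1 / x)) A (A + (m * M) *\<^sub>R op_inv A)"
      by (intro cfc_lim_add cfc_lim_id cfc_lim_scaleR saA)
    fix x assume "x \<in> rspec A"
    then have x: "m \<le> x" "x \<le> M" using rspec_ge[OF m(2)] rspec_le[OF m(3)] by auto
    then have "0 \<le> (M - x) * (x - m)" by (intro mult_nonneg_nonneg) auto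
    then have "x * x + m * M \<le> (M + m) * x" by (simp add: algebra_simps)
    then show "x + m * M * (1 / x) \<le> M + m" using x m(1) by (simp add: field_simps)
  qed
  from mono[OF this] have "\<Phi> A + (m * M) *\<^sub>R Q \<le>\<^sub>L (M + m) *\<^sub>R 1"
    by (simp add: add scaleR unital Q_def)
  then have 1: "qf (\<Phi> A) x + m * M * qf Q x \<le> (M + m) * (norm x)\<^sup>2" for x
    by (simp add: loewner_le_iff)
  define \<beta> where "\<beta> = sqrt (m * M)"
  define \<alpha> where "\<alpha> = (M + m) / (2 * \<beta>)"
  have \<beta>: "0 < \<beta>" using m M by (simp add: \<beta>_def)
  have sq: "\<beta>\<^sup>2 = m * M" using m M by (simp add: \<beta>_def)
  have \<alpha>: "\<alpha>\<^sup>2 = (M + m)\<^sup>2 / (4 * m * M)" "2 * (\<alpha> * \<beta>) = M + m"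
    using \<beta> by (simp_all add: \<alpha>_def power_divide power_mult_distrib sq)
  define C where "C = \<alpha> *\<^sub>R 1 - \<beta> *\<^sub>R Q"
  have "C * op_inv Q * C = \<alpha>\<^sup>2 *\<^sub>R op_inv Q - (2 * (\<alpha> * \<beta>)) *\<^sub>R 1 + \<beta>\<^sup>2 *\<^sub>R Q"
    using Q by (simp add: C_def algebra_simps op_inv positive_definiteD power2_eq_square flip: scaleR_2)
  moreover have "0 \<le> qf (C * op_inv Q * C) x" for x
    using saQ positive_definite_op_inv[OF Q]
    by (subst qf_congruence) (auto simp: C_def positive_definiteD)
  ultimately have 2: "0 \<le> \<alpha>\<^sup>2 * qf (op_inv Q) x - (M + m) * (norm x)\<^sup>2 + m * M * qf Q x" for x
    by (simp add: \<alpha>(2) sq)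
  have "qf (\<Phi> A) x \<le> \<alpha>\<^sup>2 * qf (op_inv Q) x" for x using 1[of x] 2[of x] by linarith
  then show ?thesis
    unfolding Q_def[symmetric] \<alpha>(1)[symmetric] using sa[OF saA] saQ by (auto simp: loewner_le_iff)
qed

end

text \<open>The constant depends on r = M / m only. For 1 \<le> r \<le> h, clearing denominators
  reduces the claim to 0 \<le> (h - r) (h r - 1).\<close>

lemma kantorovich_constant_mono:
  fixes m M h :: real
  assumes m: "0 < m" "m \<le> M" and h: "M / m \<le> h"
  shows "(M + m)\<^sup>2 / (4 * m * M) \<le> (1 + h)\<^sup>2 / (4 * h)"
proof -
  define r where "r = M / m"
  have r: "1 \<le> r" "r \<le> h" using m h by (simp_all add: r_def)
  have M: "M = r * m" using m by (simp add: r_def)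
  have "(M + m)\<^sup>2 / (4 * m * M) = (1 + r)\<^sup>2 / (4 * r)"
    using m r by (simp add: M power2_eq_square field_simps)
  also have "\<dots> \<le> (1 + h)\<^sup>2 / (4 * h)"
  proof -
    have "1 \<le> h * r" using mult_mono[of 1 h 1 r] r by simp
    then have "0 \<le> (h - r) * (h * r - 1)" using r by (intro mult_nonneg_nonneg) auto
    then have "(1 + r)\<^sup>2 * h \<le> (1 + h)\<^sup>2 * r" by (simp add: power2_eq_square algebra_simps)
    then show ?thesis using r by (simp add: field_simps)
  qed
  finally show ?thesis .
qed

context weighted_tuple
begin

lemma grad_op_inv:
  assumes "positive_definite X"
  shows "(\<Sum>i\<in>I. w i *\<^sub>R rel_entropy (op_inv X) (op_inv (A i))) = - (op_inv X * grad X * op_inv X)"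
proof -
  have "(\<Sum>i\<in>I. w i *\<^sub>R rel_entropy (op_inv X) (op_inv (A i))) =
      (\<Sum>i\<in>I. w i *\<^sub>R - (op_inv X * rel_entropy X (A i) * op_inv X))"
    by (intro sum.cong refl) (simp add: rel_entropy_op_inv[OF assms A])
  then show ?thesis by (simp add: grad_def sum_negf sum_distrib_left sum_distrib_right)
qed

end

theorem theorem4:
  fixes \<Phi> :: "'a::nonzero_complex_hilbert_space bounded_op \<Rightarrow> 'a bounded_op"
    and n :: nat and A :: "nat \<Rightarrow> 'a bounded_op" and w :: "nat \<Rightarrow> real" and h :: real
  assumes "clinear \<Phi>"
    and "\<And>X. op_positive X \<Longrightarrow> op_positive (\<Phi> X)"
    and "\<Phi> 1 = 1"
    and "2 \<le> n"
    and "\<And>i. i \<in> {1..n} \<Longrightarrow> positive_definite (A i)"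
    and "\<And>i. i \<in> {1..n} \<Longrightarrow> 0 < w i \<and> w i < 1"
    and "(\<Sum>i=1..n. w i) = 1"
    and "h = (MAX i\<in>{1..n}. lambda_max (A i) / lambda_min (A i))"
  shows "\<Phi> (karcher_mean n w A) \<le>\<^sub>L karcher_mean n w (\<lambda>i. \<Phi> (A i)) \<and>
         (4 * h / (1 + h)\<^sup>2) *\<^sub>R karcher_mean n w (\<lambda>i. \<Phi> (A i)) \<le>\<^sub>L \<Phi> (karcher_mean n w A)"
proof -
  interpret hom: module_hom scaleC scaleC \<Phi>
    using assms(1) by (simp add: Vector_Spaces.linear_def)
  interpret \<Phi>: unital_positive_map \<Phi>
  proof
    show "\<Phi> (S + T) = \<Phi> S + \<Phi> T" for S T by (rule hom.add)
    show "\<Phi> (r *\<^sub>R T) = r *\<^sub>R \<Phi> T" for r T using hom.scale[of "complex_of_real r" T] by (simp add: scaleC_of_real)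
  qed (use assms(2,3) in auto)
  let ?I = "{1..n}"
  interpret A: weighted_tuple ?I w A by unfold_locales (use assms in \<open>auto intro: less_imp_le\<close>)
  interpret \<Phi>A: weighted_tuple ?I w "\<lambda>i. \<Phi> (A i)"
    by unfold_locales (use A.A A.w A.sum_w in \<open>auto intro: \<Phi>.pd\<close>)
  define X where "X = karcher_mean n w A"
  define Y where "Y = karcher_mean n w (\<lambda>i. \<Phi> (A i))"
  have X: "positive_definite X" "A.grad X = 0"
    unfolding X_def by (rule karcher_mean[OF A.weighted_tuple_axioms])+
  have Y: "positive_definite Y" "\<Phi>A.grad Y = 0"
    unfolding Y_def by (rule karcher_mean[OF \<Phi>A.weighted_tuple_axioms])+
  have grad_le: "\<Phi> (\<Sum>i\<in>?I. w i *\<^sub>R rel_entropy Z (B i)) \<le>\<^sub>L (\<Sum>i\<in>?I. w i *\<^sub>R rel_entropy (\<Phi> Z) (\<Phi> (B i)))"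
    if "positive_definite Z" "\<And>i. i \<in> ?I \<Longrightarrow> positive_definite (B i)" for Z B
    unfolding \<Phi>.sum \<Phi>.scaleR
    by (intro loewner_sum_mono loewner_scaleR_mono \<Phi>.rel_entropy_le that A.w)
  have "\<Phi> X \<le>\<^sub>L Y"
  proof (rule \<Phi>A.grad_comparison_0[OF \<Phi>.pd[OF X(1)] Y(1)])
    have "\<Phi> (A.grad X) \<le>\<^sub>L \<Phi>A.grad (\<Phi> X)"
      unfolding A.grad_def \<Phi>A.grad_def by (intro grad_le X(1) A.A)
    then show "0 \<le>\<^sub>L \<Phi>A.grad (\<Phi> X)" unfolding X(2) \<Phi>.zero .
    show "\<Phi>A.grad Y \<le>\<^sub>L 0" unfolding Y(2) by (intro loewner_le_refl sa_intros)
  qed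
  moreover have "(4 * h / (1 + h)\<^sup>2) *\<^sub>R Y \<le>\<^sub>L \<Phi> X"
  proof -
    define K where "K = (1 + h)\<^sup>2 / (4 * h)"
    \<comment> \<open>W plays the part of \<Phi> X for the inverted tuple, whose Karcher equation is
      solved by \<open>op_inv X\<close>.\<close>
    define W where "W = \<Phi> (op_inv X)"
    have W: "positive_definite W" unfolding W_def by (intro \<Phi>.pd positive_definite_op_inv X)
    have V: "positive_definite (op_inv W)" by (rule positive_definite_op_inv[OF W])
    interpret \<Phi>A': weighted_tuple ?I w "\<lambda>i. \<Phi> (op_inv (A i))"
      by unfold_locales (use A.A A.w A.sum_w in \<open>auto intro: \<Phi>.pd positive_definite_op_inv\<close>)
    have hi: "1 \<le> h \<and> \<Phi> (A i) \<le>\<^sub>L K *\<^sub>R op_inv (\<Phi> (op_inv (A i)))" if i: "i \<in> ?I" for i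
    proof -
      define m where "m = lambda_min (A i)"
      define M where "M = lambda_max (A i)"
      note sa = positive_definiteD(2)[OF A.A[OF i]]
      have m: "0 < m" "m *\<^sub>R 1 \<le>\<^sub>L A i" "A i \<le>\<^sub>L M *\<^sub>R 1" "m \<le> M"
        using lambda_min[OF sa] lambda_max[OF sa] rspec_positive[OF A.A[OF i]] rspec_ge
        by (auto simp: m_def M_def)
      have "M / m \<le> h" unfolding assms(8) m_def M_def using i by (intro Max_ge) auto
      moreover have "1 \<le> M / m" using m by simp
      ultimately have h: "M / m \<le> h" "1 \<le> h" by auto
      have "\<Phi> (A i) \<le>\<^sub>L ((M + m)\<^sup>2 / (4 * m * M)) *\<^sub>R op_inv (\<Phi> (op_inv (A i)))"
        using m by (intro \<Phi>.kantorovich) auto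
      also have "\<dots> \<le>\<^sub>L K *\<^sub>R op_inv (\<Phi> (op_inv (A i)))"
        unfolding K_def
        by (intro loewner_scaleR_left_mono kantorovich_constant_mono positive_definiteD(3)
            positive_definite_op_inv \<Phi>A'.A i m h)
      finally show ?thesis using h by simp
    qed
    then have h: "1 \<le> h" using A.I_nonempty by blast
    have K: "0 < K" "1 / K = 4 * h / (1 + h)\<^sup>2" using h by (simp_all add: K_def)
    have "\<Phi> (\<Sum>i\<in>?I. w i *\<^sub>R rel_entropy (op_inv X) (op_inv (A i))) \<le>\<^sub>L \<Phi>A'.grad W"
      unfolding \<Phi>A'.grad_def W_def by (intro grad_le positive_definite_op_inv X(1) A.A)
    moreover have "(\<Sum>i\<in>?I. w i *\<^sub>R rel_entropy (op_inv X) (op_inv (A i))) = 0"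
      unfolding A.grad_op_inv[OF X(1)] X(2) by simp
    ultimately have "\<Phi> 0 \<le>\<^sub>L \<Phi>A'.grad W" by (simp only:)
    \<comment> \<open>Conjugating prepares \<open>grad_op_inv\<close>, whose minus sign turns the
      lower solution W for the operators \<Phi>(A i^-1) into the upper solution W^-1 for their
      inverses.\<close>
    then have "op_inv W * 0 * op_inv W \<le>\<^sub>L op_inv W * \<Phi>A'.grad W * op_inv W"
      unfolding \<Phi>.zero by (intro loewner_congruence positive_definiteD(2)[OF V])
    then have neg: "(\<Sum>i\<in>?I. w i *\<^sub>R rel_entropy (op_inv W) (op_inv (\<Phi> (op_inv (A i))))) \<le>\<^sub>L 0"
      unfolding \<Phi>A'.grad_op_inv[OF W] by (auto simp: loewner_le_iff)
    \<comment> \<open>By the Kantorovich bound in \<open>hi\<close>, replacing each \<Phi>(A i) by K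
      times the inverse of \<Phi>(A i^-1) can only increase the entropy. Then K factors out by
      homogeneity, so K W^-1 is an upper solution for the tuple \<Phi>(A i).\<close>
    have "\<Phi>A.grad (K *\<^sub>R op_inv W) \<le>\<^sub>L
        (\<Sum>i\<in>?I. w i *\<^sub>R rel_entropy (K *\<^sub>R op_inv W) (K *\<^sub>R op_inv (\<Phi> (op_inv (A i)))))"
      unfolding \<Phi>A.grad_def
      by (intro loewner_sum_mono loewner_scaleR_mono rel_entropy_mono_right positive_definite_scaleR
          K V \<Phi>A.A A.w) (use hi in auto)
    also have "\<dots> = K *\<^sub>R (\<Sum>i\<in>?I. w i *\<^sub>R rel_entropy (op_inv W) (op_inv (\<Phi> (op_inv (A i)))))"
      unfolding scaleR_sum_right
      by (intro sum.cong refl) (use K V \<Phi>A'.A in \<open>simp add: rel_entropy_scaleR positive_definite_op_inv\<close>)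
    also have "\<dots> \<le>\<^sub>L K *\<^sub>R 0" using K by (intro loewner_scaleR_mono neg) simp
    finally have "\<Phi>A.grad (K *\<^sub>R op_inv W) \<le>\<^sub>L 0" by simp
    moreover have "0 \<le>\<^sub>L \<Phi>A.grad Y" unfolding Y(2) by (intro loewner_le_refl sa_intros)
    ultimately have "Y \<le>\<^sub>L K *\<^sub>R op_inv W"
      using \<Phi>A.grad_comparison_0[OF Y(1) positive_definite_scaleR[OF K(1) V]] by blast
    also have "\<dots> \<le>\<^sub>L K *\<^sub>R \<Phi> X"
      using \<Phi>.choi[OF positive_definite_op_inv[OF X(1)]] K X(1)
      by (intro loewner_scaleR_mono) (simp_all add: W_def positive_definiteD)
    finally have "(1 / K) *\<^sub>R Y \<le>\<^sub>L (1 / K) *\<^sub>R K *\<^sub>R \<Phi> X"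
      using K(1) by (intro loewner_scaleR_mono) simp
    also have "\<dots> = \<Phi> X" using K(1) by simp
    finally show ?thesis unfolding K(2) .
  qed
  ultimately show ?thesis unfolding X_def Y_def by blast
qed

end
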